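(* Let $G=\mathbb Z_2^3$, written additively, and let $\mathcal F:G\times G\to\{\pm1\}$ be the octonion cochain $$\mathcal F(\vec a,\vec b)=(-1)^{\vec a^{T}M\vec b+a_1b_2b_3+b_1a_2b_3+b_1b_2a_3},\qquad M=\left(\begin{array}{ccc}1&1&1\\0&1&1\\0&0&1\end{array}\right),$$ viewed as an element of $H\otimes H$ with $H=\mathbb C(G)$. Then $\mathcal F$ obeys the reality condition $( *S\otimes *S)(\mathcal F)=\mathcal F$, and hence the category ${}_{H^{\mathcal F}}\mathcal M$ of $\mathbb Z_2^3$-graded complex vector spaces is a bar category with $$\mathrm{bb}_V(v)=\overline{\overline v},\qquad \Upsilon_{V,W}(\overline{v\otimes w})=\overline w\otimes\overline v\cdot\left\{\begin{array}{cl}-1 & \text{if }|v|\neq 0,\ |w|\neq 0,\ |v|\ne|w|\\ 1&\text{otherwise}\end{array}\right.$$ on elements of homogeneous degree in objects $V,W$. Moreover the octonions $\mathbb O$ are a $\star$-algebra in this category, with $\star(e_{\vec a})=\overline{e_{\vec a}^*}$, $e_{\vec a}^*=e_{-\vec a}$ (extended antilinearly) in the basis $\{e_{\vec a}\}$.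
   Context: $H=\mathbb C(G)$ is the Hopf algebra of functions on $G$ with basis of delta-functions $\delta_{\vec a}$, pointwise product, $\Delta\delta_{\vec a}=\sum_{\vec b+\vec c=\vec a}\delta_{\vec b}\otimes\delta_{\vec c}$, $\epsilon(\delta_{\vec a})=\delta_{\vec a,0}$, $S\delta_{\vec a}=\delta_{-\vec a}$, $\delta_{\vec a}^*=\delta_{\vec a}$ ($*$ antilinear); $*S$ is the map $h\mapsto(Sh)^*$. A left $H$-module is a $G$-graded complex vector space, $\delta_{\vec a}$ acting as projection to degree $\vec a$; $|v|$ denotes the degree of a homogeneous element. ${}_{H^{\mathcal F}}\mathcal M$ is the category of such spaces with the usual tensor product and grading and with associator $$\Phi((u\otimes v)\otimes w)=\phi(|u|,|v|,|w|)\,u\otimes(v\otimes w),\qquad \phi(\vec a,\vec b,\vec c)=\frac{\mathcal F(\vec b,\vec c)\mathcal F(\vec a,\vec b+\vec c)}{\mathcal F(\vec a+\vec b,\vec c)\mathcal F(\vec a,\vec b)}=(-1)^{\vec a\cdot(\vec b\times\vec c)}.$$ The bar functor sends $V$ to the conjugate vector space $\overline V$ (same abelian group, elements written $\overline v$, $\lambda\overline v=\overline{\overline\lambda v}$) with grading determined by $h\triangleright\overline v=\overline{(Sh)^*\triangleright v}$, i.e. $|\overline v|=-|v|=|v|$; $\overline\theta(\overline v)=\overline{\theta(v)}$; $\star:\mathbb C\to\overline{\mathbb C}$ is complex conjugation. The octonions are here the (complex) algebra $\mathbb O$ with basis $\{e_{\vec a}\}_{\vec a\in G}$, $|e_{\vec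 a}|=\vec a$, and product $e_{\vec a}\bullet e_{\vec b}=\mathcal F(\vec a,\vec b)e_{\vec a+\vec b}$. A bar category is a monoidal category (associator $\Phi_{X,Y,Z}:(X\otimes Y)\otimes Z\to X\otimes(Y\otimes Z)$, unit isomorphisms $l_X:X\to X\otimes 1$, $r_X:X\to 1\otimes X$) with a functor $X\mapsto\overline X$, a natural isomorphism $\mathrm{bb}_X:X\to\overline{\overline X}$, an invertible morphism $\star:1\to\overline 1$ and a natural isomorphism $\Upsilon_{X,Y}:\overline{X\otimes Y}\to\overline Y\otimes\overline X$ such that (a) $(\star^{-1}\otimes\mathrm{id})\Upsilon_{X,1}\overline{l_X}=r_{\overline X}$, $(\mathrm{id}\otimes\star^{-1})\Upsilon_{1,X}\overline{r_X}=l_{\overline X}$; (b) $\Phi_{\overline Z,\overline Y,\overline X}(\Upsilon_{Y,Z}\otimes\mathrm{id})\Upsilon_{X,Y\otimes Z}\overline{\Phi_{X,Y,Z}}=(\mathrm{id}\otimes\Upsilon_{X,Y})\Upsilon_{X\otimes Y,Z}$; (c) $\overline\star\,\star=\mathrm{bb}_1$; (d) $\overline{\mathrm{bb}_X}=\mathrm{bb}_{\overline X}$. A $\star$-algebra in a bar category is an object $B$ with a product $\mu:B\otimes B\to B$ and unit $\eta:1\to B$ (morphisms, associative with respect to $\Phi$, unital) and a morphism $\star_B:B\to\overline B$ with $\overline{\star_B}\,\star_B=\mathrm{bb}_B$, $\overline\mu\,\Upsilon_{B,B}^{-1}(\star_B\otimes\star_B)=\star_B\,\mu$ and $\overline\eta\,\star=\star_B\,\eta$.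 *)

theory Defs
  imports
    "HOL-Analysis.Analysis"
    "HOL-Library.Z2"
    "HOL-Algebra.Module"
begin

section \<open>Bar categories\<close>

text \<open>
  Arrows know their domain and codomain; composition and the functors on arrows are only
  constrained on arrows of the category. The unit isomorphisms have the directions
  \<open>lunit X : X \<rightarrow> X \<boxtimes> 1\<close> and \<open>runit X : X \<rightarrow> 1 \<boxtimes> X\<close>.
\<close>

record ('o, 'm) cat_struct =
  Obj :: "'o set"
  Arr :: "'m set"
  Dom :: "'m \<Rightarrow> 'o"
  Cod :: "'m \<Rightarrow> 'o"
  Idn :: "'o \<Rightarrow> 'm"
  Cmp :: "'m \<Rightarrow> 'm \<Rightarrow> 'm"  (infixl \<open>\<cdot>\<index>\<close> 65)

record ('o, 'm) monoidal_struct = "('o, 'm) cat_struct" +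
  tensO :: "'o \<Rightarrow> 'o \<Rightarrow> 'o"  (infixl \<open>\<boxtimes>\<index>\<close> 70)
  tensA :: "'m \<Rightarrow> 'm \<Rightarrow> 'm"  (infixl \<open>\<boxdot>\<index>\<close> 70)
  unitO :: 'o  (\<open>\<I>\<index>\<close>)
  assoc :: "'o \<Rightarrow> 'o \<Rightarrow> 'o \<Rightarrow> 'm"  (\<open>\<Phi>\<index>\<close>)
  lunit :: "'o \<Rightarrow> 'm"
  runit :: "'o \<Rightarrow> 'm"

record ('o, 'm) bar_struct = "('o, 'm) monoidal_struct" +
  barO :: "'o \<Rightarrow> 'o"
  barA :: "'m \<Rightarrow> 'm"
  bb :: "'o \<Rightarrow> 'm"
  starI :: 'm
  Ups :: "'o \<Rightarrow> 'o \<Rightarrow> 'm"  (\<open>\<Upsilon>\<index>\<close>)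

definition Hom :: "('o, 'm, 'z) cat_struct_scheme \<Rightarrow> 'o \<Rightarrow> 'o \<Rightarrow> 'm set" where
  "Hom C X Y = {f \<in> Arr C. Dom C f = X \<and> Cod C f = Y}"

definition is_inverse :: "('o, 'm, 'z) cat_struct_scheme \<Rightarrow> 'm \<Rightarrow> 'm \<Rightarrow> bool" where
  "is_inverse C f g \<longleftrightarrow> f \<in> Arr C \<and> g \<in> Hom C (Cod C f) (Dom C f) \<and>
     g \<cdot>\<^bsub>C\<^esub> f = Idn C (Dom C f) \<and> f \<cdot>\<^bsub>C\<^esub> g = Idn C (Cod C f)"

definition Iso :: "('o, 'm, 'z) cat_struct_scheme \<Rightarrow> 'o \<Rightarrow> 'o \<Rightarrow> 'm set" where
  "Iso C X Y = {f \<in> Hom C X Y. \<exists>g. is_inverse C f g}"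

definition inv_arr :: "('o, 'm, 'z) cat_struct_scheme \<Rightarrow> 'm \<Rightarrow> 'm" where
  "inv_arr C f = (THE g. is_inverse C f g)"

locale cat =
  fixes C :: "('o, 'm, 'z) cat_struct_scheme" (structure)
  assumes Dom_Obj: "f \<in> Arr C \<Longrightarrow> Dom C f \<in> Obj C"
    and Cod_Obj: "f \<in> Arr C \<Longrightarrow> Cod C f \<in> Obj C"
    and Idn_Hom: "X \<in> Obj C \<Longrightarrow> Idn C X \<in> Hom C X X"
    and Cmp_Hom: "\<lbrakk>f \<in> Hom C X Y; g \<in> Hom C Y Z\<rbrakk> \<Longrightarrow> g \<cdot> f \<in> Hom C X Z"
    and Cmp_Idn: "f \<in> Hom C X Y \<Longrightarrow> f \<cdot> Idn C X = f"
    and Idn_Cmp: "f \<in> Hom C X Y \<Longrightarrow> Idn C Y \<cdot> f = f"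
    and Cmp_assoc: "\<lbrakk>f \<in> Hom C W X; g \<in> Hom C X Y; h \<in> Hom C Y Z\<rbrakk>
          \<Longrightarrow> (h \<cdot> g) \<cdot> f = h \<cdot> (g \<cdot> f)"

locale monoidal_cat = cat C for C :: "('o, 'm, 'z) monoidal_struct_scheme" (structure) +
  assumes unit_Obj: "\<I> \<in> Obj C"
    and tens_Obj: "\<lbrakk>X \<in> Obj C; Y \<in> Obj C\<rbrakk> \<Longrightarrow> X \<boxtimes> Y \<in> Obj C"
    and tens_Hom: "\<lbrakk>f \<in> Hom C X X'; g \<in> Hom C Y Y'\<rbrakk>
          \<Longrightarrow> f \<boxdot> g \<in> Hom C (X \<boxtimes> Y) (X' \<boxtimes> Y')"
    and tens_Idn: "\<lbrakk>X \<in> Obj C; Y \<in> Obj C\<rbrakk> \<Longrightarrow> Idn C X \<boxdot> Idn C Y = Idn C (X \<boxtimes> Y)"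
    and tens_Cmp: "\<lbrakk>f \<in> Hom C X X'; f' \<in> Hom C X' X''; g \<in> Hom C Y Y'; g' \<in> Hom C Y' Y''\<rbrakk>
          \<Longrightarrow> (f' \<cdot> f) \<boxdot> (g' \<cdot> g) = (f' \<boxdot> g') \<cdot> (f \<boxdot> g)"
    and assoc_Iso: "\<lbrakk>X \<in> Obj C; Y \<in> Obj C; Z \<in> Obj C\<rbrakk>
          \<Longrightarrow> \<Phi> X Y Z \<in> Iso C ((X \<boxtimes> Y) \<boxtimes> Z) (X \<boxtimes> (Y \<boxtimes> Z))"
    and assoc_natural: "\<lbrakk>f \<in> Hom C X X'; g \<in> Hom C Y Y'; h \<in> Hom C Z Z'\<rbrakk>
          \<Longrightarrow> \<Phi> X' Y' Z' \<cdot> ((f \<boxdot> g) \<boxdot> h) = (f \<boxdot> (g \<boxdot> h)) \<cdot> \<Phi> X Y Z"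
    and lunit_Iso: "X \<in> Obj C \<Longrightarrow> lunit C X \<in> Iso C X (X \<boxtimes> \<I>)"
    and lunit_natural: "f \<in> Hom C X Y \<Longrightarrow> lunit C Y \<cdot> f = (f \<boxdot> Idn C \<I>) \<cdot> lunit C X"
    and runit_Iso: "X \<in> Obj C \<Longrightarrow> runit C X \<in> Iso C X (\<I> \<boxtimes> X)"
    and runit_natural: "f \<in> Hom C X Y \<Longrightarrow> runit C Y \<cdot> f = (Idn C \<I> \<boxdot> f) \<cdot> runit C X"
    and pentagon: "\<lbrakk>W \<in> Obj C; X \<in> Obj C; Y \<in> Obj C; Z \<in> Obj C\<rbrakk>
          \<Longrightarrow> \<Phi> W X (Y \<boxtimes> Z) \<cdot> \<Phi> (W \<boxtimes> X) Y Z
              = (Idn C W \<boxdot> \<Phi> X Y Z) \<cdot> \<Phi> W (X \<boxtimes> Y) Z \<cdot> (\<Phi> W X Y \<boxdot> Idn C Z)"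
    and triangle: "\<lbrakk>X \<in> Obj C; Y \<in> Obj C\<rbrakk>
          \<Longrightarrow> \<Phi> X \<I> Y \<cdot> (lunit C X \<boxdot> Idn C Y) = Idn C X \<boxdot> runit C Y"

locale bar_cat = monoidal_cat C for C :: "('o, 'm, 'z) bar_struct_scheme" (structure) +
  assumes bar_Obj: "X \<in> Obj C \<Longrightarrow> barO C X \<in> Obj C"
    and bar_Hom: "f \<in> Hom C X Y \<Longrightarrow> barA C f \<in> Hom C (barO C X) (barO C Y)"
    and bar_Idn: "X \<in> Obj C \<Longrightarrow> barA C (Idn C X) = Idn C (barO C X)"
    and bar_Cmp: "\<lbrakk>f \<in> Hom C X Y; g \<in> Hom C Y Z\<rbrakk> \<Longrightarrow> barA C (g \<cdot> f) = barA C g \<cdot> barA C f"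
    and bb_Iso: "X \<in> Obj C \<Longrightarrow> bb C X \<in> Iso C X (barO C (barO C X))"
    and bb_natural: "f \<in> Hom C X Y \<Longrightarrow> bb C Y \<cdot> f = barA C (barA C f) \<cdot> bb C X"
    and star_Iso: "starI C \<in> Iso C \<I> (barO C \<I>)"
    and Ups_Iso: "\<lbrakk>X \<in> Obj C; Y \<in> Obj C\<rbrakk>
          \<Longrightarrow> \<Upsilon> X Y \<in> Iso C (barO C (X \<boxtimes> Y)) (barO C Y \<boxtimes> barO C X)"
    and Ups_natural: "\<lbrakk>f \<in> Hom C X X'; g \<in> Hom C Y Y'\<rbrakk>
          \<Longrightarrow> \<Upsilon> X' Y' \<cdot> barA C (f \<boxdot> g) = (barA C g \<boxdot> barA C f) \<cdot> \<Upsilon> X Y"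
    and bar_lunit: "X \<in> Obj C
          \<Longrightarrow> (inv_arr C (starI C) \<boxdot> Idn C (barO C X)) \<cdot> \<Upsilon> X \<I> \<cdot> barA C (lunit C X)
              = runit C (barO C X)"
    and bar_runit: "X \<in> Obj C
          \<Longrightarrow> (Idn C (barO C X) \<boxdot> inv_arr C (starI C)) \<cdot> \<Upsilon> \<I> X \<cdot> barA C (runit C X)
              = lunit C (barO C X)"
    and bar_assoc: "\<lbrakk>X \<in> Obj C; Y \<in> Obj C; Z \<in> Obj C\<rbrakk>
          \<Longrightarrow> \<Phi> (barO C Z) (barO C Y) (barO C X) \<cdot> (\<Upsilon> Y Z \<boxdot> Idn C (barO C X))
                \<cdot> \<Upsilon> X (Y \<boxtimes> Z) \<cdot> barA C (\<Phi> X Y Z)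
              = (Idn C (barO C Z) \<boxdot> \<Upsilon> X Y) \<cdot> \<Upsilon> (X \<boxtimes> Y) Z"
    and bar_star: "barA C (starI C) \<cdot> starI C = bb C \<I>"
    and bar_bb: "X \<in> Obj C \<Longrightarrow> barA C (bb C X) = bb C (barO C X)"

locale star_algebra = bar_cat C for C :: "('o, 'm, 'z) bar_struct_scheme" (structure) +
  fixes B :: 'o and \<mu> \<eta> \<sigma> :: 'm
  assumes B_Obj: "B \<in> Obj C"
    and product_Hom: "\<mu> \<in> Hom C (B \<boxtimes> B) B"
    and unit_Hom: "\<eta> \<in> Hom C \<I> B"
    and star_Hom: "\<sigma> \<in> Hom C B (barO C B)"
    and product_assoc: "\<mu> \<cdot> (\<mu> \<boxdot> Idn C B) = \<mu> \<cdot> (Idn C B \<boxdot> \<mu>) \<cdot> \<Phi> B B B"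
    and product_unit_right: "\<mu> \<cdot> (Idn C B \<boxdot> \<eta>) \<cdot> lunit C B = Idn C B"
    and product_unit_left: "\<mu> \<cdot> (\<eta> \<boxdot> Idn C B) \<cdot> runit C B = Idn C B"
    and star_star: "barA C \<sigma> \<cdot> \<sigma> = bb C B"
    and star_product: "barA C \<mu> \<cdot> inv_arr C (\<Upsilon> B B) \<cdot> (\<sigma> \<boxdot> \<sigma>) = \<sigma> \<cdot> \<mu>"
    and star_unit: "barA C \<eta> \<cdot> starI C = \<sigma> \<cdot> \<eta>"


section \<open>The octonion cochain\<close>

type_synonym G = "bit ^ 3"

definition bit_sign :: "bit \<Rightarrow> complex" where
  "bit_sign x = (if x = 0 then 1 else - 1)"

definition oct_M :: "bit ^ 3 ^ 3" where
  "oct_M = vector [vector [1, 1, 1], vector [0, 1, 1], vector [0, 0, 1]]"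

definition oct_F :: "G \<Rightarrow> G \<Rightarrow> complex" where
  "oct_F a b = bit_sign ((\<Sum>i\<in>UNIV. a $ i * (oct_M *v b) $ i)
     + a $ 1 * b $ 2 * b $ 3 + b $ 1 * a $ 2 * b $ 3 + b $ 1 * b $ 2 * a $ 3)"

definition oct_phi :: "G \<Rightarrow> G \<Rightarrow> G \<Rightarrow> complex" where
  "oct_phi a b c = (oct_F b c * oct_F a (b + c)) / (oct_F (a + b) c * oct_F a b)"

lemma bit_sign_mult: "bit_sign x * bit_sign y = bit_sign (x + y)"
  and bit_sign_divide: "bit_sign x / bit_sign y = bit_sign (x + y)"
  by (cases x; cases y; simp add: bit_sign_def)+

lemma bit_add_self: "x + x = (0 :: bit)"
  and bit_add_self_left: "x + (x + y) = (y :: bit)"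
  by (cases x; cases y; simp)+

text \<open>The coboundary of \<open>oct_F\<close> is the sign with exponent the triple product of its arguments.\<close>

lemma oct_phi_eq:
  "oct_phi a b c = bit_sign (a $ 1 * (b $ 2 * c $ 3 - b $ 3 * c $ 2)
     + a $ 2 * (b $ 3 * c $ 1 - b $ 1 * c $ 3) + a $ 3 * (b $ 1 * c $ 2 - b $ 2 * c $ 1))"
  unfolding oct_phi_def oct_F_def oct_M_def bit_sign_mult bit_sign_divide
  by (rule arg_cong[where f = bit_sign],
      simp only: sum_3 matrix_vector_mult_def vec_lambda_beta vector_3 vector_add_component
        minus_bit_def mult_zero_left mult_1_left add_0_left add_0_right distrib_left distrib_right
        ac_simps bit_add_self bit_add_self_left)

definition delta :: "G \<Rightarrow> G \<Rightarrow> complex" where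
  "delta a = (\<lambda>x. if x = a then 1 else 0)"

definition antipode :: "(G \<Rightarrow> complex) \<Rightarrow> G \<Rightarrow> complex" where
  "antipode h = (\<lambda>x. h (- x))"

definition star_H :: "(G \<Rightarrow> complex) \<Rightarrow> G \<Rightarrow> complex" where
  "star_H h = (\<lambda>x. cnj (h x))"

definition starS :: "(G \<Rightarrow> complex) \<Rightarrow> G \<Rightarrow> complex" where
  "starS h = star_H (antipode h)"

lemma starS_delta: "starS (delta a) = delta (- a)"
  by (auto simp: starS_def star_H_def antipode_def delta_def fun_eq_iff minus_equation_iff)

text \<open>
  As \<open>G\<close> is finite, \<open>H \<otimes> H\<close> is the space of functions on \<open>G \<times> G\<close>, with
  \<open>(g \<otimes> h) (x, y) = g x * h y\<close>. The tensor product of two antilinear maps is the antilinear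
  map given on the basis \<open>delta a \<otimes> delta b\<close> by \<open>A (delta a) \<otimes> B (delta b)\<close>.
\<close>

definition tensor_H :: "(G \<Rightarrow> complex) \<Rightarrow> (G \<Rightarrow> complex) \<Rightarrow> G \<times> G \<Rightarrow> complex" where
  "tensor_H g h = (\<lambda>(x, y). g x * h y)"

definition antilinear_tensor ::
  "((G \<Rightarrow> complex) \<Rightarrow> (G \<Rightarrow> complex)) \<Rightarrow> ((G \<Rightarrow> complex) \<Rightarrow> (G \<Rightarrow> complex)) \<Rightarrow>
   (G \<times> G \<Rightarrow> complex) \<Rightarrow> (G \<times> G \<Rightarrow> complex)" where
  "antilinear_tensor A B T =
     (\<lambda>p. \<Sum>a\<in>UNIV. \<Sum>b\<in>UNIV. cnj (T (a, b)) * tensor_H (A (delta a)) (B (delta b)) p)"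


section \<open>Graded complex vector spaces\<close>

text \<open>
  The objects of the category are graded spaces whose vectors lie in a fixed type that is closed
  under the formation of tensor products and contains the ground field; \<open>Atom\<close> makes spaces over
  an arbitrary type \<open>'a\<close> available. \<open>Formal_Sum [(v1, w1), \<dots>, (vn, wn)]\<close> serves to represent
  the tensor \<open>v1 \<otimes> w1 + \<dots> + vn \<otimes> wn\<close>.
\<close>

datatype 'a gvec =
    Atom 'a
  | Scalar (scalar_of: complex)
  | Func (func_of: "G \<Rightarrow> complex")
  | Formal_Sum (terms_of: "('a gvec \<times> 'a gvec) list")

definition complex_ring :: "complex ring" where
  "complex_ring = \<lparr>carrier = UNIV, monoid.mult = (*), one = 1, zero = 0, add = (+)\<rparr>"

text \<open>The fields \<open>mult\<close> and \<open>one\<close> that modules inherit from rings are not used.\<close>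

record 'v gspace = "(complex, 'v) module" +
  hcomp :: "G \<Rightarrow> 'v set"

definition graded_space :: "'v gspace \<Rightarrow> bool" where
  "graded_space V \<longleftrightarrow> module complex_ring V \<and>
     (\<forall>a. submodule (hcomp V a) complex_ring V) \<and>
     (\<forall>v\<in>carrier V. \<exists>!p. (\<forall>a. p a \<in> hcomp V a) \<and> v = (\<Oplus>\<^bsub>V\<^esub>a\<in>UNIV. p a))"

record 'v garrow =
  src :: "'v gspace"
  tgt :: "'v gspace"
  fn :: "'v \<Rightarrow> 'v"

definition graded_map :: "'v garrow \<Rightarrow> bool" where
  "graded_map f \<longleftrightarrow> graded_space (src f) \<and> graded_space (tgt f) \<and>
     fn f \<in> carrier (src f) \<rightarrow>\<^sub>E carrier (tgt f) \<and>
     (\<forall>v\<in>carrier (src f). \<forall>w\<in>carrier (src f).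
        fn f (v \<oplus>\<^bsub>src f\<^esub> w) = fn f v \<oplus>\<^bsub>tgt f\<^esub> fn f w) \<and>
     (\<forall>c. \<forall>v\<in>carrier (src f). fn f (c \<odot>\<^bsub>src f\<^esub> v) = c \<odot>\<^bsub>tgt f\<^esub> fn f v) \<and>
     (\<forall>a. fn f ` hcomp (src f) a \<subseteq> hcomp (tgt f) a)"

definition mk_garrow :: "'v gspace \<Rightarrow> 'v gspace \<Rightarrow> ('v \<Rightarrow> 'v) \<Rightarrow> 'v garrow" where
  "mk_garrow V W h = \<lparr>src = V, tgt = W, fn = restrict h (carrier V)\<rparr>"

definition the_graded_map :: "'v gspace \<Rightarrow> 'v gspace \<Rightarrow> (('v \<Rightarrow> 'v) \<Rightarrow> bool) \<Rightarrow> 'v garrow" where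
  "the_graded_map V W P = (THE f. graded_map f \<and> src f = V \<and> tgt f = W \<and> P (fn f))"

subsection \<open>Tensor products\<close>

text \<open>
  The tensor product is the quotient of the formal sums of pairs of vectors by the congruence
  generated by commutativity, bi-additivity and balancedness.
\<close>

inductive tensor_eq :: "'v gspace \<Rightarrow> 'v gspace \<Rightarrow> ('v \<times> 'v) list \<Rightarrow> ('v \<times> 'v) list \<Rightarrow> bool"
  for V W :: "'v gspace" where
  refl: "set xs \<subseteq> carrier V \<times> carrier W \<Longrightarrow> tensor_eq V W xs xs"
| sym: "tensor_eq V W xs ys \<Longrightarrow> tensor_eq V W ys xs"
| trans: "\<lbrakk>tensor_eq V W xs ys; tensor_eq V W ys zs\<rbrakk> \<Longrightarrow> tensor_eq V W xs zs"
| append: "\<lbrakk>tensor_eq V W xs xs'; tensor_eq V W ys ys'\<rbrakk> \<Longrightarrow> tensor_eq V W (xs @ ys) (xs' @ ys')"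
| commute: "\<lbrakk>set xs \<subseteq> carrier V \<times> carrier W; set ys \<subseteq> carrier V \<times> carrier W\<rbrakk>
    \<Longrightarrow> tensor_eq V W (xs @ ys) (ys @ xs)"
| zero: "w \<in> carrier W \<Longrightarrow> tensor_eq V W [(\<zero>\<^bsub>V\<^esub>, w)] []"
| add_left: "\<lbrakk>v \<in> carrier V; v' \<in> carrier V; w \<in> carrier W\<rbrakk>
    \<Longrightarrow> tensor_eq V W [(v \<oplus>\<^bsub>V\<^esub> v', w)] [(v, w), (v', w)]"
| add_right: "\<lbrakk>v \<in> carrier V; w \<in> carrier W; w' \<in> carrier W\<rbrakk>
    \<Longrightarrow> tensor_eq V W [(v, w \<oplus>\<^bsub>W\<^esub> w')] [(v, w), (v, w')]"
| balanced: "\<lbrakk>v \<in> carrier V; w \<in> carrier W\<rbrakk>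
    \<Longrightarrow> tensor_eq V W [(c \<odot>\<^bsub>V\<^esub> v, w)] [(v, c \<odot>\<^bsub>W\<^esub> w)]"

text \<open>An equivalence class is encoded by a chosen representative.\<close>

definition tensor_class :: "'a gvec gspace \<Rightarrow> 'a gvec gspace \<Rightarrow> ('a gvec \<times> 'a gvec) list \<Rightarrow> 'a gvec" where
  "tensor_class V W xs = Formal_Sum (SOME ys. tensor_eq V W xs ys)"

definition pure_tensor :: "'a gvec gspace \<Rightarrow> 'a gvec gspace \<Rightarrow> 'a gvec \<Rightarrow> 'a gvec \<Rightarrow> 'a gvec" where
  "pure_tensor V W v w = tensor_class V W [(v, w)]"

definition tensor_space :: "'a gvec gspace \<Rightarrow> 'a gvec gspace \<Rightarrow> 'a gvec gspace" where
  "tensor_space V W =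
     \<lparr>carrier = {tensor_class V W xs |xs. set xs \<subseteq> carrier V \<times> carrier W},
      monoid.mult = undefined, one = undefined,
      zero = tensor_class V W [],
      add = (\<lambda>x y. tensor_class V W (terms_of x @ terms_of y)),
      smult = (\<lambda>c x. tensor_class V W (map (\<lambda>(v, w). (c \<odot>\<^bsub>V\<^esub> v, w)) (terms_of x))),
      hcomp = (\<lambda>c. {tensor_class V W xs |xs.
        \<forall>(v, w)\<in>set xs. \<exists>a b. v \<in> hcomp V a \<and> w \<in> hcomp W b \<and> a + b = c})\<rparr>"

definition tensor_map :: "'a gvec garrow \<Rightarrow> 'a gvec garrow \<Rightarrow> 'a gvec garrow" where
  "tensor_map f g = mk_garrow (tensor_space (src f) (src g)) (tensor_space (tgt f) (tgt g))
     (\<lambda>x. tensor_class (tgt f) (tgt g) (map (map_prod (fn f) (fn g)) (terms_of x)))"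

definition unit_space :: "'a gvec gspace" where
  "unit_space =
     \<lparr>carrier = range Scalar, monoid.mult = undefined, one = undefined,
      zero = Scalar 0,
      add = (\<lambda>x y. Scalar (scalar_of x + scalar_of y)),
      smult = (\<lambda>c x. Scalar (c * scalar_of x)),
      hcomp = (\<lambda>a. if a = 0 then range Scalar else {Scalar 0})\<rparr>"

definition assoc_map :: "'a gvec gspace \<Rightarrow> 'a gvec gspace \<Rightarrow> 'a gvec gspace \<Rightarrow> 'a gvec garrow" where
  "assoc_map U V W =
     the_graded_map (tensor_space (tensor_space U V) W) (tensor_space U (tensor_space V W))
       (\<lambda>h. \<forall>a b c. \<forall>u\<in>hcomp U a. \<forall>v\<in>hcomp V b. \<forall>w\<in>hcomp W c.
          h (pure_tensor (tensor_space U V) W (pure_tensor U V u v) w)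
          = oct_phi a b c \<odot>\<^bsub>tensor_space U (tensor_space V W)\<^esub>
              pure_tensor U (tensor_space V W) u (pure_tensor V W v w))"

subsection \<open>Conjugation\<close>

text \<open>
  The conjugate space has the same underlying abelian group, so the element written
  $\overline{v}$ is \<open>v\<close> itself, regarded as an element of \<open>conj_space V\<close>. The basis element
  \<open>delta a\<close> acts on $\overline{v}$ as \<open>starS (delta a) = delta (- a)\<close> acts on \<open>v\<close>, whence
  the grading.
\<close>

definition conj_space :: "'v gspace \<Rightarrow> 'v gspace" where
  "conj_space V = V\<lparr>smult := (\<lambda>c v. cnj c \<odot>\<^bsub>V\<^esub> v), hcomp := (\<lambda>a. hcomp V (- a))\<rparr>"

definition conj_map :: "'v garrow \<Rightarrow> 'v garrow" where
  "conj_map f = \<lparr>src = conj_space (src f), tgt = conj_space (tgt f), fn = fn f\<rparr>"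

definition ups_sign :: "G \<Rightarrow> G \<Rightarrow> complex" where
  "ups_sign a b = (if a \<noteq> 0 \<and> b \<noteq> 0 \<and> a \<noteq> b then - 1 else 1)"

definition ups_map :: "'a gvec gspace \<Rightarrow> 'a gvec gspace \<Rightarrow> 'a gvec garrow" where
  "ups_map V W =
     the_graded_map (conj_space (tensor_space V W)) (tensor_space (conj_space W) (conj_space V))
       (\<lambda>h. \<forall>a b. \<forall>v\<in>hcomp V a. \<forall>w\<in>hcomp W b.
          h (pure_tensor V W v w)
          = ups_sign a b \<odot>\<^bsub>tensor_space (conj_space W) (conj_space V)\<^esub>
              pure_tensor (conj_space W) (conj_space V) w v)"

definition graded_bar_cat :: "('a gvec gspace, 'a gvec garrow) bar_struct" where
  "graded_bar_cat =
     \<lparr>Obj = {V. graded_space V},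
      Arr = {f. graded_map f},
      Dom = src,
      Cod = tgt,
      Idn = (\<lambda>V. mk_garrow V V (\<lambda>v. v)),
      Cmp = (\<lambda>g f. mk_garrow (src f) (tgt g) (\<lambda>v. fn g (fn f v))),
      tensO = tensor_space,
      tensA = tensor_map,
      unitO = unit_space,
      assoc = assoc_map,
      lunit = (\<lambda>V. mk_garrow V (tensor_space V unit_space)
                (\<lambda>v. pure_tensor V unit_space v (Scalar 1))),
      runit = (\<lambda>V. mk_garrow V (tensor_space unit_space V)
                (\<lambda>v. pure_tensor unit_space V (Scalar 1) v)),
      barO = conj_space,
      barA = conj_map,
      bb = (\<lambda>V. mk_garrow V (conj_space (conj_space V)) (\<lambda>v. v)),
      starI = mk_garrow unit_space (conj_space unit_space) (\<lambda>x. Scalar (cnj (scalar_of x))),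
      Ups = ups_map\<rparr>"

subsection \<open>The octonions\<close>

text \<open>An octonion is represented by its coefficient function with respect to the basis \<open>oct_e\<close>.\<close>

definition oct_e :: "G \<Rightarrow> 'a gvec" where
  "oct_e a = Func (delta a)"

definition octonions :: "'a gvec gspace" where
  "octonions =
     \<lparr>carrier = range Func, monoid.mult = undefined, one = undefined,
      zero = Func (\<lambda>x. 0),
      add = (\<lambda>u v. Func (\<lambda>x. func_of u x + func_of v x)),
      smult = (\<lambda>c v. Func (\<lambda>x. c * func_of v x)),
      hcomp = (\<lambda>a. range (\<lambda>c. Func (\<lambda>x. c * delta a x)))\<rparr>"

definition oct_product :: "'a gvec garrow" where
  "oct_product = the_graded_map (tensor_space octonions octonions) octonions
     (\<lambda>h. \<forall>a b. h (pure_tensor octonions octonions (oct_e a) (oct_e b))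
        = oct_F a b \<odot>\<^bsub>octonions\<^esub> oct_e (a + b))"

definition oct_unit :: "'a gvec garrow" where
  "oct_unit = mk_garrow unit_space octonions (\<lambda>x. scalar_of x \<odot>\<^bsub>octonions\<^esub> oct_e 0)"

definition oct_star :: "'a gvec garrow" where
  "oct_star = the_graded_map octonions (conj_space octonions) (\<lambda>h. \<forall>a. h (oct_e a) = oct_e (- a))"

end

theory Submission
  imports Defs
begin

text \<open>
  A graded map is determined by its values on homogeneous vectors, and these span every space in
  sight; hence each coherence diagram only has to be followed on a pure tensor of homogeneous
  vectors, where it becomes an identity between signs. The pentagon and the associativity of the
  octonions hold because the associator is by construction the coboundary of \<open>\<F>\<close>. Conjugation
  reverses the order of tensor factors, and the sign of \<open>\<Upsilon>\<close> is
  \<open>\<F>(a, b) \<F>(b, a)\<close>; that it makes \<open>\<Upsilon>\<close> compatible with the associator amounts to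
  \<open>\<phi>(c, b, a) = \<phi>(a, b, c)\<close>, and multiplicativity of \<open>\<star>\<close> on the octonions is
  precisely this formula for the sign.

  The structure maps exist by the universal property of the tensor product: a bilinear or trilinear
  map is first multiplied by a scalar depending on the degrees, by summing over the homogeneous
  components of its arguments, and then factored through the tensor product.
\<close>

text \<open>Tensors are stored as representatives picked by choice; the associator, \<Upsilon>, the
  octonion product and the star are definite descriptions. Nothing is known about a description
  until a map with the prescribed values has been exhibited, and its values on a spanning set then
  identify it. The instance below makes sums over all degrees finite. The group has exponent 2: the
  antipode is trivial, conjugation keeps the grading, and conjugating a space twice returns the same
  record. A conjugate space has the elements of the original one, so an antilinear map is just a
  linear map into a conjugate space. The cochain takes the values 1 and -1 only, so every
  coefficient is real and its own inverse: the associator and \<Upsilon> are undone by the same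
  signs. The sign of \<Upsilon> is the one by which basis octonions commute or anticommute. It
  already accounts for the reversal of factors, and therefore the star fixes every basis element,
  unlike octonion conjugation, which negates the imaginary units.\<close>

instance bit :: finite
proof
  have "(UNIV :: bit set) = {0, 1}" by auto
  then show "finite (UNIV :: bit set)" by (metis finite.emptyI finite.insertI)
qed

section \<open>Complex vector spaces and linear maps\<close>

abbreviation vs :: "'v gspace \<Rightarrow> bool" where
  "vs V \<equiv> Module.module complex_ring V"

lemma complex_ring_simps [simp]:
  "carrier complex_ring = UNIV" "x \<otimes>\<^bsub>complex_ring\<^esub> y = x * y" "\<one>\<^bsub>complex_ring\<^esub> = 1"
  "\<zero>\<^bsub>complex_ring\<^esub> = 0" "x \<oplus>\<^bsub>complex_ring\<^esub> y = x + y"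
  by (simp_all add: complex_ring_def)

lemma complex_ring_cring: "cring complex_ring"
proof (rule cringI)
  show "abelian_group complex_ring"
  proof (rule abelian_groupI)
    fix x :: complex
    show "\<exists>y\<in>carrier complex_ring. y \<oplus>\<^bsub>complex_ring\<^esub> x = \<zero>\<^bsub>complex_ring\<^esub>"
      by (auto intro: exI[of _ "- x"])
  qed simp_all
  show "comm_monoid complex_ring"
    by (rule comm_monoidI) simp_all
qed (simp add: algebra_simps)

lemma vs_add [simp]: "\<lbrakk>vs V; x \<in> carrier V; y \<in> carrier V\<rbrakk> \<Longrightarrow> x \<oplus>\<^bsub>V\<^esub> y \<in> carrier V"
  by (simp add: Module.module_def abelian_group_def abelian_monoid.a_closed)

lemma vs_zero [simp]: "vs V \<Longrightarrow> \<zero>\<^bsub>V\<^esub> \<in> carrier V"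
  by (simp add: Module.module_def abelian_group_def abelian_monoid.zero_closed)

lemma vs_smult [simp]: "\<lbrakk>vs V; x \<in> carrier V\<rbrakk> \<Longrightarrow> c \<odot>\<^bsub>V\<^esub> x \<in> carrier V"
  by (simp add: module.smult_closed)

lemma vs_abelian_monoid: "vs V \<Longrightarrow> abelian_monoid V"
  by (simp add: Module.module_def abelian_group_def)

lemma vs_abelian_group: "vs V \<Longrightarrow> abelian_group V"
  by (simp add: Module.module_def)

lemma vs_simps [simp]:
  "\<lbrakk>vs V; x \<in> carrier V\<rbrakk> \<Longrightarrow> \<zero>\<^bsub>V\<^esub> \<oplus>\<^bsub>V\<^esub> x = x"
  "\<lbrakk>vs V; x \<in> carrier V\<rbrakk> \<Longrightarrow> x \<oplus>\<^bsub>V\<^esub> \<zero>\<^bsub>V\<^esub> = x"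
  "\<lbrakk>vs V; x \<in> carrier V\<rbrakk> \<Longrightarrow> c \<odot>\<^bsub>V\<^esub> (d \<odot>\<^bsub>V\<^esub> x) = (c * d) \<odot>\<^bsub>V\<^esub> x"
  "\<lbrakk>vs V; x \<in> carrier V\<rbrakk> \<Longrightarrow> 1 \<odot>\<^bsub>V\<^esub> x = x"
  "\<lbrakk>vs V; x \<in> carrier V\<rbrakk> \<Longrightarrow> 0 \<odot>\<^bsub>V\<^esub> x = \<zero>\<^bsub>V\<^esub>"
  "vs V \<Longrightarrow> c \<odot>\<^bsub>V\<^esub> \<zero>\<^bsub>V\<^esub> = \<zero>\<^bsub>V\<^esub>"
  using abelian_monoid.l_zero[OF vs_abelian_monoid, of V x]
    abelian_monoid.r_zero[OF vs_abelian_monoid, of V x]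
    module.smult_assoc1[of complex_ring V c d x] module.smult_one[of complex_ring V x]
    module.smult_l_null[of complex_ring V x] module.smult_r_null[of complex_ring V c]
  by auto

lemma vs_smult_add:
  "\<lbrakk>vs V; x \<in> carrier V\<rbrakk> \<Longrightarrow> (c + d) \<odot>\<^bsub>V\<^esub> x = c \<odot>\<^bsub>V\<^esub> x \<oplus>\<^bsub>V\<^esub> d \<odot>\<^bsub>V\<^esub> x"
  "\<lbrakk>vs V; x \<in> carrier V; y \<in> carrier V\<rbrakk>
    \<Longrightarrow> c \<odot>\<^bsub>V\<^esub> (x \<oplus>\<^bsub>V\<^esub> y) = c \<odot>\<^bsub>V\<^esub> x \<oplus>\<^bsub>V\<^esub> c \<odot>\<^bsub>V\<^esub> y"
  using module.smult_l_distr[of complex_ring V c d x] module.smult_r_distr[of complex_ring V c x y]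
  by auto

lemma vs_ac:
  "\<lbrakk>vs V; x \<in> carrier V; y \<in> carrier V; z \<in> carrier V\<rbrakk>
    \<Longrightarrow> (x \<oplus>\<^bsub>V\<^esub> y) \<oplus>\<^bsub>V\<^esub> z = x \<oplus>\<^bsub>V\<^esub> (y \<oplus>\<^bsub>V\<^esub> z)"
  "\<lbrakk>vs V; x \<in> carrier V; y \<in> carrier V\<rbrakk> \<Longrightarrow> x \<oplus>\<^bsub>V\<^esub> y = y \<oplus>\<^bsub>V\<^esub> x"
  "\<lbrakk>vs V; x \<in> carrier V; y \<in> carrier V; z \<in> carrier V\<rbrakk>
    \<Longrightarrow> x \<oplus>\<^bsub>V\<^esub> (y \<oplus>\<^bsub>V\<^esub> z) = y \<oplus>\<^bsub>V\<^esub> (x \<oplus>\<^bsub>V\<^esub> z)"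
  using abelian_monoid.a_assoc[OF vs_abelian_monoid, of V x y z]
    abelian_monoid.a_comm[OF vs_abelian_monoid, of V x y]
    abelian_monoid.a_lcomm[OF vs_abelian_monoid, of V x y z] by auto

lemma vs_minus: "\<lbrakk>vs V; x \<in> carrier V\<rbrakk> \<Longrightarrow> \<ominus>\<^bsub>V\<^esub> x = (- 1) \<odot>\<^bsub>V\<^esub> x"
  by (rule abelian_group.minus_equality[OF vs_abelian_group])
    (auto simp: vs_smult_add(1)[symmetric, of V x _ 1, simplified])

text \<open>Scaling by -1 supplies additive inverses once 0 is known to act as zero, so the group
  axioms shrink to those of a commutative monoid.\<close>

lemma vsI:
  fixes V :: "'v gspace"
  assumes "\<And>x y. \<lbrakk>x \<in> carrier V; y \<in> carrier V\<rbrakk> \<Longrightarrow> x \<oplus>\<^bsub>V\<^esub> y \<in> carrier V"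
    and "\<zero>\<^bsub>V\<^esub> \<in> carrier V"
    and "\<And>x y z. \<lbrakk>x \<in> carrier V; y \<in> carrier V; z \<in> carrier V\<rbrakk>
      \<Longrightarrow> (x \<oplus>\<^bsub>V\<^esub> y) \<oplus>\<^bsub>V\<^esub> z = x \<oplus>\<^bsub>V\<^esub> (y \<oplus>\<^bsub>V\<^esub> z)"
    and "\<And>x y. \<lbrakk>x \<in> carrier V; y \<in> carrier V\<rbrakk> \<Longrightarrow> x \<oplus>\<^bsub>V\<^esub> y = y \<oplus>\<^bsub>V\<^esub> x"
    and "\<And>x. x \<in> carrier V \<Longrightarrow> \<zero>\<^bsub>V\<^esub> \<oplus>\<^bsub>V\<^esub> x = x"
    and closed: "\<And>c x. x \<in> carrier V \<Longrightarrow> c \<odot>\<^bsub>V\<^esub> x \<in> carrier V"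
    and distr: "\<And>c d x. x \<in> carrier V \<Longrightarrow> (c + d) \<odot>\<^bsub>V\<^esub> x = c \<odot>\<^bsub>V\<^esub> x \<oplus>\<^bsub>V\<^esub> d \<odot>\<^bsub>V\<^esub> x"
    and "\<And>c x y. \<lbrakk>x \<in> carrier V; y \<in> carrier V\<rbrakk>
      \<Longrightarrow> c \<odot>\<^bsub>V\<^esub> (x \<oplus>\<^bsub>V\<^esub> y) = c \<odot>\<^bsub>V\<^esub> x \<oplus>\<^bsub>V\<^esub> c \<odot>\<^bsub>V\<^esub> y"
    and "\<And>c d x. x \<in> carrier V \<Longrightarrow> (c * d) \<odot>\<^bsub>V\<^esub> x = c \<odot>\<^bsub>V\<^esub> (d \<odot>\<^bsub>V\<^esub> x)"
    and one: "\<And>x. x \<in> carrier V \<Longrightarrow> 1 \<odot>\<^bsub>V\<^esub> x = x"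
    and null: "\<And>x. x \<in> carrier V \<Longrightarrow> 0 \<odot>\<^bsub>V\<^esub> x = \<zero>\<^bsub>V\<^esub>"
  shows "vs V"
proof (rule moduleI[OF complex_ring_cring])
  show "abelian_group V"
  proof (rule abelian_groupI)
    fix x assume "x \<in> carrier V"
    then have "(- 1) \<odot>\<^bsub>V\<^esub> x \<in> carrier V" "(- 1) \<odot>\<^bsub>V\<^esub> x \<oplus>\<^bsub>V\<^esub> x = \<zero>\<^bsub>V\<^esub>"
      using distr[of x "- 1" 1] by (simp_all add: closed one null)
    then show "\<exists>y\<in>carrier V. y \<oplus>\<^bsub>V\<^esub> x = \<zero>\<^bsub>V\<^esub>" ..
  qed (use assms in auto)
qed (use assms in auto)

text \<open>Over the complex numbers additive inverses come from scaling by -1 and the zero vector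
  from scaling by 0. This form is therefore equivalent to \<open>submodule\<close> for a vector
  space and easier to check.\<close>

definition subspace_of :: "'v gspace \<Rightarrow> 'v set \<Rightarrow> bool" where
  "subspace_of V H \<longleftrightarrow> H \<subseteq> carrier V \<and> \<zero>\<^bsub>V\<^esub> \<in> H \<and> (\<forall>x\<in>H. \<forall>y\<in>H. x \<oplus>\<^bsub>V\<^esub> y \<in> H)
     \<and> (\<forall>c. \<forall>x\<in>H. c \<odot>\<^bsub>V\<^esub> x \<in> H)"

lemma submodule_iff_subspace_of: "vs V \<Longrightarrow> submodule H complex_ring V \<longleftrightarrow> subspace_of V H"
proof
  assume V: "vs V" and H: "submodule H complex_ring V"
  note E = module.submoduleE[OF V H]
  obtain x where "x \<in> H" using E(2) by auto
  then have "0 \<odot>\<^bsub>V\<^esub> x \<in> H" "0 \<odot>\<^bsub>V\<^esub> x = \<zero>\<^bsub>V\<^esub>" using E V by auto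
  then show "subspace_of V H" using E by (auto simp: subspace_of_def)
next
  assume V: "vs V" and H: "subspace_of V H"
  have "\<ominus>\<^bsub>V\<^esub> x \<in> H" if "x \<in> H" for x
    using that H V by (subst vs_minus) (auto simp: subspace_of_def)
  then show "submodule H complex_ring V"
    using H by (intro module.submoduleI[OF V]) (auto simp: subspace_of_def)
qed

lemma finsum_in_carrier [simp]:
  "\<lbrakk>vs V; \<And>i. i \<in> A \<Longrightarrow> f i \<in> carrier V\<rbrakk> \<Longrightarrow> finsum V f A \<in> carrier V"
  by (intro abelian_monoid.finsum_closed[OF vs_abelian_monoid]) auto

lemma finsum_single:
  assumes "vs V" "i \<in> A" "finite A" "\<And>j. j \<in> A \<Longrightarrow> g j = (if j = i then x else \<zero>\<^bsub>V\<^esub>)" "x \<in> carrier V"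
  shows "finsum V g A = x"
proof -
  have "finsum V g A = finsum V (\<lambda>j. if i = j then x else \<zero>\<^bsub>V\<^esub>) A"
    using assms by (intro abelian_monoid.finsum_cong'[OF vs_abelian_monoid]) auto
  also have "\<dots> = x"
    using abelian_monoid.finsum_singleton[OF vs_abelian_monoid, of V i A "\<lambda>_. x"] assms by auto
  finally show ?thesis .
qed

text \<open>Only values on the carrier matter, so lambda terms qualify without being restricted, and
  source and target may have different element types. An antilinear map to \<open>W\<close> is a
  linear one to \<open>conj_space W\<close>.\<close>

definition linear_on :: "'v gspace \<Rightarrow> 'w gspace \<Rightarrow> ('v \<Rightarrow> 'w) \<Rightarrow> bool" where
  "linear_on V W h \<longleftrightarrow> (\<forall>v\<in>carrier V. h v \<in> carrier W)
     \<and> (\<forall>v\<in>carrier V. \<forall>v'\<in>carrier V. h (v \<oplus>\<^bsub>V\<^esub> v') = h v \<oplus>\<^bsub>W\<^esub> h v')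
     \<and> (\<forall>c. \<forall>v\<in>carrier V. h (c \<odot>\<^bsub>V\<^esub> v) = c \<odot>\<^bsub>W\<^esub> h v)"

lemma linear_onD:
  assumes "linear_on V W h"
  shows "v \<in> carrier V \<Longrightarrow> h v \<in> carrier W"
    and "v \<in> carrier V \<Longrightarrow> v' \<in> carrier V \<Longrightarrow> h (v \<oplus>\<^bsub>V\<^esub> v') = h v \<oplus>\<^bsub>W\<^esub> h v'"
    and "v \<in> carrier V \<Longrightarrow> h (c \<odot>\<^bsub>V\<^esub> v) = c \<odot>\<^bsub>W\<^esub> h v"
  using assms by (auto simp: linear_on_def)

lemma linear_on_zero:
  assumes "vs V" "vs W" "linear_on V W h"
  shows "h \<zero>\<^bsub>V\<^esub> = \<zero>\<^bsub>W\<^esub>"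
  using linear_onD(1,3)[OF assms(3), of "\<zero>\<^bsub>V\<^esub>"] linear_onD(3)[OF assms(3), of "\<zero>\<^bsub>V\<^esub>" 0] assms(1,2)
  by (metis vs_simps(5) vs_zero)

lemma linear_on_cong:
  "\<lbrakk>vs V; \<And>v. v \<in> carrier V \<Longrightarrow> h v = k v\<rbrakk> \<Longrightarrow> linear_on V W h = linear_on V W k"
  by (simp add: linear_on_def)

lemma linear_on_comp:
  "\<lbrakk>linear_on U V h; linear_on V W k\<rbrakk> \<Longrightarrow> linear_on U W (\<lambda>v. k (h v))"
  by (simp add: linear_on_def)

lemma linear_on_zero_map: "vs W \<Longrightarrow> linear_on V W (\<lambda>v. \<zero>\<^bsub>W\<^esub>)"
  by (simp add: linear_on_def)

lemma linear_on_id: "linear_on V V (\<lambda>v. v)"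
  by (simp add: linear_on_def)

lemma linear_on_add:
  "\<lbrakk>vs W; linear_on V W h; linear_on V W k\<rbrakk> \<Longrightarrow> linear_on V W (\<lambda>v. h v \<oplus>\<^bsub>W\<^esub> k v)"
  by (simp add: linear_on_def vs_smult_add vs_ac)

lemma linear_on_smult:
  "\<lbrakk>vs W; linear_on V W h\<rbrakk> \<Longrightarrow> linear_on V W (\<lambda>v. c \<odot>\<^bsub>W\<^esub> h v)"
  by (simp add: linear_on_def vs_smult_add mult.commute)

lemma linear_on_finsum:
  assumes W: "vs W" and h: "\<And>i. i \<in> A \<Longrightarrow> linear_on V W (h i)" and "finite A"
  shows "linear_on V W (\<lambda>v. \<Oplus>\<^bsub>W\<^esub>i\<in>A. h i v)"
proof -
  have "(\<Oplus>\<^bsub>W\<^esub>i\<in>A. h i (v \<oplus>\<^bsub>V\<^esub> v')) = (\<Oplus>\<^bsub>W\<^esub>i\<in>A. h i v) \<oplus>\<^bsub>W\<^esub> (\<Oplus>\<^bsub>W\<^esub>i\<in>A. h i v')"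
    if "v \<in> carrier V" "v' \<in> carrier V" for v v'
  proof -
    have "(\<Oplus>\<^bsub>W\<^esub>i\<in>A. h i (v \<oplus>\<^bsub>V\<^esub> v')) = (\<Oplus>\<^bsub>W\<^esub>i\<in>A. h i v \<oplus>\<^bsub>W\<^esub> h i v')"
      using that h W by (intro abelian_monoid.finsum_cong'[OF vs_abelian_monoid]) (auto simp: linear_on_def)
    also have "\<dots> = (\<Oplus>\<^bsub>W\<^esub>i\<in>A. h i v) \<oplus>\<^bsub>W\<^esub> (\<Oplus>\<^bsub>W\<^esub>i\<in>A. h i v')"
      using that h by (intro abelian_monoid.finsum_addf[OF vs_abelian_monoid[OF W]]) (auto simp: linear_on_def)
    finally show ?thesis .
  qed
  moreover have "(\<Oplus>\<^bsub>W\<^esub>i\<in>A. h i (c \<odot>\<^bsub>V\<^esub> v)) = c \<odot>\<^bsub>W\<^esub> (\<Oplus>\<^bsub>W\<^esub>i\<in>A. h i v)"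
    if "v \<in> carrier V" for v c
  proof -
    have "(\<Oplus>\<^bsub>W\<^esub>i\<in>A. h i (c \<odot>\<^bsub>V\<^esub> v)) = (\<Oplus>\<^bsub>W\<^esub>i\<in>A. c \<odot>\<^bsub>W\<^esub> h i v)"
      using that h W by (intro abelian_monoid.finsum_cong'[OF vs_abelian_monoid]) (auto simp: linear_on_def)
    also have "\<dots> = c \<odot>\<^bsub>W\<^esub> (\<Oplus>\<^bsub>W\<^esub>i\<in>A. h i v)"
      using that h \<open>finite A\<close>
      by (intro module.finsum_smult_ldistr[OF W, symmetric]) (auto simp: linear_on_def)
    finally show ?thesis .
  qed
  ultimately show ?thesis
    using h W by (auto simp: linear_on_def)
qed

lemma linear_on_apply_finsum:
  assumes "vs V" "vs W" "linear_on V W h" "finite A" "\<And>i. i \<in> A \<Longrightarrow> f i \<in> carrier V"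
  shows "h (finsum V f A) = (\<Oplus>\<^bsub>W\<^esub>i\<in>A. h (f i))"
  using assms(4,5)
proof (induction A rule: finite_induct)
  case empty
  then show ?case
    using assms by (simp add: abelian_monoid.finsum_empty[OF vs_abelian_monoid] linear_on_zero)
next
  case (insert a A)
  then show ?case
    using assms(1-3)
    by (subst abelian_monoid.finsum_insert[OF vs_abelian_monoid]; (simp add: Pi_def)?)
      (subst abelian_monoid.finsum_insert[OF vs_abelian_monoid]; simp add: linear_onD Pi_def)
qed

text \<open>An inductive closure in place of explicit linear combinations: statements about linear
  maps pass from generators to the span by rule induction.\<close>

inductive_set span_of :: "'v gspace \<Rightarrow> 'v set \<Rightarrow> 'v set" for V :: "'v gspace" and S :: "'v set" where
  zero: "\<zero>\<^bsub>V\<^esub> \<in> span_of V S"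
| base: "s \<in> S \<Longrightarrow> s \<in> span_of V S"
| add: "\<lbrakk>x \<in> span_of V S; y \<in> span_of V S\<rbrakk> \<Longrightarrow> x \<oplus>\<^bsub>V\<^esub> y \<in> span_of V S"
| smult: "x \<in> span_of V S \<Longrightarrow> c \<odot>\<^bsub>V\<^esub> x \<in> span_of V S"

definition spanning :: "'v gspace \<Rightarrow> 'v set \<Rightarrow> bool" where
  "spanning V S \<longleftrightarrow> S \<subseteq> carrier V \<and> carrier V \<subseteq> span_of V S"

lemma span_of_closed: "\<lbrakk>vs V; S \<subseteq> carrier V; x \<in> span_of V S\<rbrakk> \<Longrightarrow> x \<in> carrier V"
  by (rotate_tac 2, induction rule: span_of.induct) auto

lemma span_of_finsum:
  assumes "vs V" "finite A" "S \<subseteq> carrier V" "\<And>i. i \<in> A \<Longrightarrow> f i \<in> span_of V S"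
  shows "finsum V f A \<in> span_of V S"
  using assms(2,4)
proof (induction A rule: finite_induct)
  case empty
  then show ?case
    using assms by (simp add: abelian_monoid.finsum_empty[OF vs_abelian_monoid] span_of.zero)
next
  case (insert a A)
  then show ?case
    using assms(1,3) span_of_closed[OF assms(1,3)]
    by (subst abelian_monoid.finsum_insert[OF vs_abelian_monoid]) (auto intro: span_of.add)
qed

text \<open>The vectors on which two linear maps agree form a subspace. Overcomplete sets, such as
  that of all homogeneous vectors, can serve as \<open>S\<close>.\<close>

lemma linear_on_eq:
  assumes "vs V" "vs W" "linear_on V W h" "linear_on V W k" "spanning V S"
    and "\<And>s. s \<in> S \<Longrightarrow> h s = k s" and "x \<in> carrier V"
  shows "h x = k x"
proof -
  have S: "S \<subseteq> carrier V" using assms by (simp add: spanning_def)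
  have "x \<in> span_of V S" using assms by (auto simp: spanning_def)
  then show ?thesis
  proof (induction rule: span_of.induct)
    case zero
    then show ?case using assms by (simp add: linear_on_zero)
  qed (use assms span_of_closed[OF assms(1) S] in \<open>simp_all add: linear_onD\<close>)
qed

lemma linear_on_span_of:
  assumes "vs V" "vs W" "linear_on V W h" "S \<subseteq> carrier V" "\<And>s. s \<in> S \<Longrightarrow> h s \<in> span_of W T"
    "x \<in> span_of V S"
  shows "h x \<in> span_of W T"
  using assms(6)
  by (induction rule: span_of.induct)
    (use assms span_of_closed[OF assms(1,4)] in \<open>simp_all add: linear_onD linear_on_zero span_of.intros\<close>)

definition bilinear_on :: "'u gspace \<Rightarrow> 'v gspace \<Rightarrow> 'w gspace \<Rightarrow> ('u \<Rightarrow> 'v \<Rightarrow> 'w) \<Rightarrow> bool" where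
  "bilinear_on U V W \<beta> \<longleftrightarrow> (\<forall>v\<in>carrier V. linear_on U W (\<lambda>u. \<beta> u v))
     \<and> (\<forall>u\<in>carrier U. linear_on V W (\<beta> u))"

section \<open>Tensor products\<close>

lemma tensor_eq_closed:
  assumes "vs V" "vs W" "tensor_eq V W xs ys"
  shows "set xs \<subseteq> carrier V \<times> carrier W" "set ys \<subseteq> carrier V \<times> carrier W"
proof -
  have "set xs \<subseteq> carrier V \<times> carrier W \<and> set ys \<subseteq> carrier V \<times> carrier W"
    using assms(3) by (induction rule: tensor_eq.induct) (use assms in auto)
  then show "set xs \<subseteq> carrier V \<times> carrier W" "set ys \<subseteq> carrier V \<times> carrier W"
    by auto
qed

text \<open>Related lists define the same predicate \<open>tensor_eq V W xs\<close>, and choice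
  applied to equal predicates returns the same list.\<close>

lemma tensor_class_eqI: "tensor_eq V W xs ys \<Longrightarrow> tensor_class V W xs = tensor_class V W ys"
proof -
  assume "tensor_eq V W xs ys"
  then have "tensor_eq V W xs = tensor_eq V W ys"
    by (intro ext iffI) (blast intro: tensor_eq.sym tensor_eq.trans)+
  then show ?thesis by (simp add: tensor_class_def)
qed

text \<open>All that is ever known about the chosen representative: it is related to the list it was
  chosen for. Operations that read \<open>terms_of\<close> are computed through this fact.\<close>

lemma tensor_eq_terms_of:
  "set xs \<subseteq> carrier V \<times> carrier W \<Longrightarrow> tensor_eq V W xs (terms_of (tensor_class V W xs))"
  unfolding tensor_class_def gvec.sel
  by (rule someI[where P = "tensor_eq V W xs", OF tensor_eq.refl])

text \<open>Linear maps carry each generating relation of the congruence to a relation of the same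
  kind. Besides tensor products of arrows this covers scalar multiplication, which is
  \<open>map_prod\<close> of a scaling and the identity.\<close>

lemma tensor_eq_map:
  assumes "vs V" "vs W" "vs V'" "vs W'" "linear_on V V' f" "linear_on W W' g" "tensor_eq V W xs ys"
  shows "tensor_eq V' W' (map (map_prod f g) xs) (map (map_prod f g) ys)"
proof -
  have *: "set (map (map_prod f g) zs) \<subseteq> carrier V' \<times> carrier W'"
    if "set zs \<subseteq> carrier V \<times> carrier W" for zs
    using that linear_onD(1)[OF assms(5)] linear_onD(1)[OF assms(6)] by fastforce
  show ?thesis
    using assms(7)
  proof (induction rule: tensor_eq.induct)
    case (refl xs)
    then show ?case by (intro tensor_eq.refl *)
  next
    case (append xs xs' ys ys')
    then show ?case by (simp add: tensor_eq.append)
  next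
    case (commute xs ys)
    show ?case
      using tensor_eq.commute[OF *[OF commute(1)] *[OF commute(2)]] by simp
  next
    case (trans xs ys zs)
    then show ?case by (blast intro: tensor_eq.trans)
  next
    case (sym xs ys)
    then show ?case by (blast intro: tensor_eq.sym)
  qed (use assms in \<open>auto simp: linear_onD linear_on_zero
      intro: tensor_eq.zero tensor_eq.add_left tensor_eq.add_right tensor_eq.balanced\<close>)
qed

context
  fixes V W :: "'a gvec gspace"
  assumes V: "vs V" and W: "vs W"
begin

lemma carrier_tensorE:
  assumes "x \<in> carrier (tensor_space V W)"
  obtains xs where "set xs \<subseteq> carrier V \<times> carrier W" "x = tensor_class V W xs"
  using assms by (auto simp: tensor_space_def)

lemma tensor_class_in_carrier:
  "set xs \<subseteq> carrier V \<times> carrier W \<Longrightarrow> tensor_class V W xs \<in> carrier (tensor_space V W)"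
  by (auto simp: tensor_space_def)

lemma tensor_class_append:
  assumes "set xs \<subseteq> carrier V \<times> carrier W" "set ys \<subseteq> carrier V \<times> carrier W"
  shows "tensor_class V W xs \<oplus>\<^bsub>tensor_space V W\<^esub> tensor_class V W ys = tensor_class V W (xs @ ys)"
  using assms
  by (simp add: tensor_space_def)
    (intro tensor_class_eqI tensor_eq.append tensor_eq.sym[OF tensor_eq_terms_of])

lemma tensor_class_smult:
  assumes "set xs \<subseteq> carrier V \<times> carrier W"
  shows "c \<odot>\<^bsub>tensor_space V W\<^esub> tensor_class V W xs
    = tensor_class V W (map (\<lambda>(v, w). (c \<odot>\<^bsub>V\<^esub> v, w)) xs)"
proof -
  have eq: "(\<lambda>(v, w). (c \<odot>\<^bsub>V\<^esub> v, w)) = map_prod (\<lambda>v. c \<odot>\<^bsub>V\<^esub> v) (\<lambda>w :: 'a gvec. w)"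
    by auto
  have "tensor_eq V W (map (map_prod (\<lambda>v. c \<odot>\<^bsub>V\<^esub> v) (\<lambda>w. w)) xs)
      (map (map_prod (\<lambda>v. c \<odot>\<^bsub>V\<^esub> v) (\<lambda>w. w)) (terms_of (tensor_class V W xs)))"
    by (intro tensor_eq_map[OF V W V W] tensor_eq_terms_of assms linear_on_smult[OF V] linear_on_id)
  from tensor_class_eqI[OF this] show ?thesis
    by (simp add: tensor_space_def eq)
qed

lemma tensor_class_Cons:
  assumes "v \<in> carrier V" "w \<in> carrier W" "set xs \<subseteq> carrier V \<times> carrier W"
  shows "tensor_class V W ((v, w) # xs) = pure_tensor V W v w \<oplus>\<^bsub>tensor_space V W\<^esub> tensor_class V W xs"
  using tensor_class_append[of "[(v, w)]" xs] assms by (simp add: pure_tensor_def)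

lemma tensor_class_Nil: "tensor_class V W [] = \<zero>\<^bsub>tensor_space V W\<^esub>"
  by (simp add: tensor_space_def)

lemma pure_tensor_in_carrier [simp]:
  "v \<in> carrier V \<Longrightarrow> w \<in> carrier W \<Longrightarrow> pure_tensor V W v w \<in> carrier (tensor_space V W)"
  unfolding pure_tensor_def by (rule tensor_class_in_carrier) simp

text \<open>A class is the sum of the pure tensors in any of its lists, and a scalar can be absorbed
  into a factor, so closure under addition reaches every tensor.\<close>

lemma tensor_induct [consumes 1, case_names zero pure add]:
  assumes "x \<in> carrier (tensor_space V W)" and zero: "P \<zero>\<^bsub>tensor_space V W\<^esub>"
    and pure: "\<And>v w. \<lbrakk>v \<in> carrier V; w \<in> carrier W\<rbrakk> \<Longrightarrow> P (pure_tensor V W v w)"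
    and add: "\<And>x y. \<lbrakk>x \<in> carrier (tensor_space V W); y \<in> carrier (tensor_space V W); P x; P y\<rbrakk>
      \<Longrightarrow> P (x \<oplus>\<^bsub>tensor_space V W\<^esub> y)"
  shows "P x"
proof -
  obtain xs where xs: "set xs \<subseteq> carrier V \<times> carrier W" "x = tensor_class V W xs"
    using assms(1) by (rule carrier_tensorE)
  from xs(1) have "P (tensor_class V W xs)"
  proof (induction xs)
    case Nil
    then show ?case by (simp add: zero tensor_class_Nil)
  next
    case (Cons p xs)
    then show ?case
      by (cases p) (simp add: tensor_class_Cons add pure tensor_class_in_carrier)
  qed
  then show ?thesis by (simp add: xs)
qed

lemma pure_tensor_add_left:
  "\<lbrakk>v \<in> carrier V; v' \<in> carrier V; w \<in> carrier W\<rbrakk> \<Longrightarrow> pure_tensor V W (v \<oplus>\<^bsub>V\<^esub> v') w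
    = pure_tensor V W v w \<oplus>\<^bsub>tensor_space V W\<^esub> pure_tensor V W v' w"
  unfolding pure_tensor_def
  by (subst tensor_class_append) (auto intro: tensor_class_eqI tensor_eq.add_left)

lemma pure_tensor_add_right:
  "\<lbrakk>v \<in> carrier V; w \<in> carrier W; w' \<in> carrier W\<rbrakk> \<Longrightarrow> pure_tensor V W v (w \<oplus>\<^bsub>W\<^esub> w')
    = pure_tensor V W v w \<oplus>\<^bsub>tensor_space V W\<^esub> pure_tensor V W v w'"
  unfolding pure_tensor_def
  by (subst tensor_class_append) (auto intro: tensor_class_eqI tensor_eq.add_right)

lemma pure_tensor_smult_left:
  "\<lbrakk>v \<in> carrier V; w \<in> carrier W\<rbrakk> \<Longrightarrow> pure_tensor V W (c \<odot>\<^bsub>V\<^esub> v) w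
    = c \<odot>\<^bsub>tensor_space V W\<^esub> pure_tensor V W v w"
  unfolding pure_tensor_def by (subst tensor_class_smult) auto

lemma pure_tensor_smult_right:
  "\<lbrakk>v \<in> carrier V; w \<in> carrier W\<rbrakk> \<Longrightarrow> pure_tensor V W v (c \<odot>\<^bsub>W\<^esub> w)
    = c \<odot>\<^bsub>tensor_space V W\<^esub> pure_tensor V W v w"
  by (subst pure_tensor_smult_left[symmetric], assumption+)
    (auto simp: pure_tensor_def intro!: tensor_class_eqI tensor_eq.sym[OF tensor_eq.balanced])

lemma pure_tensor_zero_left: "w \<in> carrier W \<Longrightarrow> pure_tensor V W \<zero>\<^bsub>V\<^esub> w = \<zero>\<^bsub>tensor_space V W\<^esub>"
  by (simp add: pure_tensor_def flip: tensor_class_Nil) (intro tensor_class_eqI tensor_eq.zero)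

text \<open>Associativity, commutativity and additivity of scaling are read off from concatenation
  of lists. The remaining laws for scalars are checked on pure tensors, where a scalar acts on the
  left factor, and extended by \<open>tensor_induct\<close>.\<close>

lemma vs_tensor [simp]: "vs (tensor_space V W)"
proof -
  let ?T = "tensor_space V W"
  have closed: "x \<oplus>\<^bsub>?T\<^esub> y \<in> carrier ?T" if "x \<in> carrier ?T" "y \<in> carrier ?T" for x y
    using that
    by (metis carrier_tensorE tensor_class_append tensor_class_in_carrier le_sup_iff set_append)
  have assoc: "(x \<oplus>\<^bsub>?T\<^esub> y) \<oplus>\<^bsub>?T\<^esub> z = x \<oplus>\<^bsub>?T\<^esub> (y \<oplus>\<^bsub>?T\<^esub> z)"
    if "x \<in> carrier ?T" "y \<in> carrier ?T" "z \<in> carrier ?T" for x y z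
    using that by (auto elim!: carrier_tensorE simp: tensor_class_append)
  have comm: "x \<oplus>\<^bsub>?T\<^esub> y = y \<oplus>\<^bsub>?T\<^esub> x" if *: "x \<in> carrier ?T" "y \<in> carrier ?T" for x y
  proof -
    obtain xs where xs: "set xs \<subseteq> carrier V \<times> carrier W" "x = tensor_class V W xs"
      using *(1) by (rule carrier_tensorE)
    obtain ys where ys: "set ys \<subseteq> carrier V \<times> carrier W" "y = tensor_class V W ys"
      using *(2) by (rule carrier_tensorE)
    show ?thesis
      using tensor_class_eqI[OF tensor_eq.commute[OF xs(1) ys(1)]] xs ys by (simp add: tensor_class_append)
  qed
  have zero: "\<zero>\<^bsub>?T\<^esub> \<in> carrier ?T"
    by (simp flip: tensor_class_Nil add: tensor_class_in_carrier)
  have l_zero: "\<zero>\<^bsub>?T\<^esub> \<oplus>\<^bsub>?T\<^esub> x = x" if "x \<in> carrier ?T" for x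
    using that by (auto elim!: carrier_tensorE simp flip: tensor_class_Nil simp: tensor_class_append)
  have map_closed: "set (map (\<lambda>(v, w). (c \<odot>\<^bsub>V\<^esub> v, w)) zs) \<subseteq> carrier V \<times> carrier W"
    if "set zs \<subseteq> carrier V \<times> carrier W" for zs c
    using that V by (induction zs) auto
  have smult: "c \<odot>\<^bsub>?T\<^esub> x \<in> carrier ?T" if "x \<in> carrier ?T" for c x
    using that map_closed by (metis carrier_tensorE tensor_class_smult tensor_class_in_carrier)
  have smult_zero: "c \<odot>\<^bsub>?T\<^esub> \<zero>\<^bsub>?T\<^esub> = \<zero>\<^bsub>?T\<^esub>" for c
    using tensor_class_smult[of "[]" c] by (simp add: tensor_class_Nil)
  have smult_add: "c \<odot>\<^bsub>?T\<^esub> (x \<oplus>\<^bsub>?T\<^esub> y) = c \<odot>\<^bsub>?T\<^esub> x \<oplus>\<^bsub>?T\<^esub> c \<odot>\<^bsub>?T\<^esub> y"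
    if *: "x \<in> carrier ?T" "y \<in> carrier ?T" for c x y
  proof -
    obtain xs where xs: "set xs \<subseteq> carrier V \<times> carrier W" "x = tensor_class V W xs"
      using *(1) by (rule carrier_tensorE)
    obtain ys where ys: "set ys \<subseteq> carrier V \<times> carrier W" "y = tensor_class V W ys"
      using *(2) by (rule carrier_tensorE)
    have "set (xs @ ys) \<subseteq> carrier V \<times> carrier W" using xs ys by auto
    then show ?thesis
      using xs(1) ys(1) map_closed[OF xs(1)] map_closed[OF ys(1)]
      unfolding xs(2) ys(2) by (simp only: tensor_class_append tensor_class_smult map_append)
  qed
  have one: "1 \<odot>\<^bsub>?T\<^esub> x = x" if "x \<in> carrier ?T" for x
    using that
    by (induction rule: tensor_induct)
      (auto simp: smult_add smult_zero V simp flip: pure_tensor_smult_left)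
  have smult_smult: "(c * d) \<odot>\<^bsub>?T\<^esub> x = c \<odot>\<^bsub>?T\<^esub> (d \<odot>\<^bsub>?T\<^esub> x)" if "x \<in> carrier ?T" for c d x
    using that
    by (induction rule: tensor_induct)
      (auto simp: smult_add smult_zero V smult simp flip: pure_tensor_smult_left)
  have null: "0 \<odot>\<^bsub>?T\<^esub> x = \<zero>\<^bsub>?T\<^esub>" if "x \<in> carrier ?T" for x
    using that
    by (induction rule: tensor_induct)
      (auto simp: smult_add smult_zero V smult l_zero zero pure_tensor_zero_left
        simp flip: pure_tensor_smult_left)
  have distr: "(c + d) \<odot>\<^bsub>?T\<^esub> x = c \<odot>\<^bsub>?T\<^esub> x \<oplus>\<^bsub>?T\<^esub> d \<odot>\<^bsub>?T\<^esub> x" if "x \<in> carrier ?T" for c d x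
    using that
  proof (induction rule: tensor_induct)
    case zero
    then show ?case by (simp add: smult_zero l_zero \<open>\<zero>\<^bsub>?T\<^esub> \<in> carrier ?T\<close>)
  next
    case (pure v w)
    then show ?case
      using V by (simp add: vs_smult_add pure_tensor_add_left flip: pure_tensor_smult_left)
  next
    case (add x y)
    then have "(c + d) \<odot>\<^bsub>?T\<^esub> (x \<oplus>\<^bsub>?T\<^esub> y)
        = (c \<odot>\<^bsub>?T\<^esub> x \<oplus>\<^bsub>?T\<^esub> d \<odot>\<^bsub>?T\<^esub> x) \<oplus>\<^bsub>?T\<^esub> (c \<odot>\<^bsub>?T\<^esub> y \<oplus>\<^bsub>?T\<^esub> d \<odot>\<^bsub>?T\<^esub> y)"
      by (simp add: smult_add)
    \<comment> \<open>The module laws of \<open>?T\<close> are still being established, so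
      \<open>vs_ac\<close> cannot be applied to it and the two middle summands are exchanged by
      hand.\<close>
    also have "\<dots> = c \<odot>\<^bsub>?T\<^esub> x \<oplus>\<^bsub>?T\<^esub> ((d \<odot>\<^bsub>?T\<^esub> x \<oplus>\<^bsub>?T\<^esub> c \<odot>\<^bsub>?T\<^esub> y) \<oplus>\<^bsub>?T\<^esub> d \<odot>\<^bsub>?T\<^esub> y)"
      using add by (simp add: assoc smult closed)
    also have "\<dots> = c \<odot>\<^bsub>?T\<^esub> x \<oplus>\<^bsub>?T\<^esub> ((c \<odot>\<^bsub>?T\<^esub> y \<oplus>\<^bsub>?T\<^esub> d \<odot>\<^bsub>?T\<^esub> x) \<oplus>\<^bsub>?T\<^esub> d \<odot>\<^bsub>?T\<^esub> y)"
      using add comm[of "d \<odot>\<^bsub>?T\<^esub> x" "c \<odot>\<^bsub>?T\<^esub> y"] by (simp add: smult)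
    also have "\<dots> = c \<odot>\<^bsub>?T\<^esub> (x \<oplus>\<^bsub>?T\<^esub> y) \<oplus>\<^bsub>?T\<^esub> d \<odot>\<^bsub>?T\<^esub> (x \<oplus>\<^bsub>?T\<^esub> y)"
      using add by (simp add: assoc smult closed smult_add)
    finally show ?case .
  qed
  show ?thesis
    by (rule vsI) (use closed zero assoc comm l_zero smult distr smult_add smult_smult one null in auto)
qed

lemma bilinear_pure_tensor: "bilinear_on V W (tensor_space V W) (pure_tensor V W)"
  by (simp add: bilinear_on_def linear_on_def pure_tensor_add_left pure_tensor_add_right
      pure_tensor_smult_left pure_tensor_smult_right)

text \<open>Linear extension in one factor at a time: the right factor varies over
  \<open>carrier W\<close> while the left one stays in \<open>S\<close>, and the left factor is
  freed afterwards.\<close>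

lemma spanning_pure_tensor:
  assumes S: "spanning V S" and T: "spanning W T"
  shows "spanning (tensor_space V W) {pure_tensor V W s t |s t. s \<in> S \<and> t \<in> T}"
proof -
  let ?P = "{pure_tensor V W s t |s t. s \<in> S \<and> t \<in> T}"
  have *: "S \<subseteq> carrier V" "carrier V \<subseteq> span_of V S" "T \<subseteq> carrier W" "carrier W \<subseteq> span_of W T"
    using S T by (auto simp: spanning_def)
  have 1: "pure_tensor V W s w \<in> span_of (tensor_space V W) ?P" if "s \<in> S" "w \<in> carrier W" for s w
    by (rule linear_on_span_of[OF W vs_tensor, where S = T and h = "pure_tensor V W s"])
      (use that * bilinear_pure_tensor in \<open>auto simp: bilinear_on_def intro: span_of.base\<close>)
  have 2: "pure_tensor V W v w \<in> span_of (tensor_space V W) ?P" if "v \<in> carrier V" "w \<in> carrier W" for v w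
    by (rule linear_on_span_of[OF V vs_tensor, where S = S and h = "\<lambda>v. pure_tensor V W v w"])
      (use that * 1 bilinear_pure_tensor in \<open>auto simp: bilinear_on_def\<close>)
  have "x \<in> span_of (tensor_space V W) ?P" if "x \<in> carrier (tensor_space V W)" for x
    using that by (induction rule: tensor_induct) (auto intro: 2 span_of.zero span_of.add)
  then show ?thesis
    using * by (auto simp: spanning_def intro!: pure_tensor_in_carrier)
qed

end

section \<open>The universal property of the tensor product\<close>

definition tensor_lift :: "'v gspace \<Rightarrow> ('a gvec \<Rightarrow> 'a gvec \<Rightarrow> 'v) \<Rightarrow> 'a gvec \<Rightarrow> 'v" where
  "tensor_lift X \<beta> x = foldr (\<lambda>(v, w) y. \<beta> v w \<oplus>\<^bsub>X\<^esub> y) (terms_of x) \<zero>\<^bsub>X\<^esub>"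

context
  fixes V W :: "'a gvec gspace" and X :: "'v gspace" and \<beta>
  assumes V: "vs V" and W: "vs W" and X: "vs X" and \<beta>: "bilinear_on V W X \<beta>"
begin

private abbreviation "L xs \<equiv> foldr (\<lambda>(v, w) y. \<beta> v w \<oplus>\<^bsub>X\<^esub> y) xs \<zero>\<^bsub>X\<^esub>"

private lemma \<beta>_closed: "\<lbrakk>v \<in> carrier V; w \<in> carrier W\<rbrakk> \<Longrightarrow> \<beta> v w \<in> carrier X"
  using \<beta> by (simp add: bilinear_on_def linear_on_def)

private lemma L_closed: "set xs \<subseteq> carrier V \<times> carrier W \<Longrightarrow> L xs \<in> carrier X"
  by (induction xs) (auto simp: X \<beta>_closed)

private lemma L_append:
  "\<lbrakk>set xs \<subseteq> carrier V \<times> carrier W; set ys \<subseteq> carrier V \<times> carrier W\<rbrakk>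
    \<Longrightarrow> L (xs @ ys) = L xs \<oplus>\<^bsub>X\<^esub> L ys"
proof (induction xs)
  case Nil
  then show ?case using X L_closed[of ys] by simp
next
  case (Cons p xs)
  then show ?case
    using X L_closed[of xs] L_closed[of ys] by (cases p) (simp add: vs_ac \<beta>_closed)
qed

text \<open>Each generating relation becomes an identity satisfied by every bilinear map. Hence
  folding \<beta> over the chosen representative gives a value that does not depend on the
  choice.\<close>

private lemma L_tensor_eq: "tensor_eq V W xs ys \<Longrightarrow> L xs = L ys"
proof (induction rule: tensor_eq.induct)
  case (append xs xs' ys ys')
  then show ?case
    using tensor_eq_closed[OF V W append(1)] tensor_eq_closed[OF V W append(2)] by (simp only: L_append)
next
  case (commute xs ys)
  then show ?case using X L_closed by (simp only: L_append) (simp add: vs_ac)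
next
  case (zero w)
  then have "\<beta> \<zero>\<^bsub>V\<^esub> w = \<zero>\<^bsub>X\<^esub>"
    using \<beta> by (intro linear_on_zero[OF V X, of "\<lambda>v. \<beta> v w"]) (auto simp: bilinear_on_def)
  then show ?case using X by simp
next
  case (add_left v v' w)
  then show ?case using X V \<beta> by (simp add: \<beta>_closed bilinear_on_def linear_on_def)
next
  case (add_right v w w')
  then show ?case using X V \<beta> by (simp add: \<beta>_closed bilinear_on_def linear_on_def)
next
  case (balanced v w c)
  then show ?case using X V \<beta> by (simp add: \<beta>_closed bilinear_on_def linear_on_def)
qed auto

private lemma tensor_lift_class: "set xs \<subseteq> carrier V \<times> carrier W \<Longrightarrow> tensor_lift X \<beta> (tensor_class V W xs) = L xs"
  unfolding tensor_lift_def
  by (rule L_tensor_eq[symmetric]) (rule tensor_eq_terms_of)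

lemma tensor_lift_pure [simp]:
  "\<lbrakk>v \<in> carrier V; w \<in> carrier W\<rbrakk> \<Longrightarrow> tensor_lift X \<beta> (pure_tensor V W v w) = \<beta> v w"
  unfolding pure_tensor_def by (subst tensor_lift_class) (auto simp: X \<beta>_closed)

lemma linear_on_tensor_lift: "linear_on (tensor_space V W) X (tensor_lift X \<beta>)"
proof -
  let ?T = "tensor_space V W"
  have tl_add: "tensor_lift X \<beta> (x \<oplus>\<^bsub>?T\<^esub> y) = tensor_lift X \<beta> x \<oplus>\<^bsub>X\<^esub> tensor_lift X \<beta> y"
    if "x \<in> carrier ?T" "y \<in> carrier ?T" for x y
    using that
    by (auto elim!: carrier_tensorE[OF V W])
      (subst tensor_class_append[OF V W]; simp add: tensor_lift_class del: foldr_append;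
        rule L_append; assumption)
  have closed: "tensor_lift X \<beta> x \<in> carrier X" if "x \<in> carrier ?T" for x
    using that by (auto elim!: carrier_tensorE[OF V W] simp: tensor_lift_class L_closed)
  have zero: "tensor_lift X \<beta> \<zero>\<^bsub>?T\<^esub> = \<zero>\<^bsub>X\<^esub>"
    by (simp flip: tensor_class_Nil[OF V W] add: tensor_lift_class)
  have "tensor_lift X \<beta> (c \<odot>\<^bsub>?T\<^esub> x) = c \<odot>\<^bsub>X\<^esub> tensor_lift X \<beta> x" if "x \<in> carrier ?T" for x c
    using that
  proof (induction rule: tensor_induct[OF V W, consumes 1, case_names zero pure add])
    case zero
    then show ?case by (simp add: vs_tensor[OF V W] X \<open>tensor_lift X \<beta> \<zero>\<^bsub>?T\<^esub> = \<zero>\<^bsub>X\<^esub>\<close>)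
  next
    case (pure v w)
    then show ?case
      using \<beta> V
      by (simp flip: pure_tensor_smult_left[OF V W] add: bilinear_on_def linear_on_def)
  next
    case (add x y)
    then show ?case
      using V W X by (simp add: vs_smult_add tl_add closed)
  qed
  then show ?thesis
    by (simp add: linear_on_def tl_add closed)
qed

end

lemma bilinear_on_compose:
  assumes "bilinear_on V W X \<beta>" "linear_on V' V f" "linear_on W' W g"
  shows "bilinear_on V' W' X (\<lambda>v w. \<beta> (f v) (g w))"
  using assms by (auto simp: bilinear_on_def linear_on_def)

lemma bilinear_on_compose_result:
  assumes "bilinear_on V W X \<beta>" "linear_on X Y h"
  shows "bilinear_on V W Y (\<lambda>v w. h (\<beta> v w))"
  using assms by (auto simp: bilinear_on_def linear_on_def)

section \<open>Graded spaces\<close>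

text \<open>Every element of the group has order at most 2. As a simp rule this erases the antipode,
  hides the inversion of degrees under conjugation and turns \<open>oct_e (- a)\<close> into
  \<open>oct_e a\<close>.\<close>

lemma G_minus [simp]: "- a = (a :: G)"
  by (simp add: vec_eq_iff)

lemma G_add_self [simp]: "a + a = (0 :: G)" "a + (a + b) = (b :: G)"
  by (simp_all add: vec_eq_iff bit_add_self bit_add_self_left)

lemma spanning_mono: "\<lbrakk>vs V; spanning V S; S \<subseteq> T; T \<subseteq> carrier V\<rbrakk> \<Longrightarrow> spanning V T"
proof -
  assume *: "vs V" "spanning V S" "S \<subseteq> T" "T \<subseteq> carrier V"
  have "x \<in> span_of V T" if "x \<in> span_of V S" for x
    using linear_on_span_of[OF *(1) *(1) linear_on_id _ _ that, of T] * by (auto simp: spanning_def intro: span_of.base)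
  then show ?thesis using * by (auto simp: spanning_def)
qed

lemma span_of_subset_subspace: "\<lbrakk>subspace_of V H; S \<subseteq> H; x \<in> span_of V S\<rbrakk> \<Longrightarrow> x \<in> H"
  by (rotate_tac 2, induction rule: span_of.induct) (auto simp: subspace_of_def)

lemma linear_on_into_subspace:
  assumes "vs V" "vs W" "linear_on V W h" "spanning V S" "subspace_of W H" "\<And>s. s \<in> S \<Longrightarrow> h s \<in> H"
    and "x \<in> carrier V"
  shows "h x \<in> H"
proof (rule span_of_subset_subspace[OF assms(5), of H])
  show "h x \<in> span_of W H"
    by (rule linear_on_span_of[OF assms(1-3), of S]) (use assms in \<open>auto simp: spanning_def intro: span_of.base\<close>)
qed simp

text \<open>Zero lies in every component, so a vector of this set need not determine its degree.
  Facts about homogeneous vectors therefore take the degree as a separate argument.\<close>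

definition homog :: "'v gspace \<Rightarrow> 'v set" where
  "homog V = (\<Union>a. hcomp V a)"

definition proj :: "'v gspace \<Rightarrow> G \<Rightarrow> 'v \<Rightarrow> 'v" where
  "proj V a v = (THE p. (\<forall>a. p a \<in> hcomp V a) \<and> v = (\<Oplus>\<^bsub>V\<^esub>a\<in>UNIV. p a)) a"

lemma graded_space_vs [simp]: "graded_space V \<Longrightarrow> vs V"
  by (simp add: graded_space_def)

lemma graded_space_subspace: "graded_space V \<Longrightarrow> subspace_of V (hcomp V a)"
  using submodule_iff_subspace_of unfolding graded_space_def by blast

lemma hcomp_in_carrier [simp]: "\<lbrakk>graded_space V; v \<in> hcomp V a\<rbrakk> \<Longrightarrow> v \<in> carrier V"
  using graded_space_subspace[of V a] by (auto simp: subspace_of_def)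

lemma hcomp_simps [simp]:
  assumes "graded_space V"
  shows "\<zero>\<^bsub>V\<^esub> \<in> hcomp V a"
    and "\<lbrakk>x \<in> hcomp V a; y \<in> hcomp V a\<rbrakk> \<Longrightarrow> x \<oplus>\<^bsub>V\<^esub> y \<in> hcomp V a"
    and "x \<in> hcomp V a \<Longrightarrow> c \<odot>\<^bsub>V\<^esub> x \<in> hcomp V a"
  using graded_space_subspace[OF assms, of a] by (auto simp: subspace_of_def)

lemma homog_in_carrier: "\<lbrakk>graded_space V; v \<in> homog V\<rbrakk> \<Longrightarrow> v \<in> carrier V"
  by (auto simp: homog_def)

lemma proj_sum:
  assumes "graded_space V" "v \<in> carrier V"
  shows proj_in_hcomp: "proj V a v \<in> hcomp V a" and finsum_proj: "(\<Oplus>\<^bsub>V\<^esub>a\<in>UNIV. proj V a v) = v"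
    and proj_unique: "\<lbrakk>\<And>a. p a \<in> hcomp V a; v = finsum V p UNIV\<rbrakk> \<Longrightarrow> proj V a v = p a"
proof -
  have ex: "\<exists>!p. (\<forall>a. p a \<in> hcomp V a) \<and> v = (\<Oplus>\<^bsub>V\<^esub>a\<in>UNIV. p a)"
    using assms unfolding graded_space_def by blast
  show "proj V a v \<in> hcomp V a" "(\<Oplus>\<^bsub>V\<^esub>a\<in>UNIV. proj V a v) = v"
    using theI'[OF ex] by (simp_all add: proj_def)
  show "proj V a v = p a" if "\<And>a. p a \<in> hcomp V a" "v = finsum V p UNIV"
    unfolding proj_def using the1_equality[OF ex, of p] that by auto
qed

lemma proj_homog:
  assumes "graded_space V" "v \<in> hcomp V b"
  shows "proj V a v = (if a = b then v else \<zero>\<^bsub>V\<^esub>)"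
  using assms by (intro proj_unique) (auto intro!: finsum_single[symmetric, of _ b])

text \<open>Adding or scaling decompositions componentwise yields a decomposition of the sum or
  multiple, and decompositions are unique.\<close>

lemma linear_on_proj: "graded_space V \<Longrightarrow> linear_on V V (proj V a)"
proof -
  assume V: "graded_space V"
  have in_carrier: "proj V a v \<in> carrier V" if "v \<in> carrier V" for v a
    using proj_in_hcomp[OF V that] V by (rule hcomp_in_carrier[rotated])
  have "proj V a (v \<oplus>\<^bsub>V\<^esub> w) = proj V a v \<oplus>\<^bsub>V\<^esub> proj V a w" if "v \<in> carrier V" "w \<in> carrier V" for v w
  proof (rule proj_unique)
    have "v \<oplus>\<^bsub>V\<^esub> w = (\<Oplus>\<^bsub>V\<^esub>a\<in>UNIV. proj V a v) \<oplus>\<^bsub>V\<^esub> (\<Oplus>\<^bsub>V\<^esub>a\<in>UNIV. proj V a w)"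
      using V that by (simp add: finsum_proj)
    also have "\<dots> = (\<Oplus>\<^bsub>V\<^esub>a\<in>UNIV. proj V a v \<oplus>\<^bsub>V\<^esub> proj V a w)"
      using V that in_carrier
      by (intro abelian_monoid.finsum_addf[OF vs_abelian_monoid, symmetric]) auto
    finally show "v \<oplus>\<^bsub>V\<^esub> w = (\<Oplus>\<^bsub>V\<^esub>a\<in>UNIV. proj V a v \<oplus>\<^bsub>V\<^esub> proj V a w)" .
  qed (use V that in \<open>auto intro!: hcomp_simps proj_in_hcomp\<close>)
  moreover have "proj V a (c \<odot>\<^bsub>V\<^esub> v) = c \<odot>\<^bsub>V\<^esub> proj V a v" if "v \<in> carrier V" for c v
  proof (rule proj_unique)
    have "c \<odot>\<^bsub>V\<^esub> v = c \<odot>\<^bsub>V\<^esub> (\<Oplus>\<^bsub>V\<^esub>a\<in>UNIV. proj V a v)"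
      using V that by (simp add: finsum_proj)
    also have "\<dots> = (\<Oplus>\<^bsub>V\<^esub>a\<in>UNIV. c \<odot>\<^bsub>V\<^esub> proj V a v)"
      using V that in_carrier by (intro module.finsum_smult_ldistr[of complex_ring]) auto
    finally show "c \<odot>\<^bsub>V\<^esub> v = (\<Oplus>\<^bsub>V\<^esub>a\<in>UNIV. c \<odot>\<^bsub>V\<^esub> proj V a v)" .
  qed (use V that in \<open>auto intro!: hcomp_simps proj_in_hcomp\<close>)
  ultimately show ?thesis
    using in_carrier by (simp add: linear_on_def)
qed

lemma spanning_homog: "graded_space V \<Longrightarrow> spanning V (homog V)"
proof -
  assume V: "graded_space V"
  have "v \<in> span_of V (homog V)" if "v \<in> carrier V" for v
  proof -
    have "(\<Oplus>\<^bsub>V\<^esub>a\<in>UNIV. proj V a v) \<in> span_of V (homog V)"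
      using V proj_in_hcomp[OF V that]
      by (intro span_of_finsum) (auto simp: homog_def intro!: span_of.base)
    then show ?thesis using V that by (simp add: finsum_proj)
  qed
  then show ?thesis
    using V by (auto simp: spanning_def homog_def)
qed

text \<open>A grading is recognised by its projections. The sum of all \<open>P a\<close> is the
  identity on homogeneous vectors, hence everywhere, which gives a decomposition. Applying
  \<open>P a\<close> to any decomposition recovers its component of degree \<open>a\<close>, which
  gives uniqueness.\<close>

lemma graded_spaceI:
  assumes V: "vs V" and H: "\<And>a. subspace_of V (hcomp V a)" and P: "\<And>a. linear_on V V (P a)"
    and P_hcomp: "\<And>a v. v \<in> carrier V \<Longrightarrow> P a v \<in> hcomp V a"
    and P_homog: "\<And>a b v. v \<in> hcomp V b \<Longrightarrow> P a v = (if a = b then v else \<zero>\<^bsub>V\<^esub>)"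
    and S: "spanning V (homog V)"
  shows "graded_space V"
  unfolding graded_space_def
proof (intro conjI allI ballI)
  show "submodule (hcomp V a) complex_ring V" for a
    using V H by (simp add: submodule_iff_subspace_of)
  have car: "v \<in> hcomp V a \<Longrightarrow> v \<in> carrier V" for v a
    using H[of a] by (auto simp: subspace_of_def)
  fix v assume v: "v \<in> carrier V"
  have sum: "(\<Oplus>\<^bsub>V\<^esub>a\<in>UNIV. P a v) = v"
  proof (rule linear_on_eq[OF V V linear_on_finsum linear_on_id S])
    fix s assume "s \<in> homog V"
    then obtain b where "s \<in> hcomp V b" by (auto simp: homog_def)
    then show "(\<Oplus>\<^bsub>V\<^esub>a\<in>UNIV. P a s) = s"
      using V car by (intro finsum_single[of _ b]) (auto simp: P_homog)
  qed (use V P v in auto)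
  show "\<exists>!p. (\<forall>a. p a \<in> hcomp V a) \<and> v = (\<Oplus>\<^bsub>V\<^esub>a\<in>UNIV. p a)"
  proof (rule ex1I[of _ "\<lambda>a. P a v"])
    show "(\<forall>a. P a v \<in> hcomp V a) \<and> v = (\<Oplus>\<^bsub>V\<^esub>a\<in>UNIV. P a v)"
      using v by (simp add: P_hcomp sum)
    fix p assume p: "(\<forall>a. p a \<in> hcomp V a) \<and> v = (\<Oplus>\<^bsub>V\<^esub>a\<in>UNIV. p a)"
    have "P a v = p a" for a
    proof -
      have "P a v = (\<Oplus>\<^bsub>V\<^esub>b\<in>UNIV. P a (p b))"
        using p car V P by (auto intro!: linear_on_apply_finsum)
      also have "\<dots> = p a"
      proof (rule finsum_single[OF V])
        show "P a (p b) = (if b = a then p a else \<zero>\<^bsub>V\<^esub>)" for b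
          using p P_homog[of "p b" b a] by auto
      qed (use p car in auto)
      finally show ?thesis .
    qed
    then show "p = (\<lambda>a. P a v)" by auto
  qed
qed (use V in auto)

text \<open>A family \<beta> indexed by degrees becomes one bilinear map: both arguments are split
  into components and all 64 pairs of degrees are summed.\<close>

definition homog_lift ::
  "'a gvec gspace \<Rightarrow> 'a gvec gspace \<Rightarrow> 'v gspace \<Rightarrow> (G \<Rightarrow> G \<Rightarrow> 'a gvec \<Rightarrow> 'a gvec \<Rightarrow> 'v) \<Rightarrow> 'a gvec \<Rightarrow> 'v" where
  "homog_lift V W X \<beta> = tensor_lift X
     (\<lambda>v w. \<Oplus>\<^bsub>X\<^esub>p\<in>UNIV. \<beta> (fst p) (snd p) (proj V (fst p) v) (proj W (snd p) w))"

lemma bilinear_on_finsum: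
  assumes "vs X" "finite A" "\<And>i. i \<in> A \<Longrightarrow> bilinear_on V W X (\<beta> i)"
  shows "bilinear_on V W X (\<lambda>v w. \<Oplus>\<^bsub>X\<^esub>i\<in>A. \<beta> i v w)"
  using assms by (auto simp: bilinear_on_def intro!: linear_on_finsum)

context
  fixes V W :: "'a gvec gspace" and X :: "'v gspace"
    and \<beta> :: "G \<Rightarrow> G \<Rightarrow> 'a gvec \<Rightarrow> 'a gvec \<Rightarrow> 'v"
  assumes V: "graded_space V" and W: "graded_space W" and X: "vs X"
    and \<beta>: "\<And>a b. bilinear_on V W X (\<beta> a b)"
begin

private lemma bil: "bilinear_on V W X (\<lambda>v w. \<Oplus>\<^bsub>X\<^esub>p\<in>UNIV. \<beta> (fst p) (snd p) (proj V (fst p) v) (proj W (snd p) w))"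
  by (rule bilinear_on_finsum[OF X finite])
    (rule bilinear_on_compose[OF \<beta> linear_on_proj[OF V] linear_on_proj[OF W]])

lemma linear_on_homog_lift: "linear_on (tensor_space V W) X (homog_lift V W X \<beta>)"
  unfolding homog_lift_def by (rule linear_on_tensor_lift[OF _ _ X bil]) (use V W in auto)

lemma homog_lift_pure:
  assumes v: "v \<in> hcomp V a" and w: "w \<in> hcomp W b"
  shows "homog_lift V W X \<beta> (pure_tensor V W v w) = \<beta> a b v w"
proof -
  have car: "v \<in> carrier V" "w \<in> carrier W" using V W v w by auto
  \<comment> \<open>At every pair of degrees other than \<open>(a, b)\<close> at least one projected
    argument is zero; these are the summands that have to vanish.\<close>
  have zero: "\<beta> a' b' v \<zero>\<^bsub>W\<^esub> = \<zero>\<^bsub>X\<^esub>" "\<beta> a' b' \<zero>\<^bsub>V\<^esub> w = \<zero>\<^bsub>X\<^esub>" "\<beta> a' b' \<zero>\<^bsub>V\<^esub> \<zero>\<^bsub>W\<^esub> = \<zero>\<^bsub>X\<^esub>" for a' b'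
    using \<beta>[of a' b'] car V W X
    by (auto intro!: linear_on_zero[of W X "\<beta> a' b' v"] linear_on_zero[of V X "\<lambda>v. \<beta> a' b' v w"]
        linear_on_zero[of V X "\<lambda>v. \<beta> a' b' v \<zero>\<^bsub>W\<^esub>"] simp: bilinear_on_def)
  have closed: "\<beta> a b v w \<in> carrier X"
    using \<beta>[of a b] car by (simp add: bilinear_on_def linear_on_def)
  show ?thesis
    unfolding homog_lift_def
    using car closed zero V W X
    by (subst tensor_lift_pure[OF _ _ X bil])
      (auto simp: proj_homog[OF V v] proj_homog[OF W w] intro!: finsum_single[of _ "(a, b)"])
qed

end

section \<open>The grading of a tensor product\<close>

lemma hcomp_tensor_in_span:
  assumes V: "graded_space V" and W: "graded_space W" and "x \<in> hcomp (tensor_space V W) c"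
  shows "x \<in> span_of (tensor_space V W)
    {pure_tensor V W v w |v w. \<exists>a b. v \<in> hcomp V a \<and> w \<in> hcomp W b \<and> a + b = c}" (is "_ \<in> ?S")
proof -
  obtain xs where xs: "\<forall>(v, w)\<in>set xs. \<exists>a b. v \<in> hcomp V a \<and> w \<in> hcomp W b \<and> a + b = c"
    and x: "x = tensor_class V W xs"
    using assms(3) by (auto simp: tensor_space_def)
  from xs have "tensor_class V W xs \<in> ?S"
  proof (induction xs)
    case Nil
    then show ?case using V W by (simp add: tensor_class_Nil span_of.zero)
  next
    case (Cons p xs)
    obtain v w where p: "p = (v, w)" by (cases p)
    have "v \<in> carrier V" "w \<in> carrier W" "set xs \<subseteq> carrier V \<times> carrier W"
      using Cons.prems V W by (fastforce simp: p)+
    moreover have "pure_tensor V W v w \<in> ?S"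
      using Cons.prems by (intro span_of.base) (auto simp: p)
    ultimately show ?case
      using Cons V W by (simp add: p tensor_class_Cons span_of.add)
  qed
  then show ?thesis by (simp add: x)
qed

lemma pure_tensor_in_hcomp:
  assumes "v \<in> hcomp V a" "w \<in> hcomp W b"
  shows "pure_tensor V W v w \<in> hcomp (tensor_space V W) (a + b)"
proof -
  have "\<exists>xs. pure_tensor V W v w = tensor_class V W xs \<and>
      (\<forall>(v, w)\<in>set xs. \<exists>a' b'. v \<in> hcomp V a' \<and> w \<in> hcomp W b' \<and> a' + b' = a + b)"
    using assms by (intro exI[of _ "[(v, w)]"]) (auto simp: pure_tensor_def)
  then show ?thesis by (simp add: tensor_space_def)
qed

text \<open>The chosen representative of a homogeneous tensor may contain inhomogeneous pairs, so
  sums and multiples are computed from the witnessing lists and not from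
  \<open>terms_of\<close>.\<close>

lemma subspace_hcomp_tensor:
  assumes V: "graded_space V" and W: "graded_space W"
  shows "subspace_of (tensor_space V W) (hcomp (tensor_space V W) c)"
proof -
  let ?ok = "\<lambda>xs. \<forall>(v, w)\<in>set xs. \<exists>a b. v \<in> hcomp V a \<and> w \<in> hcomp W b \<and> a + b = c"
  have hc: "hcomp (tensor_space V W) c = tensor_class V W ` Collect ?ok"
    by (auto simp: tensor_space_def)
  have car: "set xs \<subseteq> carrier V \<times> carrier W" if "?ok xs" for xs
    using that V W by fastforce
  note vs = graded_space_vs[OF V] graded_space_vs[OF W]
  have smult: "?ok (map (\<lambda>(v, w). (k \<odot>\<^bsub>V\<^esub> v, w)) xs)" if "?ok xs" for k xs
    using that hcomp_simps(3)[OF V] by (induction xs) (auto, blast)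
  show ?thesis
    unfolding subspace_of_def
  proof (intro conjI ballI allI)
    show "hcomp (tensor_space V W) c \<subseteq> carrier (tensor_space V W)"
      using tensor_class_in_carrier[OF vs] car by (auto simp: hc)
    show "\<zero>\<^bsub>tensor_space V W\<^esub> \<in> hcomp (tensor_space V W) c"
      unfolding hc by (rule image_eqI[of _ _ "[]"]) (simp_all add: tensor_class_Nil[OF vs])
  next
    fix x y assume "x \<in> hcomp (tensor_space V W) c" "y \<in> hcomp (tensor_space V W) c"
    then obtain xs ys where "?ok xs" "x = tensor_class V W xs" "?ok ys" "y = tensor_class V W ys"
      unfolding hc by blast
    moreover from this have "?ok (xs @ ys)" by auto
    ultimately show "x \<oplus>\<^bsub>tensor_space V W\<^esub> y \<in> hcomp (tensor_space V W) c"
      unfolding hc using car by (simp only: tensor_class_append[OF vs]) blast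
  next
    fix k x assume "x \<in> hcomp (tensor_space V W) c"
    then obtain xs where "?ok xs" "x = tensor_class V W xs"
      unfolding hc by blast
    then show "k \<odot>\<^bsub>tensor_space V W\<^esub> x \<in> hcomp (tensor_space V W) c"
      unfolding hc using car smult by (simp only: tensor_class_smult[OF vs]) blast
  qed
qed

text \<open>The projection to degree \<open>c\<close> keeps a pure tensor with factors of degrees
  \<open>a\<close> and \<open>b\<close> when \<open>a + b = c\<close> and kills it otherwise. A rule
  that depends on the degrees in this way is realised by \<open>homog_lift\<close>, and
  \<open>graded_spaceI\<close> applies.\<close>

lemma graded_space_tensor [simp]:
  assumes V: "graded_space V" and W: "graded_space W"
  shows "graded_space (tensor_space V W)"
proof -
  let ?T = "tensor_space V W"
  define \<beta> where "\<beta> c a b v w = (if a + b = c then 1 else 0) \<odot>\<^bsub>?T\<^esub> pure_tensor V W v w" for c a b :: G and v w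
  have vs: "vs V" "vs W" "vs ?T" using V W by auto
  have \<beta>: "bilinear_on V W ?T (\<beta> c a b)" for a b c
    unfolding \<beta>_def
    by (rule bilinear_on_compose_result[OF bilinear_pure_tensor[OF vs(1,2)] linear_on_smult[OF vs(3) linear_on_id]])
  let ?P = "\<lambda>c. homog_lift V W ?T (\<beta> c)"
  have P: "linear_on ?T ?T (?P c)" for c
    by (rule linear_on_homog_lift[OF V W vs(3) \<beta>])
  have P_pure: "?P c (pure_tensor V W v w) = (if a + b = c then pure_tensor V W v w else \<zero>\<^bsub>?T\<^esub>)"
    if "v \<in> hcomp V a" "w \<in> hcomp W b" for v w a b c
    using that V W by (subst homog_lift_pure[OF V W vs(3) \<beta> that]) (auto simp: \<beta>_def)
  have span: "spanning ?T {pure_tensor V W v w |v w. v \<in> homog V \<and> w \<in> homog W}" (is "spanning _ ?S")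
    using spanning_pure_tensor[OF vs(1,2) spanning_homog[OF V] spanning_homog[OF W]] .
  have S: "?S \<subseteq> homog ?T"
    unfolding homog_def using pure_tensor_in_hcomp by fastforce
  have homog_car: "homog ?T \<subseteq> carrier ?T"
    using subspace_hcomp_tensor[OF V W] unfolding homog_def subspace_of_def by blast
  show ?thesis
  proof (rule graded_spaceI[where P = ?P])
    show "?P a v \<in> hcomp ?T a" if "v \<in> carrier ?T" for a v
    proof (rule linear_on_into_subspace[OF vs(3) vs(3) P span subspace_hcomp_tensor[OF V W] _ that])
      fix s assume "s \<in> ?S"
      then show "?P a s \<in> hcomp ?T a"
        using pure_tensor_in_hcomp[of _ V _ _ W] subspace_hcomp_tensor[OF V W, of a]
        by (auto simp: homog_def P_pure subspace_of_def)
    qed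
    show "?P a v = (if a = b then v else \<zero>\<^bsub>?T\<^esub>)" if "v \<in> hcomp ?T b" for a b v
    proof -
      let ?H = "{pure_tensor V W v w |v w. \<exists>a' b'. v \<in> hcomp V a' \<and> w \<in> hcomp W b' \<and> a' + b' = b}"
      have H: "?H \<subseteq> carrier ?T" using V W by auto
      have "v \<in> span_of ?T ?H" by (rule hcomp_tensor_in_span[OF V W that])
      \<comment> \<open>Stated with a scalar 1 or 0, the claim is linear in \<open>v\<close> and
        survives every rule of \<open>span_of\<close>; the case distinction that is wanted follows
        from it.\<close>
      then have "?P a v = (if a = b then 1 else 0) \<odot>\<^bsub>?T\<^esub> v"
      proof (induction rule: span_of.induct)
        case zero
        then show ?case using vs by (simp add: linear_on_zero[OF _ _ P])
      next
        case (base s)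
        then show ?case using V W by (auto simp: P_pure)
      next
        case (add x y)
        then show ?case
          using span_of_closed[OF vs(3) H] vs by (simp add: linear_onD[OF P] vs_smult_add)
      next
        case (smult x c)
        then show ?case
          using span_of_closed[OF vs(3) H] vs by (simp add: linear_onD[OF P])
      qed
      then show ?thesis
        using that subspace_hcomp_tensor[OF V W, of b] vs by (auto simp: subspace_of_def)
    qed
    show "spanning ?T (homog ?T)"
      by (rule spanning_mono[OF vs(3) span S homog_car])
  qed (use P vs subspace_hcomp_tensor[OF V W] in auto)
qed

lemma graded_unit_space [simp]: "graded_space unit_space"
proof -
  have V: "vs unit_space"
    by (rule vsI) (auto simp: unit_space_def algebra_simps)
  show ?thesis
  proof (rule graded_spaceI[where P = "\<lambda>a v. if a = 0 then v else Scalar 0"])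
    have "spanning unit_space (carrier unit_space)"
      by (auto simp: spanning_def intro: span_of.base)
    then show "spanning unit_space (homog unit_space)"
      by (rule spanning_mono[OF V]) (auto simp: homog_def unit_space_def intro!: exI[of _ 0] split: if_splits)
  qed (use V in \<open>auto simp: unit_space_def subspace_of_def linear_on_def split: if_splits\<close>)
qed

section \<open>Conjugate spaces and antilinear maps\<close>

lemma conj_space_simps [simp]:
  "carrier (conj_space V) = carrier V" "\<zero>\<^bsub>conj_space V\<^esub> = \<zero>\<^bsub>V\<^esub>" "x \<oplus>\<^bsub>conj_space V\<^esub> y = x \<oplus>\<^bsub>V\<^esub> y"
  "c \<odot>\<^bsub>conj_space V\<^esub> x = cnj c \<odot>\<^bsub>V\<^esub> x" "hcomp (conj_space V) a = hcomp V a"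
  by (simp_all add: conj_space_def)

text \<open>Scalar action and grading both return to themselves, so this is an equality of records
  and not merely an isomorphism. It makes \<open>bb\<close> an identity arrow and lets \<Upsilon> be
  inverted by another \<Upsilon>.\<close>

lemma conj_conj_space [simp]: "conj_space (conj_space V) = V"
  by (simp add: conj_space_def)

lemma finsum_conj_space [simp]: "finsum (conj_space V) = finsum V"
  by (simp add: finsum_def fun_eq_iff conj_space_def)

lemma vs_conj_space [simp]: "vs V \<Longrightarrow> vs (conj_space V)"
  by (rule vsI) (auto simp: vs_smult_add vs_ac)

text \<open>Conjugation leaves addition, and with it finite sums, unchanged, so the unique
  decompositions of \<open>V\<close> serve for its conjugate.\<close>

lemma graded_conj_space [simp]:
  assumes V: "graded_space V"
  shows "graded_space (conj_space V)"
proof -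
  have "subspace_of (conj_space V) (hcomp V a)" for a
    using graded_space_subspace[OF V, of a] by (simp add: subspace_of_def)
  moreover have "\<forall>v\<in>carrier V. \<exists>!p. (\<forall>a. p a \<in> hcomp V a) \<and> v = (\<Oplus>\<^bsub>V\<^esub>a\<in>UNIV. p a)"
    using V unfolding graded_space_def by blast
  ultimately show ?thesis
    using graded_space_vs[OF V] unfolding graded_space_def
    by (simp only: submodule_iff_subspace_of vs_conj_space conj_space_simps finsum_conj_space) simp
qed

lemma homog_conj_space [simp]: "homog (conj_space V) = homog V"
  by (simp add: homog_def)

lemma span_of_conj_space [simp]: "span_of (conj_space V) S = span_of V S"
proof -
  have 1: "x \<in> span_of V S" if "x \<in> span_of (conj_space V) S" for x and V :: "'a gspace"
    using that by (induction rule: span_of.induct) (auto intro: span_of.intros)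
  show ?thesis using 1[of _ V] 1[of _ "conj_space V"] by auto
qed

lemma spanning_conj_space [simp]: "spanning (conj_space V) S = spanning V S"
  by (simp add: spanning_def)

lemma linear_on_conj_space: "linear_on (conj_space V) (conj_space W) h = linear_on V W h"
  by (auto simp: linear_on_def) (metis complex_cnj_cnj)

text \<open>Both sides say that \<open>h\<close> is antilinear from \<open>V\<close> to
  \<open>W\<close>. Moving the bar from the source to the target gives access to the universal
  property of an unbarred tensor product.\<close>

lemma linear_on_conj_swap: "linear_on (conj_space V) W h = linear_on V (conj_space W) h"
  using linear_on_conj_space[of V "conj_space W"] by simp

section \<open>Signs\<close>

lemma bit_sign_simps [simp]: "bit_sign 0 = 1" "bit_sign 1 = - 1" "cnj (bit_sign x) = bit_sign x"
  "bit_sign x * bit_sign x = 1" "bit_sign x \<noteq> 0"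
  by (simp_all add: bit_sign_def)

lemma oct_F_simps [simp]: "cnj (oct_F a b) = oct_F a b" "oct_F a b * oct_F a b = 1" "oct_F a b \<noteq> 0"
  "oct_F a 0 = 1" "oct_F 0 a = 1"
  by (simp_all add: oct_F_def)

lemma oct_F_square_left [simp]: "oct_F a b * (oct_F a b * c) = c"
  by (simp flip: mult.assoc)

lemma oct_phi_simps [simp]: "cnj (oct_phi a b c) = oct_phi a b c" "oct_phi a b c * oct_phi a b c = 1"
  "oct_phi a 0 c = 1"
  by (simp_all add: oct_phi_eq)

text \<open>A sign is its own inverse, so the quotient that defines the coboundary becomes a product
  of four signs. Identities between coboundaries then reduce to cancelling equal factors in
  pairs.\<close>

lemma oct_phi_prod: "oct_phi a b c = oct_F b c * oct_F a (b + c) * oct_F (a + b) c * oct_F a b"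
  by (simp add: oct_phi_def field_simps)

text \<open>The exponent is a triple product, which is negated by reversing its arguments; modulo 2
  the negation is invisible.\<close>

lemma oct_phi_rev: "oct_phi c b a = oct_phi a b c"
  unfolding oct_phi_eq minus_bit_def by (simp only: distrib_left ac_simps)

text \<open>The coboundary of a coboundary is trivial: three values of \<open>oct_F\<close> occur
  twice on the left and one occurs twice on the right, and the same six remain on both
  sides.\<close>

lemma oct_phi_cocycle:
  "oct_phi b c d * oct_phi a (b + c) d * oct_phi a b c = oct_phi a b (c + d) * oct_phi (a + b) c d"
  by (simp add: oct_phi_prod ac_simps)

lemma ups_sign_simps [simp]: "cnj (ups_sign a b) = ups_sign a b" "ups_sign a b * ups_sign a b = 1"
  "ups_sign a 0 = 1" "ups_sign 0 a = 1"
  by (simp_all add: ups_sign_def)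

text \<open>The right-hand side is the factor by which \<open>oct_e a\<close> and
  \<open>oct_e b\<close> commute: they anticommute exactly when they are distinct imaginary units.
  The identity is verified on all 64 pairs of degrees.\<close>

lemma ups_sign_eq: "ups_sign a b = oct_F a b * oct_F b a"
proof -
  have *: "a = b \<longleftrightarrow> a $ 1 = b $ 1 \<and> a $ 2 = b $ 2 \<and> a $ 3 = b $ 3" for a b :: G
    by (simp add: vec_eq_iff forall_3)
  show ?thesis
    unfolding ups_sign_def oct_F_def oct_M_def * sum_3 matrix_vector_mult_def vec_lambda_beta vector_3
    by (cases "a $ 1"; cases "a $ 2"; cases "a $ 3"; cases "b $ 1"; cases "b $ 2"; cases "b $ 3") simp_all
qed

text \<open>\<open>ups_sign\<close> is a 2-cocycle because \<open>oct_phi\<close> is symmetric under reversal of its arguments.\<close>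

lemma ups_sign_cocycle: "ups_sign b c * ups_sign a (b + c) = ups_sign a b * ups_sign (a + b) c"
proof -
  have "oct_phi a b c * oct_phi c b a = 1" by (simp add: oct_phi_rev[of c b a])
  moreover have "oct_phi a b c * oct_phi c b a
      = (ups_sign b c * ups_sign a (b + c)) * (ups_sign a b * ups_sign (a + b) c)"
    by (simp add: oct_phi_prod ups_sign_eq ac_simps)
  \<comment> \<open>Two signs with product 1 agree; this line records that the second of the two
    products is a sign.\<close>
  moreover have "(ups_sign a b * ups_sign (a + b) c) * (ups_sign a b * ups_sign (a + b) c) = 1"
    by (simp add: mult.assoc mult.left_commute)
  ultimately show ?thesis
    by (metis mult.assoc mult.left_neutral mult.right_neutral)
qed


section \<open>Graded maps\<close>

text \<open>A linear map that respects degrees on a spanning set commutes with the projections,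
  since both composites agree on that set. A homogeneous vector equals its own projection, and hence
  so does its image.\<close>

lemma hcomp_preserved:
  assumes V: "graded_space V" and X: "graded_space X" and h: "linear_on V X h" and S: "spanning V S"
    and deg: "\<And>s. s \<in> S \<Longrightarrow> \<exists>b. s \<in> hcomp V b \<and> h s \<in> hcomp X b" and v: "v \<in> hcomp V a"
  shows "h v \<in> hcomp X a"
proof -
  have "h (proj V a v) = proj X a (h v)"
  proof (rule linear_on_eq[where h = "\<lambda>v. h (proj V a v)" and k = "\<lambda>v. proj X a (h v)"])
    show "linear_on V X (\<lambda>v. h (proj V a v))" "linear_on V X (\<lambda>v. proj X a (h v))"
      by (rule linear_on_comp[OF linear_on_proj[OF V] h] linear_on_comp[OF h linear_on_proj[OF X]])+
    fix s assume "s \<in> S"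
    then obtain b where "s \<in> hcomp V b" "h s \<in> hcomp X b" using deg by blast
    then show "h (proj V a s) = proj X a (h s)"
      using V X h by (simp add: proj_homog[of V s b] proj_homog[of X "h s" b] linear_on_zero)
  qed (use S V X v in auto)
  then have "h v = proj X a (h v)" using V v by (simp add: proj_homog)
  moreover have "proj X a (h v) \<in> hcomp X a"
    using X linear_onD(1)[OF h] V v by (auto intro!: proj_in_hcomp)
  ultimately show ?thesis by simp
qed

lemma mk_garrow_simps [simp]: "src (mk_garrow V W h) = V" "tgt (mk_garrow V W h) = W"
  "v \<in> carrier V \<Longrightarrow> fn (mk_garrow V W h) v = h v"
  by (simp_all add: mk_garrow_def)

lemma graded_map_mk_garrow:
  assumes "graded_space V" "graded_space W" "linear_on V W h"
    and "\<And>a v. v \<in> hcomp V a \<Longrightarrow> h v \<in> hcomp W a"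
  shows "graded_map (mk_garrow V W h)"
  using assms(1,2,4) linear_onD[OF assms(3)] by (auto simp: graded_map_def mk_garrow_def)

lemma graded_mapD:
  assumes "graded_map f"
  shows graded_map_src: "graded_space (src f)" and graded_map_tgt: "graded_space (tgt f)"
    and graded_map_linear: "linear_on (src f) (tgt f) (fn f)"
    and graded_map_hcomp: "v \<in> hcomp (src f) a \<Longrightarrow> fn f v \<in> hcomp (tgt f) a"
    and graded_map_extensional: "fn f \<in> carrier (src f) \<rightarrow>\<^sub>E carrier (tgt f)"
  using assms unfolding graded_map_def linear_on_def by (blast dest: PiE_mem)+

text \<open>The codomain is a separate variable fixed by an equation, so that the rule also fires
  when a goal names it in a form other than \<open>tgt f\<close>.\<close>

lemma fn_in_carrier [simp]:
  "\<lbrakk>graded_map f; tgt f = W; v \<in> carrier (src f)\<rbrakk> \<Longrightarrow> fn f v \<in> carrier W"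
  using graded_map_linear[of f] by (auto simp: linear_on_def)

lemma fn_in_hcomp [simp]:
  "\<lbrakk>graded_map f; tgt f = W; v \<in> hcomp (src f) a\<rbrakk> \<Longrightarrow> fn f v \<in> hcomp W a"
  using graded_map_hcomp[of f v a] by auto

lemma fn_smult [simp]:
  "\<lbrakk>graded_map f; src f = V; v \<in> carrier V\<rbrakk> \<Longrightarrow> fn f (c \<odot>\<^bsub>V\<^esub> v) = c \<odot>\<^bsub>tgt f\<^esub> fn f v"
  using graded_map_linear[of f] by (auto simp: linear_on_def)

text \<open>Arrows are \<open>undefined\<close> outside the carrier of their source, so agreement on
  a spanning set gives equality of the arrows themselves, as the categorical axioms demand.\<close>

lemma garrow_eqI:
  assumes f: "graded_map f" "src f = V" "tgt f = W" and g: "graded_map g" "src g = V" "tgt g = W"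
    and S: "spanning V S" "\<And>s. s \<in> S \<Longrightarrow> fn f s = fn g s"
  shows "f = g"
proof -
  have "fn f = fn g"
  proof (rule PiE_ext)
    show "fn f \<in> carrier V \<rightarrow>\<^sub>E carrier W" "fn g \<in> carrier V \<rightarrow>\<^sub>E carrier W"
      using graded_map_extensional[OF f(1)] graded_map_extensional[OF g(1)] f g by auto
    show "fn f v = fn g v" if "v \<in> carrier V" for v
      by (rule linear_on_eq[of V W, OF _ _ _ _ S that])
        (use graded_map_src[OF f(1)] graded_map_tgt[OF f(1)] graded_map_linear[OF f(1)]
          graded_map_linear[OF g(1)] f g in auto)
  qed
  then show ?thesis using f g by (cases f; cases g) auto
qed

text \<open>A definite description is resolved by exhibiting one graded map with the property,
  provided that the property fixes the values on a spanning set.\<close>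

lemma the_graded_map_eq:
  assumes f: "graded_map f" "src f = V" "tgt f = W" and P: "P (fn f)" and S: "spanning V S"
    and uniq: "\<And>g s. \<lbrakk>P g; s \<in> S\<rbrakk> \<Longrightarrow> g s = fn f s"
  shows "the_graded_map V W P = f"
  unfolding the_graded_map_def
proof (rule the_equality)
  fix g assume "graded_map g \<and> src g = V \<and> tgt g = W \<and> P (fn g)"
  then show "g = f" using f S uniq by (intro garrow_eqI[of g V W f S]) auto
qed (use f P in auto)

lemma spanning_homog_tensor:
  assumes "graded_space V" "graded_space W"
  shows "spanning (tensor_space V W) {pure_tensor V W v w |v w. v \<in> homog V \<and> w \<in> homog W}"
  using assms by (intro spanning_pure_tensor spanning_homog) auto

lemma spanning_homog_tensor3:
  assumes "graded_space U" "graded_space V" "graded_space W"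
  shows "spanning (tensor_space (tensor_space U V) W)
    {pure_tensor (tensor_space U V) W (pure_tensor U V u v) w |u v w. u \<in> homog U \<and> v \<in> homog V \<and> w \<in> homog W}"
    (is "spanning ?T ?S")
proof -
  have "spanning ?T {pure_tensor (tensor_space U V) W s w |s w.
      s \<in> {pure_tensor U V u v |u v. u \<in> homog U \<and> v \<in> homog V} \<and> w \<in> homog W}"
    using assms by (intro spanning_pure_tensor spanning_homog spanning_homog_tensor) auto
  also have "\<dots> = ?S" by blast
  finally show ?thesis .
qed

lemma spanning_homog_tensor3':
  assumes "graded_space U" "graded_space V" "graded_space W"
  shows "spanning (tensor_space U (tensor_space V W))
    {pure_tensor U (tensor_space V W) u (pure_tensor V W v w) |u v w. u \<in> homog U \<and> v \<in> homog V \<and> w \<in> homog W}"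
    (is "spanning ?T ?S")
proof -
  have "spanning ?T {pure_tensor U (tensor_space V W) u s |u s.
      u \<in> homog U \<and> s \<in> {pure_tensor V W v w |v w. v \<in> homog V \<and> w \<in> homog W}}"
    using assms by (intro spanning_pure_tensor spanning_homog spanning_homog_tensor) auto
  also have "\<dots> = ?S" by blast
  finally show ?thesis .
qed

lemma spanning_homog_tensor4:
  assumes "graded_space U" "graded_space V" "graded_space W" "graded_space X"
  shows "spanning (tensor_space (tensor_space (tensor_space U V) W) X)
    {pure_tensor (tensor_space (tensor_space U V) W) X
      (pure_tensor (tensor_space U V) W (pure_tensor U V u v) w) x |u v w x.
      u \<in> homog U \<and> v \<in> homog V \<and> w \<in> homog W \<and> x \<in> homog X}"
    (is "spanning ?T ?S")
proof -
  have "spanning ?T {pure_tensor (tensor_space (tensor_space U V) W) X s x |s x.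
      s \<in> {pure_tensor (tensor_space U V) W (pure_tensor U V u v) w |u v w. u \<in> homog U \<and> v \<in> homog V \<and> w \<in> homog W}
      \<and> x \<in> homog X}"
    using assms by (intro spanning_pure_tensor spanning_homog spanning_homog_tensor3) auto
  also have "\<dots> = ?S" by blast
  finally show ?thesis .
qed

lemma garrow_eqI_tensor:
  assumes "graded_map f" "src f = tensor_space V W" "tgt f = X" "graded_map g" "src g = tensor_space V W" "tgt g = X"
    and "graded_space V" "graded_space W"
    and "\<And>a b v w. \<lbrakk>v \<in> hcomp V a; w \<in> hcomp W b\<rbrakk> \<Longrightarrow> fn f (pure_tensor V W v w) = fn g (pure_tensor V W v w)"
  shows "f = g"
  by (rule garrow_eqI[OF assms(1-6) spanning_homog_tensor[OF assms(7,8)]]) (use assms(9) in \<open>auto simp: homog_def\<close>)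

lemma garrow_eqI_tensor3:
  assumes "graded_map f" "src f = tensor_space (tensor_space U V) W" "tgt f = X"
    "graded_map g" "src g = tensor_space (tensor_space U V) W" "tgt g = X"
    and "graded_space U" "graded_space V" "graded_space W"
    and "\<And>a b c u v w. \<lbrakk>u \<in> hcomp U a; v \<in> hcomp V b; w \<in> hcomp W c\<rbrakk>
      \<Longrightarrow> fn f (pure_tensor (tensor_space U V) W (pure_tensor U V u v) w)
        = fn g (pure_tensor (tensor_space U V) W (pure_tensor U V u v) w)"
  shows "f = g"
  by (rule garrow_eqI[OF assms(1-6) spanning_homog_tensor3[OF assms(7-9)]]) (use assms(10) in \<open>auto simp: homog_def\<close>)

lemma garrow_eqI_tensor4:
  assumes "graded_map f" "src f = tensor_space (tensor_space (tensor_space U V) W) Y" "tgt f = X"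
    "graded_map g" "src g = tensor_space (tensor_space (tensor_space U V) W) Y" "tgt g = X"
    and "graded_space U" "graded_space V" "graded_space W" "graded_space Y"
    and "\<And>a b c d u v w y. \<lbrakk>u \<in> hcomp U a; v \<in> hcomp V b; w \<in> hcomp W c; y \<in> hcomp Y d\<rbrakk>
      \<Longrightarrow> fn f (pure_tensor (tensor_space (tensor_space U V) W) Y (pure_tensor (tensor_space U V) W (pure_tensor U V u v) w) y)
        = fn g (pure_tensor (tensor_space (tensor_space U V) W) Y (pure_tensor (tensor_space U V) W (pure_tensor U V u v) w) y)"
  shows "f = g"
  by (rule garrow_eqI[OF assms(1-6) spanning_homog_tensor4[OF assms(7-10)]]) (use assms(11) in \<open>auto simp: homog_def\<close>)

subsection \<open>Tensor products of maps\<close>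

lemma tensor_map_simps [simp]:
  "src (tensor_map f g) = tensor_space (src f) (src g)" "tgt (tensor_map f g) = tensor_space (tgt f) (tgt g)"
  by (simp_all add: tensor_map_def)

context
  fixes f g :: "'a gvec garrow"
  assumes f: "graded_map f" and g: "graded_map g"
begin

private lemma vs: "vs (src f)" "vs (tgt f)" "vs (src g)" "vs (tgt g)"
  using graded_map_src[OF f] graded_map_tgt[OF f] graded_map_src[OF g] graded_map_tgt[OF g] by auto

private abbreviation "S \<equiv> tensor_space (src f) (src g)"
private abbreviation "T \<equiv> tensor_space (tgt f) (tgt g)"
private abbreviation "m \<equiv> (\<lambda>x. tensor_class (tgt f) (tgt g) (map (map_prod (fn f) (fn g)) (terms_of x)))"

private lemma map_closed: "set xs \<subseteq> carrier (src f) \<times> carrier (src g)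
  \<Longrightarrow> set (map (map_prod (fn f) (fn g)) xs) \<subseteq> carrier (tgt f) \<times> carrier (tgt g)"
  using f g by (induction xs) auto

text \<open>The image of a class can be computed from any of its lists, because related lists have
  related images.\<close>

private lemma m_class: "set xs \<subseteq> carrier (src f) \<times> carrier (src g)
  \<Longrightarrow> m (tensor_class (src f) (src g) xs) = tensor_class (tgt f) (tgt g) (map (map_prod (fn f) (fn g)) xs)"
  by (intro tensor_class_eqI tensor_eq.sym[OF tensor_eq_map[OF vs(1,3,2,4)]] tensor_eq_terms_of
      graded_map_linear f g)

private lemma m_pure: "\<lbrakk>v \<in> carrier (src f); w \<in> carrier (src g)\<rbrakk>
  \<Longrightarrow> m (pure_tensor (src f) (src g) v w) = pure_tensor (tgt f) (tgt g) (fn f v) (fn g w)"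
  using m_class[of "[(v, w)]"] by (simp add: pure_tensor_def)

private lemma m_linear: "linear_on S T m"
  unfolding linear_on_def
proof (intro conjI ballI allI)
  fix x assume x: "x \<in> carrier S"
  obtain xs where xs: "set xs \<subseteq> carrier (src f) \<times> carrier (src g)" "x = tensor_class (src f) (src g) xs"
    using x by (rule carrier_tensorE[OF vs(1,3)])
  show "m x \<in> carrier T"
    unfolding xs(2) m_class[OF xs(1)] by (rule tensor_class_in_carrier[OF vs(2,4) map_closed[OF xs(1)]])
  show "m (c \<odot>\<^bsub>S\<^esub> x) = c \<odot>\<^bsub>T\<^esub> m x" for c
  proof -
    let ?k = "map (\<lambda>(v, w). (c \<odot>\<^bsub>src f\<^esub> v, w)) xs"
    have 1: "set ?k \<subseteq> carrier (src f) \<times> carrier (src g)"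
      using xs(1) vs by (induction xs) auto
    have 2: "map (map_prod (fn f) (fn g)) ?k
        = map (\<lambda>(v, w). (c \<odot>\<^bsub>tgt f\<^esub> v, w)) (map (map_prod (fn f) (fn g)) xs)"
      using xs(1) f by (induction xs) auto
    show ?thesis
      unfolding xs(2) tensor_class_smult[OF vs(1,3) xs(1)] m_class[OF xs(1)] m_class[OF 1]
        tensor_class_smult[OF vs(2,4) map_closed[OF xs(1)]] 2 ..
  qed
  fix y assume y: "y \<in> carrier S"
  obtain ys where ys: "set ys \<subseteq> carrier (src f) \<times> carrier (src g)" "y = tensor_class (src f) (src g) ys"
    using y by (rule carrier_tensorE[OF vs(1,3)])
  have "set (xs @ ys) \<subseteq> carrier (src f) \<times> carrier (src g)" using xs(1) ys(1) by simp
  then show "m (x \<oplus>\<^bsub>S\<^esub> y) = m x \<oplus>\<^bsub>T\<^esub> m y"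
    unfolding xs(2) ys(2) tensor_class_append[OF vs(1,3) xs(1) ys(1)] m_class[OF xs(1)] m_class[OF ys(1)]
      tensor_class_append[OF vs(2,4) map_closed[OF xs(1)] map_closed[OF ys(1)]]
    by (subst m_class) simp_all
qed

lemma graded_map_tensor_map [simp]: "graded_map (tensor_map f g)"
  unfolding tensor_map_def
proof (rule graded_map_mk_garrow)
  show gr: "graded_space S" "graded_space T"
    using f g by (auto intro!: graded_space_tensor graded_mapD)
  show "linear_on S T m" by (rule m_linear)
  show "m x \<in> hcomp T a" if "x \<in> hcomp S a" for x a
  proof (rule hcomp_preserved[OF gr m_linear spanning_homog_tensor _ that])
    fix s assume "s \<in> {pure_tensor (src f) (src g) v w |v w. v \<in> homog (src f) \<and> w \<in> homog (src g)}"
    then obtain v w a b where *: "s = pure_tensor (src f) (src g) v w" "v \<in> hcomp (src f) a" "w \<in> hcomp (src g) b"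
      by (auto simp: homog_def)
    have "v \<in> carrier (src f)" "w \<in> carrier (src g)"
      using * f g by (auto intro: hcomp_in_carrier graded_map_src)
    then show "\<exists>b. s \<in> hcomp S b \<and> m s \<in> hcomp T b"
      using * f g by (intro exI[of _ "a + b"]) (simp add: m_pure pure_tensor_in_hcomp)
  qed (use f g graded_map_src in auto)
qed

lemma fn_tensor_map [simp]:
  "\<lbrakk>src f = V; src g = W; v \<in> carrier V; w \<in> carrier W\<rbrakk>
    \<Longrightarrow> fn (tensor_map f g) (pure_tensor V W v w) = pure_tensor (tgt f) (tgt g) (fn f v) (fn g w)"
  unfolding tensor_map_def using m_pure pure_tensor_in_carrier[OF vs(1,3)] by (auto simp del: map_map)

end

subsection \<open>Trilinear maps\<close>

text \<open>Fixing an outer argument leaves a bilinear map in the other two, which is the shape that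
  the two bracketings require.\<close>

definition trilinear_on where
  "trilinear_on U V W X T \<longleftrightarrow> (\<forall>w\<in>carrier W. bilinear_on U V X (\<lambda>u v. T u v w))
     \<and> (\<forall>u\<in>carrier U. bilinear_on V W X (T u))"

text \<open>The inner factorisation is made for each fixed \<open>w\<close>. Its linear dependence
  on \<open>w\<close> is evident at pure tensors and extends to all of
  \<open>tensor_space U V\<close> by \<open>tensor_induct\<close>, after which a second
  factorisation applies.\<close>

lemma trilinear_on_lift_left:
  fixes U V W :: "'a gvec gspace" and X :: "'v gspace"
  assumes U: "vs U" and V: "vs V" and W: "vs W" and X: "vs X" and T: "trilinear_on U V W X T"
  obtains h where "linear_on (tensor_space (tensor_space U V) W) X h"
    and "\<And>u v w. \<lbrakk>u \<in> carrier U; v \<in> carrier V; w \<in> carrier W\<rbrakk>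
      \<Longrightarrow> h (pure_tensor (tensor_space U V) W (pure_tensor U V u v) w) = T u v w"
proof
  let ?\<beta> = "\<lambda>x w. tensor_lift X (\<lambda>u v. T u v w) x"
  have vs: "vs (tensor_space U V)" using U V by simp
  have bil: "bilinear_on U V X (\<lambda>u v. T u v w)" if "w \<in> carrier W" for w
    using T that by (simp add: trilinear_on_def)
  have lin: "linear_on (tensor_space U V) X (\<lambda>x. ?\<beta> x w)" if "w \<in> carrier W" for w
    by (rule linear_on_tensor_lift[OF U V X bil[OF that]])
  have "linear_on W X (?\<beta> x)" if "x \<in> carrier (tensor_space U V)" for x
    using that
  proof (induction rule: tensor_induct[OF U V, consumes 1, case_names zero pure add])
    case zero
    have "linear_on W X (\<lambda>w. ?\<beta> \<zero>\<^bsub>tensor_space U V\<^esub> w) = linear_on W X (\<lambda>w. \<zero>\<^bsub>X\<^esub>)"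
      by (rule linear_on_cong[OF W]) (rule linear_on_zero[OF vs X lin])
    then show ?case using X by (simp add: linear_on_zero_map)
  next
    case (pure u v)
    have "linear_on W X (\<lambda>w. ?\<beta> (pure_tensor U V u v) w) = linear_on W X (T u v)"
      by (rule linear_on_cong[OF W]) (use U V X pure bil in simp)
    then show ?case using T pure by (simp add: trilinear_on_def bilinear_on_def)
  next
    case (add x y)
    have "linear_on W X (\<lambda>w. ?\<beta> (x \<oplus>\<^bsub>tensor_space U V\<^esub> y) w) = linear_on W X (\<lambda>w. ?\<beta> x w \<oplus>\<^bsub>X\<^esub> ?\<beta> y w)"
      by (rule linear_on_cong[OF W]) (use add in \<open>simp add: linear_onD(2)[OF lin]\<close>)
    then show ?case using X add by (simp add: linear_on_add)
  qed
  then have \<beta>: "bilinear_on (tensor_space U V) W X ?\<beta>"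
    using lin by (simp add: bilinear_on_def)
  show "linear_on (tensor_space (tensor_space U V) W) X (tensor_lift X ?\<beta>)"
    by (rule linear_on_tensor_lift[OF vs W X \<beta>])
  show "tensor_lift X ?\<beta> (pure_tensor (tensor_space U V) W (pure_tensor U V u v) w) = T u v w"
    if "u \<in> carrier U" "v \<in> carrier V" "w \<in> carrier W" for u v w
    using that U V by (simp add: tensor_lift_pure[OF vs W X \<beta>] tensor_lift_pure[OF U V X bil])
qed

text \<open>The mirror image serves the inverse of the associator, whose source carries the other
  bracketing.\<close>

lemma trilinear_on_lift_right:
  fixes U V W :: "'a gvec gspace" and X :: "'v gspace"
  assumes U: "vs U" and V: "vs V" and W: "vs W" and X: "vs X" and T: "trilinear_on U V W X T"
  obtains h where "linear_on (tensor_space U (tensor_space V W)) X h"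
    and "\<And>u v w. \<lbrakk>u \<in> carrier U; v \<in> carrier V; w \<in> carrier W\<rbrakk>
      \<Longrightarrow> h (pure_tensor U (tensor_space V W) u (pure_tensor V W v w)) = T u v w"
proof
  let ?\<beta> = "\<lambda>u x. tensor_lift X (T u) x"
  have vs: "vs (tensor_space V W)" using V W by simp
  have bil: "bilinear_on V W X (T u)" if "u \<in> carrier U" for u
    using T that by (simp add: trilinear_on_def)
  have lin: "linear_on (tensor_space V W) X (?\<beta> u)" if "u \<in> carrier U" for u
    by (rule linear_on_tensor_lift[OF V W X bil[OF that]])
  have "linear_on U X (\<lambda>u. ?\<beta> u x)" if "x \<in> carrier (tensor_space V W)" for x
    using that
  proof (induction rule: tensor_induct[OF V W, consumes 1, case_names zero pure add])
    case zero
    have "linear_on U X (\<lambda>u. ?\<beta> u \<zero>\<^bsub>tensor_space V W\<^esub>) = linear_on U X (\<lambda>u. \<zero>\<^bsub>X\<^esub>)"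
      by (rule linear_on_cong[OF U]) (rule linear_on_zero[OF vs X lin])
    then show ?case using X by (simp add: linear_on_zero_map)
  next
    case (pure v w)
    have "linear_on U X (\<lambda>u. ?\<beta> u (pure_tensor V W v w)) = linear_on U X (\<lambda>u. T u v w)"
      by (rule linear_on_cong[OF U]) (use V W X pure bil in simp)
    then show ?case using T pure by (simp add: trilinear_on_def bilinear_on_def)
  next
    case (add x y)
    have "linear_on U X (\<lambda>u. ?\<beta> u (x \<oplus>\<^bsub>tensor_space V W\<^esub> y)) = linear_on U X (\<lambda>u. ?\<beta> u x \<oplus>\<^bsub>X\<^esub> ?\<beta> u y)"
      by (rule linear_on_cong[OF U]) (use add in \<open>simp add: linear_onD(2)[OF lin]\<close>)
    then show ?case using X add by (simp add: linear_on_add)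
  qed
  then have \<beta>: "bilinear_on U (tensor_space V W) X ?\<beta>"
    using lin by (simp add: bilinear_on_def)
  show "linear_on (tensor_space U (tensor_space V W)) X (tensor_lift X ?\<beta>)"
    by (rule linear_on_tensor_lift[OF U vs X \<beta>])
  show "tensor_lift X ?\<beta> (pure_tensor U (tensor_space V W) u (pure_tensor V W v w)) = T u v w"
    if "u \<in> carrier U" "v \<in> carrier V" "w \<in> carrier W" for u v w
    using that V W by (simp add: tensor_lift_pure[OF U vs X \<beta>] tensor_lift_pure[OF V W X bil])
qed

text \<open>A factor depending on three degrees makes sense for homogeneous arguments only.
  Splitting all arguments and weighting each of the 512 triples of components by its own value of
  \<open>k\<close> gives a trilinear map with that factor.\<close>

lemma trilinear_on_twist:
  assumes U: "graded_space U" and V: "graded_space V" and W: "graded_space W" and X: "vs X"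
    and T: "trilinear_on U V W X T"
  obtains T' where "trilinear_on U V W X T'"
    and "\<And>a b c u v w. \<lbrakk>u \<in> hcomp U a; v \<in> hcomp V b; w \<in> hcomp W c\<rbrakk> \<Longrightarrow> T' u v w = k a b c \<odot>\<^bsub>X\<^esub> T u v w"
proof
  let ?t = "\<lambda>p u v w. k (fst p) (fst (snd p)) (snd (snd p))
    \<odot>\<^bsub>X\<^esub> T (proj U (fst p) u) (proj V (fst (snd p)) v) (proj W (snd (snd p)) w)"
  let ?T = "\<lambda>u v w. \<Oplus>\<^bsub>X\<^esub>p\<in>UNIV. ?t p u v w"
  have 1: "bilinear_on U V X (\<lambda>u v. ?t p u v w)" if "w \<in> carrier W" for p w
  proof -
    have "bilinear_on U V X (\<lambda>u v. T u v (proj W (snd (snd p)) w))"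
      using T that linear_onD(1)[OF linear_on_proj[OF W]] by (simp add: trilinear_on_def)
    from bilinear_on_compose_result[OF bilinear_on_compose[OF this linear_on_proj[OF U] linear_on_proj[OF V]]
        linear_on_smult[OF X linear_on_id]]
    show ?thesis .
  qed
  have 2: "bilinear_on V W X (?t p u)" if "u \<in> carrier U" for p u
  proof -
    have "bilinear_on V W X (T (proj U (fst p) u))"
      using T that linear_onD(1)[OF linear_on_proj[OF U]] by (simp add: trilinear_on_def)
    from bilinear_on_compose_result[OF bilinear_on_compose[OF this linear_on_proj[OF V] linear_on_proj[OF W]]
        linear_on_smult[OF X linear_on_id]]
    show ?thesis .
  qed
  show "trilinear_on U V W X ?T"
    unfolding trilinear_on_def using 1 2 by (auto intro!: bilinear_on_finsum X)
  fix a b c u v w assume u: "u \<in> hcomp U a" and v: "v \<in> hcomp V b" and w: "w \<in> hcomp W c"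
  have car: "u \<in> carrier U" "v \<in> carrier V" "w \<in> carrier W" using U V W u v w by auto
  have T1: "linear_on U X (\<lambda>u. T u v w)" "linear_on V X (\<lambda>v. T u v w)" "linear_on W X (\<lambda>w. T u v w)"
    if "u \<in> carrier U" "v \<in> carrier V" "w \<in> carrier W" for u v w
    using T that by (auto simp: trilinear_on_def bilinear_on_def)
  \<comment> \<open>A triple of degrees different from \<open>(a, b, c)\<close> projects at least
    one argument to zero, and trilinearity kills its summand.\<close>
  have zero: "T \<zero>\<^bsub>U\<^esub> v w = \<zero>\<^bsub>X\<^esub>" "T u \<zero>\<^bsub>V\<^esub> w = \<zero>\<^bsub>X\<^esub>" "T u v \<zero>\<^bsub>W\<^esub> = \<zero>\<^bsub>X\<^esub>"
    if "u \<in> carrier U" "v \<in> carrier V" "w \<in> carrier W" for u v w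
    using linear_on_zero[OF _ X T1(1)] linear_on_zero[OF _ X T1(2)] linear_on_zero[OF _ X T1(3)]
      that U V W by auto
  show "?T u v w = k a b c \<odot>\<^bsub>X\<^esub> T u v w"
  proof (rule finsum_single[of _ "(a, b, c)"])
    show "?t p u v w = (if p = (a, b, c) then k a b c \<odot>\<^bsub>X\<^esub> T u v w else \<zero>\<^bsub>X\<^esub>)" for p
      using car zero U V W X
      by (cases p) (auto simp: proj_homog[OF U u] proj_homog[OF V v] proj_homog[OF W w])
    show "k a b c \<odot>\<^bsub>X\<^esub> T u v w \<in> carrier X"
      using X linear_onD(1)[OF T1(1)] car by simp
  qed (use X in auto)
qed

section \<open>The structure maps\<close>

lemma trilinear_on_pure_right:
  assumes "vs U" "vs V" "vs W"
  shows "trilinear_on U V W (tensor_space U (tensor_space V W))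
    (\<lambda>u v w. pure_tensor U (tensor_space V W) u (pure_tensor V W v w))"
  using assms bilinear_pure_tensor[OF assms(2,3)] bilinear_pure_tensor[OF assms(1) vs_tensor[OF assms(2,3)]]
  by (auto simp: trilinear_on_def bilinear_on_def intro: linear_on_comp)

lemma trilinear_on_pure_left:
  assumes "vs U" "vs V" "vs W"
  shows "trilinear_on U V W (tensor_space (tensor_space U V) W)
    (\<lambda>u v w. pure_tensor (tensor_space U V) W (pure_tensor U V u v) w)"
proof -
  note * = bilinear_pure_tensor[OF assms(1,2)] bilinear_pure_tensor[OF vs_tensor[OF assms(1,2)] assms(3)]
  have "linear_on U (tensor_space (tensor_space U V) W)
      (\<lambda>u. pure_tensor (tensor_space U V) W (pure_tensor U V u v) w)" if "v \<in> carrier V" "w \<in> carrier W" for v w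
    by (rule linear_on_comp[where h = "\<lambda>u. pure_tensor U V u v" and V = "tensor_space U V"])
      (use * that in \<open>auto simp: bilinear_on_def\<close>)
  moreover have "linear_on V (tensor_space (tensor_space U V) W)
      (\<lambda>v. pure_tensor (tensor_space U V) W (pure_tensor U V u v) w)" if "u \<in> carrier U" "w \<in> carrier W" for u w
    by (rule linear_on_comp[where h = "\<lambda>v. pure_tensor U V u v" and V = "tensor_space U V"])
      (use * that in \<open>auto simp: bilinear_on_def\<close>)
  ultimately show ?thesis
    using assms * by (simp add: trilinear_on_def bilinear_on_def)
qed

text \<open>The rebracketing map, twisted by \<open>oct_phi\<close>, factors through the left
  bracketing. Source and target add up the degrees in different orders, which associativity of
  addition in the group reconciles. The conclusions are bundled because all of them rest on
  identifying the description with this one map.\<close>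

lemma assoc_map_exists:
  assumes U: "graded_space U" and V: "graded_space V" and W: "graded_space W"
  shows "graded_map (assoc_map U V W) \<and> src (assoc_map U V W) = tensor_space (tensor_space U V) W
    \<and> tgt (assoc_map U V W) = tensor_space U (tensor_space V W)
    \<and> (\<forall>a b c. \<forall>u\<in>hcomp U a. \<forall>v\<in>hcomp V b. \<forall>w\<in>hcomp W c.
      fn (assoc_map U V W) (pure_tensor (tensor_space U V) W (pure_tensor U V u v) w)
        = oct_phi a b c \<odot>\<^bsub>tensor_space U (tensor_space V W)\<^esub> pure_tensor U (tensor_space V W) u (pure_tensor V W v w))"
proof -
  let ?S = "tensor_space (tensor_space U V) W" and ?T = "tensor_space U (tensor_space V W)"
  note vs = graded_space_vs[OF U] graded_space_vs[OF V] graded_space_vs[OF W]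
  have gr: "graded_space ?S" "graded_space ?T" using U V W by auto
  obtain T where T: "trilinear_on U V W ?T T"
    and T_eq: "\<And>a b c u v w. \<lbrakk>u \<in> hcomp U a; v \<in> hcomp V b; w \<in> hcomp W c\<rbrakk>
      \<Longrightarrow> T u v w = oct_phi a b c \<odot>\<^bsub>?T\<^esub> pure_tensor U (tensor_space V W) u (pure_tensor V W v w)"
    using trilinear_on_twist[OF U V W graded_space_vs[OF gr(2)] trilinear_on_pure_right[OF vs], where k = oct_phi]
    by blast
  obtain h where h: "linear_on ?S ?T h" and h_pure: "\<And>u v w. \<lbrakk>u \<in> carrier U; v \<in> carrier V; w \<in> carrier W\<rbrakk>
      \<Longrightarrow> h (pure_tensor (tensor_space U V) W (pure_tensor U V u v) w) = T u v w"
    using trilinear_on_lift_left[OF vs graded_space_vs[OF gr(2)] T] by blast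
  have h_eq: "h (pure_tensor (tensor_space U V) W (pure_tensor U V u v) w)
      = oct_phi a b c \<odot>\<^bsub>?T\<^esub> pure_tensor U (tensor_space V W) u (pure_tensor V W v w)"
    if "u \<in> hcomp U a" "v \<in> hcomp V b" "w \<in> hcomp W c" for u v w a b c
  proof -
    have "u \<in> carrier U" "v \<in> carrier V" "w \<in> carrier W"
      using that U V W by auto
    then show ?thesis using h_pure T_eq[OF that] by simp
  qed
  let ?f = "mk_garrow ?S ?T h"
  have car: "pure_tensor (tensor_space U V) W (pure_tensor U V u v) w \<in> carrier ?S"
    if "u \<in> hcomp U a" "v \<in> hcomp V b" "w \<in> hcomp W c" for u v w a b c
    using that U V W by (intro pure_tensor_in_carrier) auto
  have f: "graded_map ?f"
  proof (rule graded_map_mk_garrow[OF gr h], rule hcomp_preserved[OF gr h spanning_homog_tensor3[OF U V W]])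
    fix s assume "s \<in> {pure_tensor (tensor_space U V) W (pure_tensor U V u v) w |u v w.
      u \<in> homog U \<and> v \<in> homog V \<and> w \<in> homog W}"
    then obtain u v w a b c where s: "s = pure_tensor (tensor_space U V) W (pure_tensor U V u v) w"
      and u: "u \<in> hcomp U a" and v: "v \<in> hcomp V b" and w: "w \<in> hcomp W c"
      by (auto simp: homog_def)
    have "s \<in> hcomp ?S (a + b + c)"
      unfolding s by (intro pure_tensor_in_hcomp u v w)
    moreover have "h s \<in> hcomp ?T (a + (b + c))"
      unfolding s h_eq[OF u v w] by (intro hcomp_simps(3)[OF gr(2)] pure_tensor_in_hcomp u v w)
    ultimately show "\<exists>b. s \<in> hcomp ?S b \<and> h s \<in> hcomp ?T b"
      by (auto simp: add.assoc)
  qed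
  have "assoc_map U V W = ?f"
    unfolding assoc_map_def
  proof (rule the_graded_map_eq[OF f _ _ _ spanning_homog_tensor3[OF U V W]])
    show "\<forall>a b c. \<forall>u\<in>hcomp U a. \<forall>v\<in>hcomp V b. \<forall>w\<in>hcomp W c.
        fn ?f (pure_tensor (tensor_space U V) W (pure_tensor U V u v) w)
        = oct_phi a b c \<odot>\<^bsub>?T\<^esub> pure_tensor U (tensor_space V W) u (pure_tensor V W v w)"
      using car h_eq by simp
  next
    fix g :: "'a gvec \<Rightarrow> 'a gvec" and s
    assume g: "\<forall>a b c. \<forall>u\<in>hcomp U a. \<forall>v\<in>hcomp V b. \<forall>w\<in>hcomp W c.
        g (pure_tensor (tensor_space U V) W (pure_tensor U V u v) w)
        = oct_phi a b c \<odot>\<^bsub>?T\<^esub> pure_tensor U (tensor_space V W) u (pure_tensor V W v w)"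
      and "s \<in> {pure_tensor (tensor_space U V) W (pure_tensor U V u v) w |u v w.
        u \<in> homog U \<and> v \<in> homog V \<and> w \<in> homog W}"
    then obtain u v w a b c where s: "s = pure_tensor (tensor_space U V) W (pure_tensor U V u v) w"
      and u: "u \<in> hcomp U a" and v: "v \<in> hcomp V b" and w: "w \<in> hcomp W c"
      by (auto simp: homog_def)
    show "g s = fn ?f s"
      using car[OF u v w] h_eq[OF u v w] g u v w unfolding s by simp
  qed auto
  then show ?thesis
    using f car h_eq by simp
qed

lemma assoc_map_simps [simp]:
  assumes "graded_space U" "graded_space V" "graded_space W"
  shows "graded_map (assoc_map U V W)" "src (assoc_map U V W) = tensor_space (tensor_space U V) W"
    "tgt (assoc_map U V W) = tensor_space U (tensor_space V W)"
  using assoc_map_exists[OF assms] by auto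

lemma fn_assoc_map:
  assumes "graded_space U" "graded_space V" "graded_space W" "u \<in> hcomp U a" "v \<in> hcomp V b" "w \<in> hcomp W c"
  shows "fn (assoc_map U V W) (pure_tensor (tensor_space U V) W (pure_tensor U V u v) w)
    = oct_phi a b c \<odot>\<^bsub>tensor_space U (tensor_space V W)\<^esub> pure_tensor U (tensor_space V W) u (pure_tensor V W v w)"
  using assoc_map_exists[OF assms(1-3)] assms(4-6) by blast

text \<open>\<open>oct_phi\<close> squares to 1, so the inverse carries the same coefficient. An
  existential is enough: the axioms ask for an inverse of the associator but never compute with
  it.\<close>

lemma assoc_map_inverse_exists:
  assumes U: "graded_space U" and V: "graded_space V" and W: "graded_space W"
  obtains g where "graded_map g" "src g = tensor_space U (tensor_space V W)" "tgt g = tensor_space (tensor_space U V) W"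
    "\<And>a b c u v w. \<lbrakk>u \<in> hcomp U a; v \<in> hcomp V b; w \<in> hcomp W c\<rbrakk>
      \<Longrightarrow> fn g (pure_tensor U (tensor_space V W) u (pure_tensor V W v w))
        = oct_phi a b c \<odot>\<^bsub>tensor_space (tensor_space U V) W\<^esub> pure_tensor (tensor_space U V) W (pure_tensor U V u v) w"
proof -
  let ?T = "tensor_space (tensor_space U V) W" and ?S = "tensor_space U (tensor_space V W)"
  note vs = graded_space_vs[OF U] graded_space_vs[OF V] graded_space_vs[OF W]
  have gr: "graded_space ?S" "graded_space ?T" using U V W by auto
  obtain T where T: "trilinear_on U V W ?T T"
    and T_eq: "\<And>a b c u v w. \<lbrakk>u \<in> hcomp U a; v \<in> hcomp V b; w \<in> hcomp W c\<rbrakk>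
      \<Longrightarrow> T u v w = oct_phi a b c \<odot>\<^bsub>?T\<^esub> pure_tensor (tensor_space U V) W (pure_tensor U V u v) w"
    using trilinear_on_twist[OF U V W graded_space_vs[OF gr(2)] trilinear_on_pure_left[OF vs], where k = oct_phi]
    by blast
  obtain h where h: "linear_on ?S ?T h" and h_pure: "\<And>u v w. \<lbrakk>u \<in> carrier U; v \<in> carrier V; w \<in> carrier W\<rbrakk>
      \<Longrightarrow> h (pure_tensor U (tensor_space V W) u (pure_tensor V W v w)) = T u v w"
    using trilinear_on_lift_right[OF vs graded_space_vs[OF gr(2)] T] by blast
  have h_eq: "h (pure_tensor U (tensor_space V W) u (pure_tensor V W v w))
      = oct_phi a b c \<odot>\<^bsub>?T\<^esub> pure_tensor (tensor_space U V) W (pure_tensor U V u v) w"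
    if "u \<in> hcomp U a" "v \<in> hcomp V b" "w \<in> hcomp W c" for u v w a b c
  proof -
    have "u \<in> carrier U" "v \<in> carrier V" "w \<in> carrier W"
      using that U V W by auto
    then show ?thesis using h_pure T_eq[OF that] by simp
  qed
  let ?f = "mk_garrow ?S ?T h"
  have car: "pure_tensor U (tensor_space V W) u (pure_tensor V W v w) \<in> carrier ?S"
    if "u \<in> hcomp U a" "v \<in> hcomp V b" "w \<in> hcomp W c" for u v w a b c
    using that U V W by (intro pure_tensor_in_carrier) auto
  have f: "graded_map ?f"
  proof (rule graded_map_mk_garrow[OF gr h], rule hcomp_preserved[OF gr h spanning_homog_tensor3'[OF U V W]])
    fix s assume "s \<in> {pure_tensor U (tensor_space V W) u (pure_tensor V W v w) |u v w.
      u \<in> homog U \<and> v \<in> homog V \<and> w \<in> homog W}"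
    then obtain u v w a b c where s: "s = pure_tensor U (tensor_space V W) u (pure_tensor V W v w)"
      and u: "u \<in> hcomp U a" and v: "v \<in> hcomp V b" and w: "w \<in> hcomp W c"
      by (auto simp: homog_def)
    have "s \<in> hcomp ?S (a + (b + c))"
      unfolding s by (intro pure_tensor_in_hcomp u v w)
    moreover have "h s \<in> hcomp ?T (a + b + c)"
      unfolding s h_eq[OF u v w] by (intro hcomp_simps(3)[OF gr(2)] pure_tensor_in_hcomp u v w)
    ultimately show "\<exists>b. s \<in> hcomp ?S b \<and> h s \<in> hcomp ?T b"
      by (auto simp: add.assoc)
  qed
  show ?thesis
    by (rule that[of ?f]) (use f car h_eq in auto)
qed

text \<open>Swapping the factors is antilinear. It is lifted as a linear map from the unbarred
  tensor product into the conjugate of the target, which by \<open>linear_on_conj_swap\<close> is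
  the same as a linear map out of the conjugate source.\<close>

lemma ups_map_exists:
  assumes V: "graded_space V" and W: "graded_space W"
  shows "graded_map (ups_map V W) \<and> src (ups_map V W) = conj_space (tensor_space V W)
    \<and> tgt (ups_map V W) = tensor_space (conj_space W) (conj_space V)
    \<and> (\<forall>a b. \<forall>v\<in>hcomp V a. \<forall>w\<in>hcomp W b. fn (ups_map V W) (pure_tensor V W v w)
        = ups_sign a b \<odot>\<^bsub>tensor_space (conj_space W) (conj_space V)\<^esub> pure_tensor (conj_space W) (conj_space V) w v)"
proof -
  let ?S = "conj_space (tensor_space V W)" and ?T = "tensor_space (conj_space W) (conj_space V)"
  let ?\<beta> = "\<lambda>a b v w. ups_sign a b \<odot>\<^bsub>?T\<^esub> pure_tensor (conj_space W) (conj_space V) w v"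
  let ?h = "homog_lift V W (conj_space ?T) ?\<beta>"
  have gr: "graded_space ?S" "graded_space ?T" using V W by auto
  have X: "vs (conj_space ?T)" using gr by auto
  have "bilinear_on (conj_space W) (conj_space V) ?T (\<lambda>w v. ?\<beta> a b v w)" for a b
    using V W by (intro bilinear_on_compose_result[OF bilinear_pure_tensor] linear_on_smult linear_on_id) auto
  then have \<beta>: "bilinear_on V W (conj_space ?T) (?\<beta> a b)" for a b
    by (simp add: bilinear_on_def linear_on_conj_swap)
  have h: "linear_on ?S ?T ?h"
    unfolding linear_on_conj_swap by (rule linear_on_homog_lift[OF V W X \<beta>])
  have h_eq: "?h (pure_tensor V W v w) = ?\<beta> a b v w" if "v \<in> hcomp V a" "w \<in> hcomp W b" for v w a b
    by (rule homog_lift_pure[OF V W X \<beta> that])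
  let ?f = "mk_garrow ?S ?T ?h"
  have car: "pure_tensor V W v w \<in> carrier ?S" if "v \<in> hcomp V a" "w \<in> hcomp W b" for v w a b
    using that V W by auto
  have span: "spanning ?S {pure_tensor V W v w |v w. v \<in> homog V \<and> w \<in> homog W}" (is "spanning _ ?P")
    using spanning_homog_tensor[OF V W] by simp
  have f: "graded_map ?f"
  proof (rule graded_map_mk_garrow[OF gr h], rule hcomp_preserved[OF gr h span])
    fix s assume "s \<in> ?P"
    then obtain v w a b where s: "s = pure_tensor V W v w"
      and v: "v \<in> hcomp V a" and w: "w \<in> hcomp W b"
      by (auto simp: homog_def)
    have "s \<in> hcomp ?S (a + b)"
      using pure_tensor_in_hcomp[OF v w] by (simp add: s)
    moreover have "?h s \<in> hcomp ?T (b + a)"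
      unfolding s h_eq[OF v w] using v w by (intro hcomp_simps(3)[OF gr(2)] pure_tensor_in_hcomp) auto
    ultimately show "\<exists>b. s \<in> hcomp ?S b \<and> ?h s \<in> hcomp ?T b"
      by (auto simp: add.commute)
  qed
  have "ups_map V W = ?f"
    unfolding ups_map_def
  proof (rule the_graded_map_eq[OF f _ _ _ span])
    show "\<forall>a b. \<forall>v\<in>hcomp V a. \<forall>w\<in>hcomp W b. fn ?f (pure_tensor V W v w) = ?\<beta> a b v w"
      using car h_eq by simp
  next
    fix g :: "'a gvec \<Rightarrow> 'a gvec" and s
    assume g: "\<forall>a b. \<forall>v\<in>hcomp V a. \<forall>w\<in>hcomp W b. g (pure_tensor V W v w) = ?\<beta> a b v w" and "s \<in> ?P"
    then obtain v w a b where s: "s = pure_tensor V W v w"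
      and v: "v \<in> hcomp V a" and w: "w \<in> hcomp W b"
      by (auto simp: homog_def)
    show "g s = fn ?f s"
      using car[OF v w] h_eq[OF v w] g v w unfolding s by simp
  qed auto
  then show ?thesis
    using f car h_eq by simp
qed

lemma ups_map_simps [simp]:
  assumes "graded_space V" "graded_space W"
  shows "graded_map (ups_map V W)" "src (ups_map V W) = conj_space (tensor_space V W)"
    "tgt (ups_map V W) = tensor_space (conj_space W) (conj_space V)"
  using ups_map_exists[OF assms] by auto

lemma fn_ups_map:
  assumes "graded_space V" "graded_space W" "v \<in> hcomp V a" "w \<in> hcomp W b"
  shows "fn (ups_map V W) (pure_tensor V W v w)
    = ups_sign a b \<odot>\<^bsub>tensor_space (conj_space W) (conj_space V)\<^esub> pure_tensor (conj_space W) (conj_space V) w v"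
  using ups_map_exists[OF assms(1,2)] assms(3,4) by blast

text \<open>A scalar \<open>c\<close> of the unbarred product acts on the source of \<Upsilon> as
  \<open>cnj c\<close> and so reappears conjugated; for the real coefficients met below the
  conjugation disappears.\<close>

lemma fn_ups_map_smult:
  assumes "graded_space V" "graded_space W" "x \<in> carrier (tensor_space V W)"
  shows "fn (ups_map V W) (c \<odot>\<^bsub>tensor_space V W\<^esub> x)
    = cnj c \<odot>\<^bsub>tensor_space (conj_space W) (conj_space V)\<^esub> fn (ups_map V W) x"
  using fn_smult[of "ups_map V W" "conj_space (tensor_space V W)" x "cnj c"] assms by simp

section \<open>Named components of the category and their values\<close>

definition gid :: "'v gspace \<Rightarrow> 'v garrow" where
  "gid V = mk_garrow V V (\<lambda>v. v)"

definition gcomp :: "'v garrow \<Rightarrow> 'v garrow \<Rightarrow> 'v garrow" (infixl \<open>\<bullet>\<^sub>g\<close> 65) where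
  "g \<bullet>\<^sub>g f = mk_garrow (src f) (tgt g) (\<lambda>v. fn g (fn f v))"

definition lunit_map :: "'a gvec gspace \<Rightarrow> 'a gvec garrow" where
  "lunit_map V = mk_garrow V (tensor_space V unit_space) (\<lambda>v. pure_tensor V unit_space v (Scalar 1))"

definition runit_map :: "'a gvec gspace \<Rightarrow> 'a gvec garrow" where
  "runit_map V = mk_garrow V (tensor_space unit_space V) (\<lambda>v. pure_tensor unit_space V (Scalar 1) v)"

definition bb_map :: "'v gspace \<Rightarrow> 'v garrow" where
  "bb_map V = mk_garrow V (conj_space (conj_space V)) (\<lambda>v. v)"

definition star_map :: "'a gvec garrow" where
  "star_map = mk_garrow unit_space (conj_space unit_space) (\<lambda>x. Scalar (cnj (scalar_of x)))"

text \<open>Rewriting the fields to constants keeps the simplifier from unfolding composites into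
  bare functions, so that the axioms become equations between named arrows.\<close>

lemma graded_bar_cat_simps [simp]:
  "Obj graded_bar_cat = {V. graded_space V}" "Arr graded_bar_cat = {f. graded_map f}"
  "Dom graded_bar_cat = src" "Cod graded_bar_cat = tgt" "Idn graded_bar_cat = gid"
  "Cmp graded_bar_cat = gcomp" "tensO graded_bar_cat = tensor_space" "tensA graded_bar_cat = tensor_map"
  "unitO graded_bar_cat = unit_space" "assoc graded_bar_cat = assoc_map"
  "lunit graded_bar_cat = lunit_map" "runit graded_bar_cat = runit_map"
  "barO graded_bar_cat = conj_space" "barA graded_bar_cat = conj_map" "bb graded_bar_cat = bb_map"
  "starI graded_bar_cat = star_map" "Ups graded_bar_cat = ups_map"
  by (simp_all add: graded_bar_cat_def fun_eq_iff gid_def gcomp_def lunit_map_def runit_map_def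
      bb_map_def star_map_def)

lemma Hom_graded_bar_cat [simp]:
  "f \<in> Hom graded_bar_cat V W \<longleftrightarrow> graded_map f \<and> src f = V \<and> tgt f = W"
  by (simp add: Hom_def)

lemma gid_simps [simp]: "src (gid V) = V" "tgt (gid V) = V" "v \<in> carrier V \<Longrightarrow> fn (gid V) v = v"
  "graded_space V \<Longrightarrow> graded_map (gid V)"
  by (auto simp: gid_def linear_on_id intro!: graded_map_mk_garrow)

lemma gcomp_simps [simp]: "src (g \<bullet>\<^sub>g f) = src f" "tgt (g \<bullet>\<^sub>g f) = tgt g"
  "v \<in> carrier (src f) \<Longrightarrow> fn (g \<bullet>\<^sub>g f) v = fn g (fn f v)"
  by (simp_all add: gcomp_def)

lemma graded_map_gcomp [simp]:
  assumes "graded_map f" "graded_map g" "tgt f = src g"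
  shows "graded_map (g \<bullet>\<^sub>g f)"
  unfolding gcomp_def
proof (rule graded_map_mk_garrow)
  show "linear_on (src f) (tgt g) (\<lambda>v. fn g (fn f v))"
    using linear_on_comp[OF graded_map_linear[OF assms(1)], of "tgt g" "fn g"] graded_map_linear[OF assms(2)]
    by (simp add: assms(3))
  show "fn g (fn f v) \<in> hcomp (tgt g) a" if "v \<in> hcomp (src f) a" for v a
    using graded_map_hcomp[OF assms(2)] graded_map_hcomp[OF assms(1) that] by (simp add: assms(3))
qed (fact graded_map_src[OF assms(1)] graded_map_tgt[OF assms(2)])+

lemma conj_map_simps [simp]: "src (conj_map f) = conj_space (src f)" "tgt (conj_map f) = conj_space (tgt f)"
  "fn (conj_map f) = fn f"
  by (simp_all add: conj_map_def)

lemma graded_map_conj_map [simp]: "graded_map f \<Longrightarrow> graded_map (conj_map f)"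
  unfolding graded_map_def by simp

lemma hcomp_unit_space [simp]: "Scalar c \<in> hcomp unit_space 0" "Scalar c \<in> carrier unit_space"
  by (auto simp: unit_space_def)

lemma spanning_unit_space: "spanning unit_space {Scalar 1}"
proof -
  have "Scalar c \<in> span_of unit_space {Scalar 1}" for c
    using span_of.smult[OF span_of.base, of "Scalar 1" "{Scalar 1}" unit_space c]
    by (simp add: unit_space_def)
  then show ?thesis by (auto simp: spanning_def unit_space_def)
qed

lemma unit_maps_simps [simp]:
  "src (lunit_map V) = V" "tgt (lunit_map V) = tensor_space V unit_space"
  "v \<in> carrier V \<Longrightarrow> fn (lunit_map V) v = pure_tensor V unit_space v (Scalar 1)"
  "src (runit_map V) = V" "tgt (runit_map V) = tensor_space unit_space V"
  "v \<in> carrier V \<Longrightarrow> fn (runit_map V) v = pure_tensor unit_space V (Scalar 1) v"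
  "src (bb_map W) = W" "tgt (bb_map W) = W" "w \<in> carrier W \<Longrightarrow> fn (bb_map W) w = w"
  "src star_map = unit_space" "tgt star_map = conj_space unit_space" "fn star_map (Scalar c) = Scalar (cnj c)"
  by (simp_all add: lunit_map_def runit_map_def bb_map_def star_map_def)

lemma bb_map_eq: "bb_map V = gid V"
  by (simp add: bb_map_def gid_def)

lemma graded_unit_maps [simp]:
  "graded_space V \<Longrightarrow> graded_map (lunit_map V)" "graded_space V \<Longrightarrow> graded_map (runit_map V)"
  "graded_map star_map"
proof -
  show "graded_map (lunit_map V)" if V: "graded_space V"
    unfolding lunit_map_def
  proof (rule graded_map_mk_garrow)
    show "linear_on V (tensor_space V unit_space) (\<lambda>v. pure_tensor V unit_space v (Scalar 1))"
      using bilinear_pure_tensor[of V unit_space] V by (simp add: bilinear_on_def)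
    show "pure_tensor V unit_space v (Scalar 1) \<in> hcomp (tensor_space V unit_space) a" if "v \<in> hcomp V a" for v a
      using pure_tensor_in_hcomp[OF that, of "Scalar 1" unit_space 0] by simp
  qed (use V in auto)
  show "graded_map (runit_map V)" if V: "graded_space V"
    unfolding runit_map_def
  proof (rule graded_map_mk_garrow)
    show "linear_on V (tensor_space unit_space V) (\<lambda>v. pure_tensor unit_space V (Scalar 1) v)"
      using bilinear_pure_tensor[of unit_space V] V by (simp add: bilinear_on_def)
    show "pure_tensor unit_space V (Scalar 1) v \<in> hcomp (tensor_space unit_space V) a" if "v \<in> hcomp V a" for v a
      using pure_tensor_in_hcomp[OF _ that, of "Scalar 1" unit_space 0] by simp
  qed (use V in auto)
  show "graded_map star_map"
    unfolding star_map_def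
    by (rule graded_map_mk_garrow) (auto simp: linear_on_def, auto simp: unit_space_def split: if_splits)
qed

section \<open>The bar category of graded spaces\<close>

lemma garrow_eqI':
  assumes "graded_map f" "graded_map g" "src g = src f" "tgt g = tgt f"
    and "\<And>v. v \<in> carrier (src f) \<Longrightarrow> fn f v = fn g v"
  shows "f = g"
  by (rule garrow_eqI[OF assms(1) HOL.refl HOL.refl assms(2-4), where S = "carrier (src f)"])
    (use assms in \<open>auto simp: spanning_def intro: span_of.base\<close>)

interpretation graded: cat graded_bar_cat
proof unfold_locales
  show "h \<cdot>\<^bsub>graded_bar_cat\<^esub> g \<cdot>\<^bsub>graded_bar_cat\<^esub> f = h \<cdot>\<^bsub>graded_bar_cat\<^esub> (g \<cdot>\<^bsub>graded_bar_cat\<^esub> f)"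
    if "f \<in> Hom graded_bar_cat W X" "g \<in> Hom graded_bar_cat X Y" "h \<in> Hom graded_bar_cat Y Z"
    for f g h :: "'a gvec garrow" and W X Y Z
    using that by (auto intro!: garrow_eqI')
qed (auto simp: graded_map_src graded_map_tgt intro!: garrow_eqI')

lemma is_inverse_graded_bar_cat:
  assumes f: "graded_map f" "src f = V" "tgt f = W" and g: "graded_map g" "src g = W" "tgt g = V"
    and S: "spanning V S" "\<And>s. s \<in> S \<Longrightarrow> fn g (fn f s) = s"
    and T: "spanning W T" "\<And>t. t \<in> T \<Longrightarrow> fn f (fn g t) = t"
  shows "is_inverse graded_bar_cat f g"
proof -
  have gr: "graded_space V" "graded_space W"
    using graded_map_src[OF f(1)] graded_map_tgt[OF f(1)] f by auto
  have sub: "S \<subseteq> carrier V" "T \<subseteq> carrier W" using S T by (auto simp: spanning_def)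
  have "g \<bullet>\<^sub>g f = gid V"
  proof (rule garrow_eqI[OF _ _ _ _ _ _ S(1)])
    show "fn (g \<bullet>\<^sub>g f) s = fn (gid V) s" if "s \<in> S" for s
      using that f g S sub by (simp add: subsetD)
  qed (use f g gr in auto)
  moreover have "f \<bullet>\<^sub>g g = gid W"
  proof (rule garrow_eqI[OF _ _ _ _ _ _ T(1)])
    show "fn (f \<bullet>\<^sub>g g) s = fn (gid W) s" if "s \<in> T" for s
      using that f g T sub by (simp add: subsetD)
  qed (use f g gr in auto)
  ultimately show ?thesis
    using f g by (simp add: is_inverse_def)
qed

lemma Iso_graded_bar_cat:
  assumes "graded_map f" "src f = V" "tgt f = W" "graded_map g" "src g = W" "tgt g = V"
    "spanning V S" "\<And>s. s \<in> S \<Longrightarrow> fn g (fn f s) = s" "spanning W T" "\<And>t. t \<in> T \<Longrightarrow> fn f (fn g t) = t"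
  shows "f \<in> Iso graded_bar_cat V W"
  using is_inverse_graded_bar_cat[of f V W g S T] assms by (auto simp: Iso_def)

text \<open>Two inverses agree by g' = g' (f g) = (g' f) g = g. This replaces the description
  \<open>inv_arr\<close>, which the axioms apply to the star of the unit object and to \<Upsilon>,
  by explicit inverses.\<close>

lemma (in cat) inv_arr_eq:
  assumes g: "is_inverse C f g"
  shows "inv_arr C f = g"
  unfolding inv_arr_def
proof (rule the_equality[where P = "is_inverse C f", OF g])
  fix g' assume g': "is_inverse C f g'"
  have f: "f \<in> Hom C (Dom C f) (Cod C f)" using g by (simp add: is_inverse_def Hom_def)
  have G: "g \<in> Hom C (Cod C f) (Dom C f)" "g' \<in> Hom C (Cod C f) (Dom C f)"
    using g g' by (auto simp: is_inverse_def)
  have "g' = g' \<cdot> Idn C (Cod C f)" using Cmp_Idn[OF G(2)] by simp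
  also have "\<dots> = g' \<cdot> (f \<cdot> g)" using g by (simp add: is_inverse_def)
  also have "\<dots> = g' \<cdot> f \<cdot> g" using Cmp_assoc[OF G(1) f G(2)] by simp
  also have "\<dots> = g" using g' Idn_Cmp[OF G(1)] by (simp add: is_inverse_def)
  finally show "g' = g" .
qed

lemmas pure_tensor_smult = pure_tensor_smult_left pure_tensor_smult_right

lemma pure_tensor_unit_in_hcomp [simp]:
  "v \<in> hcomp V a \<Longrightarrow> pure_tensor V unit_space v (Scalar c) \<in> hcomp (tensor_space V unit_space) a"
  "v \<in> hcomp V a \<Longrightarrow> pure_tensor unit_space V (Scalar c) v \<in> hcomp (tensor_space unit_space V) a"
  using pure_tensor_in_hcomp[of v V a "Scalar c" unit_space 0]
    pure_tensor_in_hcomp[of "Scalar c" unit_space 0 v V a] by auto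

section \<open>The associator and the unit isomorphisms\<close>

lemma assoc_map_Iso:
  assumes X: "graded_space X" and Y: "graded_space Y" and Z: "graded_space Z"
  shows "assoc_map X Y Z \<in> Iso graded_bar_cat (tensor_space (tensor_space X Y) Z) (tensor_space X (tensor_space Y Z))"
proof -
  obtain g where g: "graded_map g" "src g = tensor_space X (tensor_space Y Z)" "tgt g = tensor_space (tensor_space X Y) Z"
    and g_eq: "\<And>a b c u v w. \<lbrakk>u \<in> hcomp X a; v \<in> hcomp Y b; w \<in> hcomp Z c\<rbrakk>
      \<Longrightarrow> fn g (pure_tensor X (tensor_space Y Z) u (pure_tensor Y Z v w))
        = oct_phi a b c \<odot>\<^bsub>tensor_space (tensor_space X Y) Z\<^esub> pure_tensor (tensor_space X Y) Z (pure_tensor X Y u v) w"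
    using assoc_map_inverse_exists[OF X Y Z] by blast
  have f_eq: "fn (assoc_map X Y Z) (pure_tensor (tensor_space X Y) Z (pure_tensor X Y u v) w)
      = oct_phi a b c \<odot>\<^bsub>tensor_space X (tensor_space Y Z)\<^esub> pure_tensor X (tensor_space Y Z) u (pure_tensor Y Z v w)"
    if "u \<in> hcomp X a" "v \<in> hcomp Y b" "w \<in> hcomp Z c" for u v w a b c
    by (rule fn_assoc_map[OF X Y Z that])
  have car: "u \<in> carrier X" "v \<in> carrier Y" "w \<in> carrier Z"
    if "u \<in> hcomp X a" "v \<in> hcomp Y b" "w \<in> hcomp Z c" for u v w a b c
    using that X Y Z by auto
  show ?thesis
  proof (rule Iso_graded_bar_cat[OF _ _ _ g spanning_homog_tensor3[OF X Y Z] _ spanning_homog_tensor3'[OF X Y Z]])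
    fix s assume "s \<in> {pure_tensor (tensor_space X Y) Z (pure_tensor X Y u v) w |u v w.
        u \<in> homog X \<and> v \<in> homog Y \<and> w \<in> homog Z}"
    then obtain u v w a b c where s: "s = pure_tensor (tensor_space X Y) Z (pure_tensor X Y u v) w"
      and *: "u \<in> hcomp X a" "v \<in> hcomp Y b" "w \<in> hcomp Z c"
      by (auto simp: homog_def)
    show "fn g (fn (assoc_map X Y Z) s) = s"
      using X Y Z g car[OF *] by (simp add: s f_eq[OF *] g_eq[OF *])
  next
    fix s assume "s \<in> {pure_tensor X (tensor_space Y Z) u (pure_tensor Y Z v w) |u v w.
        u \<in> homog X \<and> v \<in> homog Y \<and> w \<in> homog Z}"
    then obtain u v w a b c where s: "s = pure_tensor X (tensor_space Y Z) u (pure_tensor Y Z v w)"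
      and *: "u \<in> hcomp X a" "v \<in> hcomp Y b" "w \<in> hcomp Z c"
      by (auto simp: homog_def)
    show "fn (assoc_map X Y Z) (fn g s) = s"
      using X Y Z g car[OF *] by (simp add: s f_eq[OF *] g_eq[OF *])
  qed (use X Y Z in auto)
qed

text \<open>Graded maps preserve degrees, so both paths pick up the same sign
  \<open>oct_phi a b c\<close>.\<close>

lemma assoc_map_natural:
  assumes f: "graded_map f" "src f = X" "tgt f = X'" and g: "graded_map g" "src g = Y" "tgt g = Y'"
    and h: "graded_map h" "src h = Z" "tgt h = Z'"
  shows "assoc_map X' Y' Z' \<bullet>\<^sub>g tensor_map (tensor_map f g) h
    = tensor_map f (tensor_map g h) \<bullet>\<^sub>g assoc_map X Y Z"
proof -
  have gr: "graded_space X" "graded_space X'" "graded_space Y" "graded_space Y'" "graded_space Z" "graded_space Z'"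
    using f g h graded_map_src graded_map_tgt by blast+
  show ?thesis
  proof (rule garrow_eqI_tensor3[where U = X and V = Y and W = Z])
    fix u v w a b c assume *: "u \<in> hcomp X a" "v \<in> hcomp Y b" "w \<in> hcomp Z c"
    have **: "fn f u \<in> hcomp X' a" "fn g v \<in> hcomp Y' b" "fn h w \<in> hcomp Z' c"
      using * f g h by auto
    have car: "u \<in> carrier X" "v \<in> carrier Y" "w \<in> carrier Z" using * gr by auto
    show "fn (assoc_map X' Y' Z' \<bullet>\<^sub>g tensor_map (tensor_map f g) h) (pure_tensor (tensor_space X Y) Z (pure_tensor X Y u v) w)
      = fn (tensor_map f (tensor_map g h) \<bullet>\<^sub>g assoc_map X Y Z) (pure_tensor (tensor_space X Y) Z (pure_tensor X Y u v) w)"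
      using f g h gr car
      by (simp add: fn_assoc_map[OF gr(1,3,5) *] fn_assoc_map[OF gr(2,4,6) **])
  qed (use f g h gr in auto)
qed

text \<open>The inverse sends the tensor of \<open>v\<close> and a scalar to that multiple of
  \<open>v\<close>. It comes from the universal property, and since \<open>Scalar 1\<close> spans
  the unit object only that scalar has to be inspected.\<close>

lemma lunit_map_Iso:
  assumes X: "graded_space X"
  shows "lunit_map X \<in> Iso graded_bar_cat X (tensor_space X unit_space)"
proof -
  let ?I = "unit_space :: 'a gvec gspace"
  let ?h = "tensor_lift X (\<lambda>v x. scalar_of x \<odot>\<^bsub>X\<^esub> v)"
  have vs: "vs X" "vs ?I" using X by auto
  have bil: "bilinear_on X ?I X (\<lambda>v x. scalar_of x \<odot>\<^bsub>X\<^esub> v)"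
    using vs by (auto simp: bilinear_on_def linear_on_def unit_space_def vs_smult_add mult.commute)
  note lin = linear_on_tensor_lift[OF vs vs(1) bil]
  have eq: "?h (pure_tensor X ?I v (Scalar 1)) = v" if "v \<in> carrier X" for v
    using that vs by (simp add: tensor_lift_pure[OF vs vs(1) bil])
  have gr: "graded_space (tensor_space X ?I)" using X by simp
  have span: "spanning (tensor_space X ?I) {pure_tensor X ?I v t |v t. v \<in> homog X \<and> t \<in> {Scalar 1}}"
    using vs X by (intro spanning_pure_tensor spanning_homog spanning_unit_space) auto
  let ?g = "mk_garrow (tensor_space X ?I) X ?h"
  have "graded_map ?g"
  proof (rule graded_map_mk_garrow[OF gr X lin], rule hcomp_preserved[OF gr X lin span])
    fix s assume "s \<in> {pure_tensor X ?I v t |v t. v \<in> homog X \<and> t \<in> {Scalar 1}}"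
    then obtain v a where "s = pure_tensor X ?I v (Scalar 1)" "v \<in> hcomp X a" by (auto simp: homog_def)
    then show "\<exists>b. s \<in> hcomp (tensor_space X ?I) b \<and> ?h s \<in> hcomp X b"
      using X by (intro exI[of _ a]) (simp add: eq)
  qed
  then show ?thesis
    by (rule Iso_graded_bar_cat[OF _ _ _ _ _ _ spanning_homog[OF X] _ span, rotated 3])
      (use X vs eq in \<open>auto simp: homog_def\<close>)
qed

lemma runit_map_Iso:
  assumes X: "graded_space X"
  shows "runit_map X \<in> Iso graded_bar_cat X (tensor_space unit_space X)"
proof -
  let ?I = "unit_space :: 'a gvec gspace"
  let ?h = "tensor_lift X (\<lambda>x v. scalar_of x \<odot>\<^bsub>X\<^esub> v)"
  have vs: "vs ?I" "vs X" using X by auto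
  have bil: "bilinear_on ?I X X (\<lambda>x v. scalar_of x \<odot>\<^bsub>X\<^esub> v)"
    using vs by (auto simp: bilinear_on_def linear_on_def unit_space_def vs_smult_add mult.commute)
  note lin = linear_on_tensor_lift[OF vs vs(2) bil]
  have eq: "?h (pure_tensor ?I X (Scalar 1) v) = v" if "v \<in> carrier X" for v
    using that vs by (simp add: tensor_lift_pure[OF vs vs(2) bil])
  have gr: "graded_space (tensor_space ?I X)" using X by simp
  have span: "spanning (tensor_space ?I X) {pure_tensor ?I X t v |t v. t \<in> {Scalar 1} \<and> v \<in> homog X}"
    using vs X by (intro spanning_pure_tensor spanning_homog spanning_unit_space) auto
  let ?g = "mk_garrow (tensor_space ?I X) X ?h"
  have "graded_map ?g"
  proof (rule graded_map_mk_garrow[OF gr X lin], rule hcomp_preserved[OF gr X lin span])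
    fix s assume "s \<in> {pure_tensor ?I X t v |t v. t \<in> {Scalar 1} \<and> v \<in> homog X}"
    then obtain v a where "s = pure_tensor ?I X (Scalar 1) v" "v \<in> hcomp X a" by (auto simp: homog_def)
    then show "\<exists>b. s \<in> hcomp (tensor_space ?I X) b \<and> ?h s \<in> hcomp X b"
      using X by (intro exI[of _ a]) (simp add: eq)
  qed
  then show ?thesis
    by (rule Iso_graded_bar_cat[OF _ _ _ _ _ _ spanning_homog[OF X] _ span, rotated 3])
      (use X vs eq in \<open>auto simp: homog_def\<close>)
qed

lemma assoc_map_pentagon:
  assumes gr: "graded_space W" "graded_space X" "graded_space Y" "graded_space Z"
  shows "assoc_map W X (tensor_space Y Z) \<bullet>\<^sub>g assoc_map (tensor_space W X) Y Z
    = tensor_map (gid W) (assoc_map X Y Z) \<bullet>\<^sub>g assoc_map W (tensor_space X Y) Z \<bullet>\<^sub>g tensor_map (assoc_map W X Y) (gid Z)"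
proof (rule garrow_eqI_tensor4[where U = W and V = X and W = Y and Y = Z])
  fix w x y z a b c d
  assume w: "w \<in> hcomp W a" and x: "x \<in> hcomp X b" and y: "y \<in> hcomp Y c" and z: "z \<in> hcomp Z d"
  have car: "w \<in> carrier W" "x \<in> carrier X" "y \<in> carrier Y" "z \<in> carrier Z" using w x y z gr by auto
  have T: "graded_space (tensor_space W X)" "graded_space (tensor_space X Y)" "graded_space (tensor_space Y Z)"
    using gr by auto
  \<comment> \<open>A pure tensor has the sum of the degrees of its factors. The composite objects
    therefore contribute \<open>a + b\<close>, \<open>b + c\<close> and \<open>c + d\<close>, the
    sums that occur in \<open>oct_phi_cocycle\<close>.\<close>
  note eqs = fn_assoc_map[OF T(1) gr(3,4) pure_tensor_in_hcomp[OF w x] y z]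
    fn_assoc_map[OF gr(1,2) T(3) w x pure_tensor_in_hcomp[OF y z]]
    fn_assoc_map[OF gr(1,2,3) w x y] fn_assoc_map[OF gr(2,3,4) x y z]
    fn_assoc_map[OF gr(1) T(2) gr(4) w pure_tensor_in_hcomp[OF x y] z]
  show "fn (assoc_map W X (tensor_space Y Z) \<bullet>\<^sub>g assoc_map (tensor_space W X) Y Z)
      (pure_tensor (tensor_space (tensor_space W X) Y) Z (pure_tensor (tensor_space W X) Y (pure_tensor W X w x) y) z)
    = fn (tensor_map (gid W) (assoc_map X Y Z) \<bullet>\<^sub>g assoc_map W (tensor_space X Y) Z \<bullet>\<^sub>g tensor_map (assoc_map W X Y) (gid Z))
      (pure_tensor (tensor_space (tensor_space W X) Y) Z (pure_tensor (tensor_space W X) Y (pure_tensor W X w x) y) z)"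
    using gr car oct_phi_cocycle[of b c d a]
    by (simp add: eqs pure_tensor_smult mult.commute mult.left_commute)
qed (use gr in auto)

text \<open>The triple product vanishes when its middle argument is 0, so the associator acts here
  with coefficient 1.\<close>

lemma assoc_map_triangle:
  assumes gr: "graded_space X" "graded_space Y"
  shows "assoc_map X unit_space Y \<bullet>\<^sub>g tensor_map (lunit_map X) (gid Y) = tensor_map (gid X) (runit_map Y)"
proof (rule garrow_eqI_tensor[where V = X and W = Y])
  fix x y a b assume *: "x \<in> hcomp X a" "y \<in> hcomp Y b"
  have car: "x \<in> carrier X" "y \<in> carrier Y" using * gr by auto
  show "fn (assoc_map X unit_space Y \<bullet>\<^sub>g tensor_map (lunit_map X) (gid Y)) (pure_tensor X Y x y)
    = fn (tensor_map (gid X) (runit_map Y)) (pure_tensor X Y x y)"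
    using gr car by (simp add: fn_assoc_map[OF gr(1) graded_unit_space gr(2) *(1) hcomp_unit_space(1) *(2)])
qed (use gr in auto)

interpretation graded: monoidal_cat graded_bar_cat
proof unfold_locales
  fix f f' g g' :: "'a gvec garrow" and X X' X'' Y Y' Y''
  assume "f \<in> Hom graded_bar_cat X X'" "f' \<in> Hom graded_bar_cat X' X''"
    "g \<in> Hom graded_bar_cat Y Y'" "g' \<in> Hom graded_bar_cat Y' Y''"
  then have *: "graded_map f" "src f = X" "tgt f = X'" "graded_map f'" "src f' = X'" "tgt f' = X''"
    "graded_map g" "src g = Y" "tgt g = Y'" "graded_map g'" "src g' = Y'" "tgt g' = Y''"
    by auto
  then have gr: "graded_space X" "graded_space X'" "graded_space X''" "graded_space Y" "graded_space Y'" "graded_space Y''"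
    using graded_map_src graded_map_tgt by blast+
  have "tensor_map (f' \<bullet>\<^sub>g f) (g' \<bullet>\<^sub>g g) = tensor_map f' g' \<bullet>\<^sub>g tensor_map f g"
    by (rule garrow_eqI_tensor[where V = X and W = Y]) (use * gr in auto)
  then show "(f' \<cdot>\<^bsub>graded_bar_cat\<^esub> f) \<boxdot>\<^bsub>graded_bar_cat\<^esub> (g' \<cdot>\<^bsub>graded_bar_cat\<^esub> g)
      = f' \<boxdot>\<^bsub>graded_bar_cat\<^esub> g' \<cdot>\<^bsub>graded_bar_cat\<^esub> (f \<boxdot>\<^bsub>graded_bar_cat\<^esub> g)"
    by simp
next
  fix X Y :: "'a gvec gspace" assume "X \<in> Obj graded_bar_cat" "Y \<in> Obj graded_bar_cat"
  then have gr: "graded_space X" "graded_space Y" by auto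
  have "tensor_map (gid X) (gid Y) = gid (tensor_space X Y)"
    by (rule garrow_eqI_tensor[where V = X and W = Y]) (use gr in auto)
  then show "Idn graded_bar_cat X \<boxdot>\<^bsub>graded_bar_cat\<^esub> Idn graded_bar_cat Y = Idn graded_bar_cat (X \<boxtimes>\<^bsub>graded_bar_cat\<^esub> Y)"
    by simp
next
  fix f :: "'a gvec garrow" and X Y assume "f \<in> Hom graded_bar_cat X Y"
  then have *: "graded_map f" "src f = X" "tgt f = Y" by auto
  then have gr: "graded_space X" "graded_space Y"
    using graded_map_src graded_map_tgt by blast+
  have "lunit_map Y \<bullet>\<^sub>g f = tensor_map f (gid unit_space) \<bullet>\<^sub>g lunit_map X"
    "runit_map Y \<bullet>\<^sub>g f = tensor_map (gid unit_space) f \<bullet>\<^sub>g runit_map X"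
    by (rule garrow_eqI'; use * gr in simp)+
  then show "lunit graded_bar_cat Y \<cdot>\<^bsub>graded_bar_cat\<^esub> f
      = f \<boxdot>\<^bsub>graded_bar_cat\<^esub> Idn graded_bar_cat \<I>\<^bsub>graded_bar_cat\<^esub> \<cdot>\<^bsub>graded_bar_cat\<^esub> lunit graded_bar_cat X"
    "runit graded_bar_cat Y \<cdot>\<^bsub>graded_bar_cat\<^esub> f
      = Idn graded_bar_cat \<I>\<^bsub>graded_bar_cat\<^esub> \<boxdot>\<^bsub>graded_bar_cat\<^esub> f \<cdot>\<^bsub>graded_bar_cat\<^esub> runit graded_bar_cat X"
    by simp_all
qed (simp_all add: assoc_map_Iso assoc_map_natural lunit_map_Iso runit_map_Iso assoc_map_pentagon assoc_map_triangle)

text \<open>Conjugating an arrow does not alter its underlying function, and complex conjugation is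
  an involution, so the star is inverted by its own conjugate. One half of this is the axiom
  \<open>bar_star\<close>.\<close>

lemma inv_star_map: "is_inverse graded_bar_cat star_map (conj_map star_map)"
  by (rule is_inverse_graded_bar_cat[OF _ _ _ _ _ _ spanning_unit_space _ , where T = "{Scalar 1}"])
    (auto simp: spanning_unit_space)

text \<open>Since double conjugation is the identity, \<Upsilon> for the conjugate factors in
  reversed order leads back, and its conjugate has the right source and target. The signs cancel
  because \<open>ups_sign\<close> is symmetric.\<close>

lemma ups_map_Iso:
  assumes X: "graded_space X" and Y: "graded_space Y"
  shows "ups_map X Y \<in> Iso graded_bar_cat (conj_space (tensor_space X Y)) (tensor_space (conj_space Y) (conj_space X))"
    and inv_ups_map: "is_inverse graded_bar_cat (ups_map X Y) (conj_map (ups_map (conj_space Y) (conj_space X)))"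
proof -
  \<comment> \<open>Stated for arbitrary spaces: the two composites to be checked are the instances
    at \<open>X\<close>, \<open>Y\<close> and at \<open>conj_space Y\<close>,
    \<open>conj_space X\<close>.\<close>
  have *: "fn (ups_map (conj_space Y) (conj_space X)) (fn (ups_map X Y) (pure_tensor X Y x y)) = pure_tensor X Y x y"
    if xy': "x \<in> homog X" "y \<in> homog Y" and that: "graded_space X" "graded_space Y" for X Y :: "'a gvec gspace" and x y
  proof -
    obtain a b where xy: "x \<in> hcomp X a" "y \<in> hcomp Y b" using xy' by (auto simp: homog_def)
    have car: "x \<in> carrier X" "y \<in> carrier Y" using xy that by auto
    have yx: "y \<in> hcomp (conj_space Y) b" "x \<in> hcomp (conj_space X) a" using xy by auto
    have "ups_sign a b * ups_sign b a = 1" by (simp add: ups_sign_eq ac_simps)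
    then show ?thesis
      using that car
      by (simp add: fn_ups_map[OF that xy] fn_ups_map_smult
          fn_ups_map[OF graded_conj_space graded_conj_space yx] pure_tensor_in_carrier)
  qed
  have span: "spanning (conj_space (tensor_space X Y)) {pure_tensor X Y v w |v w. v \<in> homog X \<and> w \<in> homog Y}"
    "spanning (tensor_space (conj_space Y) (conj_space X))
      {pure_tensor (conj_space Y) (conj_space X) v w |v w. v \<in> homog Y \<and> w \<in> homog X}"
    using spanning_homog_tensor[OF X Y] spanning_homog_tensor[of "conj_space Y" "conj_space X"] X Y by simp_all
  show inv: "is_inverse graded_bar_cat (ups_map X Y) (conj_map (ups_map (conj_space Y) (conj_space X)))"
    by (rule is_inverse_graded_bar_cat[OF _ _ _ _ _ _ span(1) _ span(2)])
      (use X Y *[of _ X _ Y] *[of _ "conj_space Y" _ "conj_space X"] in auto)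
  show "ups_map X Y \<in> Iso graded_bar_cat (conj_space (tensor_space X Y)) (tensor_space (conj_space Y) (conj_space X))"
    using inv X Y by (auto simp: Iso_def)
qed

lemma ups_map_natural:
  assumes f: "graded_map f" "src f = X" "tgt f = X'" and g: "graded_map g" "src g = Y" "tgt g = Y'"
  shows "ups_map X' Y' \<bullet>\<^sub>g conj_map (tensor_map f g) = tensor_map (conj_map g) (conj_map f) \<bullet>\<^sub>g ups_map X Y"
proof -
  have gr: "graded_space X" "graded_space X'" "graded_space Y" "graded_space Y'"
    using f g graded_map_src graded_map_tgt by blast+
  show ?thesis
  proof (rule garrow_eqI)
    show "spanning (conj_space (tensor_space X Y)) {pure_tensor X Y v w |v w. v \<in> homog X \<and> w \<in> homog Y}"
      using spanning_homog_tensor[OF gr(1,3)] by simp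
    fix s assume "s \<in> {pure_tensor X Y v w |v w. v \<in> homog X \<and> w \<in> homog Y}"
    then obtain x y a b where s: "s = pure_tensor X Y x y" and *: "x \<in> hcomp X a" "y \<in> hcomp Y b"
      by (auto simp: homog_def)
    have **: "fn f x \<in> hcomp X' a" "fn g y \<in> hcomp Y' b" using * f g by auto
    have car: "x \<in> carrier X" "y \<in> carrier Y" using * gr by auto
    show "fn (ups_map X' Y' \<bullet>\<^sub>g conj_map (tensor_map f g)) s
      = fn (tensor_map (conj_map g) (conj_map f) \<bullet>\<^sub>g ups_map X Y) s"
      using f g gr car
      by (simp add: s fn_ups_map[OF gr(1,3) *] fn_ups_map[OF gr(2,4) **])
  qed (use f g gr in auto)
qed

lemma ups_map_assoc:
  assumes gr: "graded_space X" "graded_space Y" "graded_space Z"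
  shows "assoc_map (conj_space Z) (conj_space Y) (conj_space X) \<bullet>\<^sub>g tensor_map (ups_map Y Z) (gid (conj_space X))
      \<bullet>\<^sub>g ups_map X (tensor_space Y Z) \<bullet>\<^sub>g conj_map (assoc_map X Y Z)
    = tensor_map (gid (conj_space Z)) (ups_map X Y) \<bullet>\<^sub>g ups_map (tensor_space X Y) Z" (is "?l = ?r")
proof (rule garrow_eqI)
  show "spanning (conj_space (tensor_space (tensor_space X Y) Z))
      {pure_tensor (tensor_space X Y) Z (pure_tensor X Y u v) w |u v w. u \<in> homog X \<and> v \<in> homog Y \<and> w \<in> homog Z}"
    (is "spanning _ ?S")
    using spanning_homog_tensor3[OF gr] by simp
  fix s assume "s \<in> ?S"
  then obtain x y z a b c where s: "s = pure_tensor (tensor_space X Y) Z (pure_tensor X Y x y) z"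
    and x: "x \<in> hcomp X a" and y: "y \<in> hcomp Y b" and z: "z \<in> hcomp Z c"
    by (auto simp: homog_def)
  have car: "x \<in> carrier X" "y \<in> carrier Y" "z \<in> carrier Z" using x y z gr by auto
  have T: "graded_space (tensor_space X Y)" "graded_space (tensor_space Y Z)" using gr by auto
  have c: "x \<in> hcomp (conj_space X) a" "y \<in> hcomp (conj_space Y) b" "z \<in> hcomp (conj_space Z) c"
    "graded_space (conj_space X)" "graded_space (conj_space Y)" "graded_space (conj_space Z)"
    using x y z gr by auto
  note eqs = fn_assoc_map[OF gr x y z] fn_ups_map[OF gr(1) T(2) x pure_tensor_in_hcomp[OF y z]]
    fn_ups_map[OF gr(2,3) y z] fn_assoc_map[OF c(6,5,4,3,2,1)]
    fn_ups_map[OF T(1) gr(3) pure_tensor_in_hcomp[OF x y] z] fn_ups_map[OF gr(1,2) x y]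
  \<comment> \<open>The two associators contribute signs with reversed arguments, which coincide and
    cancel; what remains is the cocycle identity of \<open>ups_sign\<close>.\<close>
  have coeff: "oct_phi a b c * (ups_sign a (b + c) * (ups_sign b c * oct_phi c b a))
      = ups_sign (a + b) c * ups_sign a b"
  proof -
    have "oct_phi a b c * (ups_sign a (b + c) * (ups_sign b c * oct_phi c b a))
        = (oct_phi a b c * oct_phi a b c) * (ups_sign b c * ups_sign a (b + c))"
      by (simp only: oct_phi_rev[of c b a] ac_simps)
    then show ?thesis by (simp add: ups_sign_cocycle mult.commute)
  qed
  show "fn ?l s = fn ?r s"
    using gr car T coeff
    by (simp add: s eqs fn_ups_map_smult pure_tensor_smult mult.assoc)
qed (use gr in auto)

text \<open>\<open>conj_map star_map\<close> stands for the inverse of the star. The sign is 1 when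
  one factor has degree 0, and the star fixes the scalar 1, so only the swap of the factors is
  left.\<close>

lemma ups_map_unit:
  assumes X: "graded_space X"
  shows "tensor_map (conj_map star_map) (gid (conj_space X)) \<bullet>\<^sub>g ups_map X unit_space \<bullet>\<^sub>g conj_map (lunit_map X)
      = runit_map (conj_space X)" (is "?l = ?r")
    and "tensor_map (gid (conj_space X)) (conj_map star_map) \<bullet>\<^sub>g ups_map unit_space X \<bullet>\<^sub>g conj_map (runit_map X)
      = lunit_map (conj_space X)" (is "?l' = ?r'")
proof -
  have S: "spanning (conj_space X) (homog X)" using spanning_homog[OF X] by simp
  have eqs: "fn ?l s = fn ?r s" "fn ?l' s = fn ?r' s" if s: "s \<in> homog X" for s
  proof -
    obtain a where a: "s \<in> hcomp X a" using s by (auto simp: homog_def)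
    have car: "s \<in> carrier X" using a X by auto
    show "fn ?l s = fn ?r s" "fn ?l' s = fn ?r' s"
      using X car
      by (simp_all add: fn_ups_map[OF X graded_unit_space a hcomp_unit_space(1)]
          fn_ups_map[OF graded_unit_space X hcomp_unit_space(1) a])
  qed
  show "?l = ?r" by (rule garrow_eqI[OF _ _ _ _ _ _ S eqs(1)]) (use X in auto)
  show "?l' = ?r'" by (rule garrow_eqI[OF _ _ _ _ _ _ S eqs(2)]) (use X in auto)
qed

interpretation graded: bar_cat graded_bar_cat
proof unfold_locales
  fix X :: "'a gvec gspace" assume "X \<in> Obj graded_bar_cat"
  then have X: "graded_space X" by simp
  have "gid X \<in> Iso graded_bar_cat X X"
    by (rule Iso_graded_bar_cat[OF _ _ _ _ _ _ spanning_homog[OF X] _ spanning_homog[OF X], where g = "gid X"])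
      (use X homog_in_carrier[OF X] in auto)
  then show "bb graded_bar_cat X \<in> Iso graded_bar_cat X (barO graded_bar_cat (barO graded_bar_cat X))"
    by (simp add: bb_map_eq)
  show "barA graded_bar_cat (bb graded_bar_cat X) = bb graded_bar_cat (barO graded_bar_cat X)"
    using X by (auto simp: bb_map_eq intro!: garrow_eqI')
  show "barA graded_bar_cat (Idn graded_bar_cat X) = Idn graded_bar_cat (barO graded_bar_cat X)"
    using X by (auto intro!: garrow_eqI')
  show "inv_arr graded_bar_cat (starI graded_bar_cat) \<boxdot>\<^bsub>graded_bar_cat\<^esub> Idn graded_bar_cat (barO graded_bar_cat X)
      \<cdot>\<^bsub>graded_bar_cat\<^esub> \<Upsilon>\<^bsub>graded_bar_cat\<^esub> X \<I>\<^bsub>graded_bar_cat\<^esub> \<cdot>\<^bsub>graded_bar_cat\<^esub> barA graded_bar_cat (lunit graded_bar_cat X)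
      = runit graded_bar_cat (barO graded_bar_cat X)"
    "Idn graded_bar_cat (barO graded_bar_cat X) \<boxdot>\<^bsub>graded_bar_cat\<^esub> inv_arr graded_bar_cat (starI graded_bar_cat)
      \<cdot>\<^bsub>graded_bar_cat\<^esub> \<Upsilon>\<^bsub>graded_bar_cat\<^esub> \<I>\<^bsub>graded_bar_cat\<^esub> X \<cdot>\<^bsub>graded_bar_cat\<^esub> barA graded_bar_cat (runit graded_bar_cat X)
      = lunit graded_bar_cat (barO graded_bar_cat X)"
    using X by (simp_all add: graded.inv_arr_eq[OF inv_star_map] ups_map_unit)
next
  fix f :: "'a gvec garrow" and X Y assume "f \<in> Hom graded_bar_cat X Y"
  then have *: "graded_map f" "src f = X" "tgt f = Y" by auto
  then have gr: "graded_space X" "graded_space Y"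
    using graded_map_src graded_map_tgt by blast+
  have "gid Y \<bullet>\<^sub>g f = conj_map (conj_map f) \<bullet>\<^sub>g gid X"
    by (rule garrow_eqI'; use * gr in simp)
  then show "bb graded_bar_cat Y \<cdot>\<^bsub>graded_bar_cat\<^esub> f
      = barA graded_bar_cat (barA graded_bar_cat f) \<cdot>\<^bsub>graded_bar_cat\<^esub> bb graded_bar_cat X"
    by (simp add: bb_map_eq)
next
  fix f g :: "'a gvec garrow" and X Y Z
  assume "f \<in> Hom graded_bar_cat X Y" "g \<in> Hom graded_bar_cat Y Z"
  then show "barA graded_bar_cat (g \<cdot>\<^bsub>graded_bar_cat\<^esub> f) = barA graded_bar_cat g \<cdot>\<^bsub>graded_bar_cat\<^esub> barA graded_bar_cat f"
    by (auto intro!: garrow_eqI')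
next
  show "starI graded_bar_cat \<in> Iso graded_bar_cat \<I>\<^bsub>graded_bar_cat\<^esub> (barO graded_bar_cat \<I>\<^bsub>graded_bar_cat\<^esub>)"
    using inv_star_map by (auto simp: Iso_def)
  have "conj_map star_map \<bullet>\<^sub>g star_map = (gid unit_space :: 'a gvec garrow)"
    using inv_star_map[where 'a = 'a] by (simp add: is_inverse_def)
  then show "barA graded_bar_cat (starI graded_bar_cat) \<cdot>\<^bsub>graded_bar_cat\<^esub> starI graded_bar_cat
      = (bb graded_bar_cat \<I>\<^bsub>graded_bar_cat\<^esub> :: 'a gvec garrow)"
    by (simp add: bb_map_eq)
qed (simp_all add: ups_map_Iso ups_map_natural ups_map_assoc)

section \<open>The octonions\<close>

lemma octonions_simps [simp]:
  "carrier octonions = range Func" "\<zero>\<^bsub>octonions\<^esub> = Func (\<lambda>x. 0)"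
  "u \<oplus>\<^bsub>octonions\<^esub> v = Func (\<lambda>x. func_of u x + func_of v x)"
  "c \<odot>\<^bsub>octonions\<^esub> v = Func (\<lambda>x. c * func_of v x)"
  "hcomp octonions a = range (\<lambda>c. Func (\<lambda>x. c * delta a x))"
  by (simp_all add: octonions_def)

lemma vs_octonions: "vs octonions"
  by (rule vsI) (auto simp: algebra_simps)

lemma oct_e_in_hcomp: "(oct_e a :: 'a gvec) \<in> hcomp octonions a"
  by (auto simp: oct_e_def intro!: image_eqI[of _ _ 1])

lemma delta_sum: "(\<Sum>a\<in>UNIV. f a * delta a x) = f x"
  by (simp add: delta_def if_distrib[of "(*) _"] cong: if_cong)

lemma spanning_oct_e: "spanning (octonions :: 'a gvec gspace) (range oct_e)"
proof -
  let ?O = "octonions :: 'a gvec gspace"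
  \<comment> \<open>The abstract sum in the module is identified with the pointwise sum of
    coefficient functions.\<close>
  have *: "(\<Oplus>\<^bsub>octonions\<^esub>a\<in>A. Func (\<lambda>x. f a * delta a x)) = (Func (\<lambda>x. \<Sum>a\<in>A. f a * delta a x) :: 'a gvec)"
    if "finite A" for A :: "G set" and f
    using that
  proof (induction A rule: finite_induct)
    case empty
    show ?case by (simp add: abelian_monoid.finsum_empty[OF vs_abelian_monoid[OF vs_octonions]])
  next
    case (insert a A)
    then show ?case
      by (subst abelian_monoid.finsum_insert[OF vs_abelian_monoid[OF vs_octonions]]) auto
  qed
  have "Func f \<in> span_of ?O (range oct_e)" for f
  proof -
    have "c \<odot>\<^bsub>?O\<^esub> oct_e a \<in> span_of ?O (range oct_e)" for c a
      by (intro span_of.smult span_of.base) simp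
    then have "Func (\<lambda>x. f a * delta a x) \<in> span_of ?O (range oct_e)" for a
      by (simp add: oct_e_def)
    then have "(\<Oplus>\<^bsub>?O\<^esub>a\<in>UNIV. Func (\<lambda>x. f a * delta a x)) \<in> span_of ?O (range oct_e)"
      by (intro span_of_finsum[OF vs_octonions]) (auto simp: oct_e_def)
    then show ?thesis by (simp add: * delta_sum)
  qed
  then show ?thesis by (auto simp: spanning_def oct_e_def)
qed

lemma graded_octonions [simp]: "graded_space octonions"
proof (rule graded_spaceI[OF vs_octonions, where P = "\<lambda>a v. Func (\<lambda>x. func_of v a * delta a x)"])
  have sub: "homog octonions \<subseteq> carrier (octonions :: 'a gvec gspace)" by (auto simp: homog_def)
  have "range oct_e \<subseteq> homog (octonions :: 'a gvec gspace)"
    using oct_e_in_hcomp unfolding homog_def by blast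
  then show "spanning octonions (homog (octonions :: 'a gvec gspace))"
    by (rule spanning_mono[OF vs_octonions spanning_oct_e _ sub])
  show "subspace_of octonions (hcomp (octonions :: 'a gvec gspace) a)" for a
    unfolding subspace_of_def
  proof (intro conjI ballI allI)
    fix x y :: "'a gvec" and c
    assume x: "x \<in> hcomp octonions a"
    then obtain k where k: "x = Func (\<lambda>x. k * delta a x)" by auto
    show "c \<odot>\<^bsub>octonions\<^esub> x \<in> hcomp octonions a"
      by (auto simp: k intro!: image_eqI[of _ _ "c * k"])
    assume "y \<in> hcomp octonions a"
    then obtain l where l: "y = Func (\<lambda>x. l * delta a x)" by auto
    show "x \<oplus>\<^bsub>octonions\<^esub> y \<in> hcomp octonions a"
      by (auto simp: k l algebra_simps intro!: image_eqI[of _ _ "k + l"])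
  qed (auto intro!: image_eqI[of _ _ 0])
  show "linear_on octonions octonions (\<lambda>v. Func (\<lambda>x. func_of v a * delta a x) :: 'a gvec)" for a
    by (auto simp: linear_on_def algebra_simps)
  show "Func (\<lambda>x. func_of v a * delta a x) = (if a = b then v else \<zero>\<^bsub>octonions\<^esub>)"
    if "v \<in> hcomp octonions b" for v :: "'a gvec" and a b
    using that by (auto simp: delta_def fun_eq_iff)
qed auto

lemma oct_e_in_carrier [simp]: "oct_e a \<in> carrier octonions" "oct_e a \<in> range Func"
  by (simp_all add: oct_e_def)

lemma oct_product_exists:
  "graded_map (oct_product :: 'a gvec garrow)
    \<and> src (oct_product :: 'a gvec garrow) = tensor_space octonions octonions
    \<and> tgt (oct_product :: 'a gvec garrow) = octonions
    \<and> (\<forall>a b. fn oct_product (pure_tensor octonions octonions (oct_e a) (oct_e b :: 'a gvec))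
      = oct_F a b \<odot>\<^bsub>octonions\<^esub> oct_e (a + b))"
proof -
  let ?O = "octonions :: 'a gvec gspace"
  \<comment> \<open>A twisted convolution: the coefficient at \<open>x\<close> collects the pairs of
    degrees with sum \<open>x\<close>. The partner of \<open>a\<close> is \<open>a + x\<close>, as
    subtraction and addition coincide in the group.\<close>
  let ?\<beta> = "\<lambda>u v :: 'a gvec. Func (\<lambda>x. \<Sum>a\<in>UNIV. oct_F a (a + x) * (func_of u a * func_of v (a + x)))"
  have bil: "bilinear_on ?O ?O ?O ?\<beta>"
    by (auto simp: bilinear_on_def linear_on_def sum_distrib_left sum.distrib algebra_simps)
  note lin = linear_on_tensor_lift[OF vs_octonions vs_octonions vs_octonions bil]
  let ?h = "tensor_lift ?O ?\<beta>"
  have eq: "?h (pure_tensor ?O ?O (oct_e a) (oct_e b)) = oct_F a b \<odot>\<^bsub>?O\<^esub> oct_e (a + b)" for a b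
  proof -
    have "(\<Sum>c\<in>UNIV. oct_F c (c + x) * (delta a c * delta b (c + x))) = oct_F a b * delta (a + b) x" for x
    proof -
      have "(\<Sum>c\<in>UNIV. oct_F c (c + x) * (delta a c * delta b (c + x)))
          = (\<Sum>c\<in>UNIV. if c = a then oct_F a (a + x) * delta b (a + x) else 0)"
        by (rule sum.cong) (auto simp: delta_def)
      moreover have "a + x = b \<longleftrightarrow> x = a + b" by auto
      ultimately show ?thesis by (auto simp: delta_def)
    qed
    then show ?thesis
      by (subst tensor_lift_pure[OF vs_octonions vs_octonions vs_octonions bil]) (simp_all add: oct_e_def)
  qed
  have span: "spanning (tensor_space ?O ?O) {pure_tensor ?O ?O s t |s t. s \<in> range oct_e \<and> t \<in> range oct_e}"
    by (intro spanning_pure_tensor vs_octonions spanning_oct_e)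
  have gr: "graded_space (tensor_space ?O ?O)" by simp
  let ?f = "mk_garrow (tensor_space ?O ?O) ?O ?h"
  have car: "pure_tensor ?O ?O (oct_e a) (oct_e b) \<in> carrier (tensor_space ?O ?O)" for a b
    by (intro pure_tensor_in_carrier vs_octonions oct_e_in_carrier)
  have f: "graded_map ?f"
  proof (rule graded_map_mk_garrow[OF gr graded_octonions lin],
      rule hcomp_preserved[OF gr graded_octonions lin span])
    fix s assume "s \<in> {pure_tensor ?O ?O s t |s t. s \<in> range oct_e \<and> t \<in> range oct_e}"
    then obtain a b where s: "s = pure_tensor ?O ?O (oct_e a) (oct_e b)" by auto
    show "\<exists>b. s \<in> hcomp (tensor_space ?O ?O) b \<and> ?h s \<in> hcomp ?O b"
      unfolding s eq
      using pure_tensor_in_hcomp[OF oct_e_in_hcomp oct_e_in_hcomp, of a b]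
        hcomp_simps(3)[OF graded_octonions oct_e_in_hcomp, of "oct_F a b" "a + b"] by blast
  qed
  have oct_product_eq: "oct_product = ?f"
    unfolding oct_product_def
    by (rule the_graded_map_eq[OF f _ _ _ span]) (use car eq in auto)
  show ?thesis unfolding oct_product_eq using f car eq by simp
qed

lemma oct_product_simps [simp]:
  "graded_map oct_product" "src oct_product = tensor_space octonions octonions" "tgt oct_product = octonions"
  using oct_product_exists by auto

lemma fn_oct_product:
  "fn oct_product (pure_tensor octonions octonions (oct_e a) (oct_e b)) = oct_F a b \<odot>\<^bsub>octonions\<^esub> oct_e (a + b)"
  using oct_product_exists by blast

text \<open>In coordinates the star is complex conjugation of the coefficients. Delta functions are
  real and \<open>- a = a\<close>, so every \<open>oct_e a\<close> is fixed.\<close>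

lemma oct_star_exists:
  "graded_map (oct_star :: 'a gvec garrow) \<and> src (oct_star :: 'a gvec garrow) = octonions
    \<and> tgt (oct_star :: 'a gvec garrow) = conj_space octonions
    \<and> (\<forall>a. fn oct_star (oct_e a :: 'a gvec) = oct_e (- a))"
proof -
  let ?O = "octonions :: 'a gvec gspace"
  let ?h = "\<lambda>v :: 'a gvec. Func (\<lambda>x. cnj (func_of v x)) :: 'a gvec"
  have eq: "?h (oct_e a) = oct_e a" for a
    by (auto simp: oct_e_def delta_def)
  have lin: "linear_on ?O (conj_space ?O) ?h"
    by (auto simp: linear_on_def)
  have gr: "graded_space (conj_space ?O)" by simp
  let ?f = "mk_garrow ?O (conj_space ?O) ?h"
  have f: "graded_map ?f"
  proof (rule graded_map_mk_garrow[OF graded_octonions gr lin],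
      rule hcomp_preserved[OF graded_octonions gr lin spanning_oct_e])
    fix s :: "'a gvec" assume "s \<in> range oct_e"
    then obtain a where s: "s = oct_e a" by auto
    show "\<exists>b. s \<in> hcomp ?O b \<and> ?h s \<in> hcomp (conj_space ?O) b"
      unfolding s eq conj_space_simps using oct_e_in_hcomp by blast
  qed
  have oct_star_eq: "oct_star = ?f"
    unfolding oct_star_def
    by (rule the_graded_map_eq[OF f _ _ _ spanning_oct_e]) (auto simp: eq simp del: octonions_simps)
  show ?thesis unfolding oct_star_eq using f eq by (simp del: octonions_simps)
qed

lemma oct_star_simps [simp]:
  "graded_map oct_star" "src oct_star = octonions" "tgt oct_star = conj_space octonions"
  "fn oct_star (oct_e a) = oct_e a"
  using oct_star_exists by auto

lemma oct_unit_simps [simp]: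
  "graded_map oct_unit" "src oct_unit = unit_space" "tgt oct_unit = octonions" "fn oct_unit (Scalar 1) = oct_e 0"
proof -
  show "graded_map oct_unit"
    unfolding oct_unit_def
    by (rule graded_map_mk_garrow)
      (auto simp: linear_on_def oct_e_def, auto simp: unit_space_def algebra_simps split: if_splits
        intro!: image_eqI[of _ _ 0])
qed (simp_all add: oct_unit_def oct_e_def)

lemma spanning_oct_e_tensor:
  "spanning (tensor_space octonions octonions) {pure_tensor octonions octonions (oct_e a) (oct_e b) |a b. True}"
proof -
  have "spanning (tensor_space octonions octonions)
      {pure_tensor octonions octonions s t |s t. s \<in> range oct_e \<and> t \<in> range oct_e}"
    by (intro spanning_pure_tensor vs_octonions spanning_oct_e)
  also have "\<dots> = {pure_tensor octonions octonions (oct_e a) (oct_e b) |a b. True}" by auto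
  finally show ?thesis .
qed

lemma spanning_oct_e_tensor3:
  "spanning (tensor_space (tensor_space octonions octonions) octonions)
    {pure_tensor (tensor_space octonions octonions) octonions (pure_tensor octonions octonions (oct_e a) (oct_e b)) (oct_e c) |a b c. True}"
proof -
  have "spanning (tensor_space (tensor_space octonions octonions) octonions)
      {pure_tensor (tensor_space octonions octonions) octonions s t |s t.
        s \<in> {pure_tensor octonions octonions (oct_e a) (oct_e b) |a b. True} \<and> t \<in> range oct_e}"
    by (intro spanning_pure_tensor vs_tensor vs_octonions spanning_oct_e spanning_oct_e_tensor)
  also have "\<dots> = {pure_tensor (tensor_space octonions octonions) octonions
      (pure_tensor octonions octonions (oct_e a) (oct_e b)) (oct_e c) |a b c. True}" by auto
  finally show ?thesis .
qed

lemma oct_product_assoc: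
  "oct_product \<bullet>\<^sub>g tensor_map oct_product (gid octonions)
    = oct_product \<bullet>\<^sub>g tensor_map (gid octonions) oct_product \<bullet>\<^sub>g assoc_map octonions octonions octonions"
    (is "?l = ?r")
proof (rule garrow_eqI[OF _ _ _ _ _ _ spanning_oct_e_tensor3])
  fix s :: "'a gvec"
  assume "s \<in> {pure_tensor (tensor_space octonions octonions) octonions
    (pure_tensor octonions octonions (oct_e a) (oct_e b)) (oct_e c) |a b c. True}"
  then obtain a b c where s: "s = pure_tensor (tensor_space octonions octonions) octonions
    (pure_tensor octonions octonions (oct_e a) (oct_e b)) (oct_e c)" by auto
  note [simp del] = octonions_simps
  \<comment> \<open>The defining equation of \<open>oct_phi\<close>, solved for the coefficient of
    the left bracketing.\<close>
  have "oct_F a b * oct_F (a + b) c = oct_phi a b c * (oct_F b c * oct_F a (b + c))"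
    by (simp add: oct_phi_prod ac_simps)
  then show "fn ?l s = fn ?r s"
    by (simp add: s fn_oct_product pure_tensor_smult vs_octonions add.assoc
        fn_assoc_map[OF graded_octonions graded_octonions graded_octonions oct_e_in_hcomp oct_e_in_hcomp oct_e_in_hcomp])
qed simp_all

lemma oct_star_product:
  "conj_map oct_product \<bullet>\<^sub>g conj_map (ups_map (conj_space octonions) (conj_space octonions)) \<bullet>\<^sub>g tensor_map oct_star oct_star
    = oct_star \<bullet>\<^sub>g oct_product" (is "?l = ?r")
proof (rule garrow_eqI[OF _ _ _ _ _ _ spanning_oct_e_tensor])
  fix s :: "'a gvec"
  assume "s \<in> {pure_tensor octonions octonions (oct_e a) (oct_e b) |a b. True}"
  then obtain a b where s: "s = pure_tensor octonions octonions (oct_e a) (oct_e b)" by auto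
  note [simp del] = octonions_simps
  have e: "oct_e a \<in> hcomp (conj_space octonions) a" for a
    by (simp add: oct_e_in_hcomp)
  \<comment> \<open>The inverse of \<Upsilon> swaps the factors, so the product on the left is taken
    in the order \<open>b\<close>, \<open>a\<close>; the commutation sign turns its coefficient back
    into \<open>oct_F a b\<close>.\<close>
  have "ups_sign a b * oct_F b a = oct_F a b"
    by (simp add: ups_sign_eq mult.assoc)
  then show "fn ?l s = fn ?r s"
    by (simp add: s fn_oct_product vs_octonions add.commute
        fn_ups_map[OF graded_conj_space graded_conj_space e e])
qed simp_all

interpretation oct: star_algebra graded_bar_cat octonions oct_product oct_unit oct_star
proof unfold_locales
  note [simp del] = octonions_simps
  note e = garrow_eqI[OF _ _ _ _ _ _ spanning_oct_e]
  show "octonions \<in> Obj graded_bar_cat" "oct_product \<in> Hom graded_bar_cat (octonions \<boxtimes>\<^bsub>graded_bar_cat\<^esub> octonions) octonions"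
    "oct_unit \<in> Hom graded_bar_cat \<I>\<^bsub>graded_bar_cat\<^esub> octonions"
    "oct_star \<in> Hom graded_bar_cat octonions (barO graded_bar_cat octonions)"
    by simp_all
  \<comment> \<open>The unit laws hold because the cochain is normalised:
    \<open>oct_F a 0 = 1\<close> and \<open>oct_F 0 a = 1\<close>.\<close>
  have "oct_product \<bullet>\<^sub>g tensor_map (gid octonions) oct_unit \<bullet>\<^sub>g lunit_map octonions = gid octonions"
    by (rule e) (auto simp: fn_oct_product vs_octonions)
  then show "oct_product \<cdot>\<^bsub>graded_bar_cat\<^esub> (Idn graded_bar_cat octonions \<boxdot>\<^bsub>graded_bar_cat\<^esub> oct_unit)
      \<cdot>\<^bsub>graded_bar_cat\<^esub> lunit graded_bar_cat octonions = Idn graded_bar_cat octonions"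
    by simp
  have "oct_product \<bullet>\<^sub>g tensor_map oct_unit (gid octonions) \<bullet>\<^sub>g runit_map octonions = gid octonions"
    by (rule e) (auto simp: fn_oct_product vs_octonions)
  then show "oct_product \<cdot>\<^bsub>graded_bar_cat\<^esub> (oct_unit \<boxdot>\<^bsub>graded_bar_cat\<^esub> Idn graded_bar_cat octonions)
      \<cdot>\<^bsub>graded_bar_cat\<^esub> runit graded_bar_cat octonions = Idn graded_bar_cat octonions"
    by simp
  have "conj_map oct_star \<bullet>\<^sub>g oct_star = gid octonions"
    by (rule e) auto
  then show "barA graded_bar_cat oct_star \<cdot>\<^bsub>graded_bar_cat\<^esub> oct_star = bb graded_bar_cat octonions"
    by (simp add: bb_map_eq)
  have "conj_map oct_unit \<bullet>\<^sub>g star_map = oct_star \<bullet>\<^sub>g oct_unit"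
    by (rule garrow_eqI[OF _ _ _ _ _ _ spanning_unit_space]) auto
  then show "barA graded_bar_cat oct_unit \<cdot>\<^bsub>graded_bar_cat\<^esub> starI graded_bar_cat = oct_star \<cdot>\<^bsub>graded_bar_cat\<^esub> oct_unit"
    by simp
  show "barA graded_bar_cat oct_product \<cdot>\<^bsub>graded_bar_cat\<^esub> inv_arr graded_bar_cat (\<Upsilon>\<^bsub>graded_bar_cat\<^esub> octonions octonions)
      \<cdot>\<^bsub>graded_bar_cat\<^esub> (oct_star \<boxdot>\<^bsub>graded_bar_cat\<^esub> oct_star)
      = (oct_star \<cdot>\<^bsub>graded_bar_cat\<^esub> oct_product :: 'a gvec garrow)"
    using graded.inv_arr_eq[OF inv_ups_map[OF graded_octonions[where 'a = 'a] graded_octonions[where 'a = 'a]]]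
    by (simp add: oct_star_product)
qed (simp add: oct_product_assoc)

text \<open>In a group of exponent 2 \<open>starS\<close> fixes each delta function, and the values
  of the cochain are real. The antilinear map therefore reproduces the expansion of the cochain in
  the basis of delta functions.\<close>

lemma oct_F_real: "antilinear_tensor starS starS (\<lambda>(a, b). oct_F a b) = (\<lambda>(a, b). oct_F a b)"
proof -
  have "(\<Sum>a\<in>UNIV. \<Sum>b\<in>UNIV. oct_F a b * (delta a x * delta b y)) = oct_F x y" for x y
  proof -
    have "(\<Sum>a\<in>UNIV. \<Sum>b\<in>UNIV. oct_F a b * (delta a x * delta b y))
        = (\<Sum>a\<in>UNIV. (\<Sum>b\<in>UNIV. oct_F a b * delta b y) * delta a x)"
      by (simp add: sum_distrib_left sum_distrib_right ac_simps)
    then show ?thesis by (simp only: delta_sum)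
  qed
  then show ?thesis
    by (auto simp: antilinear_tensor_def starS_delta tensor_H_def)
qed

theorem proposition5p9:
  fixes C :: "('a gvec gspace, 'a gvec garrow) bar_struct"
  assumes C_def: "C = graded_bar_cat"
  shows "antilinear_tensor starS starS (\<lambda>(a, b). oct_F a b) = (\<lambda>(a, b). oct_F a b)
    \<and> bar_cat C
    \<and> (\<forall>V\<in>Obj C. \<forall>v\<in>carrier V. fn (bb C V) v = v)
    \<and> (\<forall>V\<in>Obj C. \<forall>W\<in>Obj C. \<forall>a b. \<forall>v\<in>hcomp V a. \<forall>w\<in>hcomp W b.
         fn (Ups C V W) (pure_tensor V W v w)
         = (if a \<noteq> 0 \<and> b \<noteq> 0 \<and> a \<noteq> b then - 1 else 1)
             \<odot>\<^bsub>tensor_space (conj_space W) (conj_space V)\<^esub>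
             pure_tensor (conj_space W) (conj_space V) w v)
    \<and> star_algebra C octonions oct_product oct_unit oct_star
    \<and> (\<forall>a. fn oct_star (oct_e a :: 'a gvec) = oct_e (- a))"
  unfolding C_def
proof (intro conjI)
  show "\<forall>V\<in>Obj graded_bar_cat. \<forall>W\<in>Obj graded_bar_cat. \<forall>a b. \<forall>v\<in>hcomp V a. \<forall>w\<in>hcomp W b.
      fn (Ups graded_bar_cat V W) (pure_tensor V W v w)
      = (if a \<noteq> 0 \<and> b \<noteq> 0 \<and> a \<noteq> b then - 1 else 1)
          \<odot>\<^bsub>tensor_space (conj_space W) (conj_space V)\<^esub>
          pure_tensor (conj_space W) (conj_space V) w (v :: 'a gvec)"
    \<comment> \<open>The explicit sign is folded back into \<open>ups_sign\<close>, the form in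
      which the values of \<Upsilon> are known.\<close>
    unfolding ups_sign_def[symmetric] graded_bar_cat_simps
    by (intro ballI allI fn_ups_map) auto
qed (simp_all add: oct_F_real graded.bar_cat_axioms oct.star_algebra_axioms)

end
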